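(* There exists a potential $V:\mathbb{N}\to\mathbb{R}$ such that the discrete Schr\"odinger operator $H$ on $\ell^2(\mathbb{N})$ with potential $V$ satisfies: (1) $\sigma_{\mathrm{ess}}(H)=[-2,2]$; (2) for every $\lambda\in\mathbb{R}$, the spectral measure $\mu_\lambda$ of $\delta_1$ with respect to $H_\lambda:=H+\lambda\langle\delta_1,\cdot\rangle\delta_1$ is non-Rajchman, i.e. $\widehat{\mu_\lambda}(t)$ does not tend to $0$ as $|t|\to\infty$.
   Context: Here $\mathbb{N}=\{1,2,3,\dots\}$. Given $V:\mathbb{N}\to\mathbb{R}$, the (half-line, discrete) Schr\"odinger operator $H$ on $\ell^2(\mathbb{N})$ with potential $V$ is given by $(H\psi)(n)=\psi(n-1)+\psi(n+1)+V(n)\psi(n)$ for $n>1$ and $(H\psi)(1)=\psi(2)+V(1)\psi(1)$. $V$ may be unbounded; for every $\lambda\in\mathbb{R}$ the operator $H_\lambda=H+\lambda\langle\delta_1,\cdot\rangle\delta_1$ is essentially self-adjoint on finitely supported sequences, and $H_\lambda$ denotes its self-adjoint closure (equivalently, the operator on the maximal domain of $\psi\in\ell^2(\mathbb{N})$ for which the formula gives an element of $\ell^2(\mathbb{N})$); $H=H_0$. $\delta_1$ is the sequence with $\delta_1(1)=1$ and $\delta_1(n)=0$ for $n\ne1$. $\mu_\lambda$ is the spectral measure of $\delta_1$ for $H_\lambda$, i.e. the Borel probability measure on $\mathbb{R}$ with $\langle\delta_1,f(H_\lambda)\delta_1\rangle=\int f\,d\mu_\lambda$ for bounded Borel $f$.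 For a finite Borel measure $\mu$ on $\mathbb{R}$, $\widehat{\mu}(t)=\int e^{-itE}\,d\mu(E)$; $\mu$ is called Rajchman if $\widehat{\mu}(t)\to0$ as $|t|\to\infty$, and non-Rajchman otherwise. $\sigma_{\mathrm{ess}}$ denotes the essential spectrum. *)

theory Defs
  imports "HOL-Analysis.Analysis" "HOL-Probability.Probability"
begin

text \<open>Sequences indexed by $1, 2, 3, \dots$ are functions on \<^typ>\<open>nat\<close> whose (meaningless) entry
  at index 0 is fixed to be 0.\<close>

type_synonym cseq = "nat \<Rightarrow> complex"

definition ell2 :: "cseq set" where
  "ell2 = {\<psi>. \<psi> 0 = 0 \<and> summable (\<lambda>n. (cmod (\<psi> n))\<^sup>2)}"

definition l2_inner :: "cseq \<Rightarrow> cseq \<Rightarrow> complex" where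
  "l2_inner \<phi> \<psi> = (\<Sum>n. cnj (\<phi> n) * \<psi> n)"

definition l2_norm :: "cseq \<Rightarrow> real" where
  "l2_norm \<psi> = sqrt (\<Sum>n. (cmod (\<psi> n))\<^sup>2)"

definition l2_tendsto :: "(nat \<Rightarrow> cseq) \<Rightarrow> cseq \<Rightarrow> bool" where
  "l2_tendsto X \<psi> \<longleftrightarrow> (\<lambda>k. l2_norm (\<lambda>n. X k n - \<psi> n)) \<longlonglongrightarrow> 0"

definition delta1 :: cseq where
  "delta1 n = (if n = 1 then 1 else 0)"

text \<open>Possibly unbounded operators: a domain and an action. The action is only relevant on the
  domain.\<close>

datatype l2_operator = L2_Operator (op_dom: "cseq set") (op_app: "cseq \<Rightarrow> cseq")

definition schrodinger_formula :: "(nat \<Rightarrow> real) \<Rightarrow> cseq \<Rightarrow> cseq" where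
  "schrodinger_formula V \<psi> n =
     (if n = 0 then 0
      else if n = 1 then \<psi> 2 + of_real (V 1) * \<psi> 1
      else \<psi> (n - 1) + \<psi> (n + 1) + of_real (V n) * \<psi> n)"

text \<open>The self-adjoint operator is the formula on its maximal domain. The value of the potential at
  index 0 is never used.\<close>

definition schrodinger :: "(nat \<Rightarrow> real) \<Rightarrow> l2_operator" where
  "schrodinger V =
     L2_Operator {\<psi> \<in> ell2. schrodinger_formula V \<psi> \<in> ell2} (schrodinger_formula V)"

definition delta1_perturbation :: "l2_operator \<Rightarrow> real \<Rightarrow> l2_operator" where
  "delta1_perturbation A lam =
     L2_Operator (op_dom A) (\<lambda>\<psi> n. op_app A \<psi> n + of_real lam * l2_inner delta1 \<psi> * delta1 n)"

definition resolvent_set :: "l2_operator \<Rightarrow> complex set" where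
  "resolvent_set A =
     {z. bij_betw (\<lambda>\<psi> n. op_app A \<psi> n - z * \<psi> n) (op_dom A) ell2 \<and>
         (\<exists>C. \<forall>\<psi>\<in>op_dom A. l2_norm \<psi> \<le> C * l2_norm (\<lambda>n. op_app A \<psi> n - z * \<psi> n))}"

definition op_spectrum :: "l2_operator \<Rightarrow> complex set" where
  "op_spectrum A = - resolvent_set A"

definition eigenspace :: "l2_operator \<Rightarrow> complex \<Rightarrow> cseq set" where
  "eigenspace A z = {\<psi> \<in> op_dom A. op_app A \<psi> = (\<lambda>n. z * \<psi> n)}"

definition finitely_spanned :: "cseq set \<Rightarrow> bool" where
  "finitely_spanned S \<longleftrightarrow>
     (\<exists>N (b :: nat \<Rightarrow> cseq). \<forall>\<psi>\<in>S. \<exists>c :: nat \<Rightarrow> complex. \<psi> = (\<lambda>n. \<Sum>k<N. c k * b k n))"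

text \<open>For self-adjoint operators: the discrete spectrum consists of the isolated points of the
  spectrum that are eigenvalues of finite multiplicity, and the essential spectrum is the rest.\<close>

definition discrete_spectrum :: "l2_operator \<Rightarrow> complex set" where
  "discrete_spectrum A =
     {z. z isolated_in op_spectrum A \<and> eigenspace A z \<noteq> {\<lambda>n. 0} \<and> finitely_spanned (eigenspace A z)}"

definition essential_spectrum :: "l2_operator \<Rightarrow> complex set" where
  "essential_spectrum A = op_spectrum A - discrete_spectrum A"

definition bounded_borel :: "(real \<Rightarrow> complex) set" where
  "bounded_borel = {f. f \<in> borel_measurable borel \<and> bounded (range f)}"

text \<open>\<open>\<Phi> f\<close> is the bounded operator \<open>f(A)\<close>. The clauses are the usual characterization of the bounded
  Borel functional calculus of a self-adjoint operator (e.g. Reed and Simon, Theorem VIII.5): a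
  norm-contractive unital *-homomorphism into the bounded operators, normalized by the condition that
  approximating the identity function recovers \<open>A\<close>, and continuous under bounded pointwise
  convergence. It determines \<open>\<Phi> f \<psi>\<close> for bounded Borel \<open>f\<close> and square summable \<open>\<psi>\<close>; values at
  other arguments are irrelevant.\<close>

definition borel_functional_calculus ::
    "l2_operator \<Rightarrow> ((real \<Rightarrow> complex) \<Rightarrow> cseq \<Rightarrow> cseq) \<Rightarrow> bool" where
  "borel_functional_calculus A \<Phi> \<longleftrightarrow>
     (\<forall>f\<in>bounded_borel. \<forall>\<psi>\<in>ell2. \<Phi> f \<psi> \<in> ell2) \<and>
     (\<forall>f\<in>bounded_borel. \<forall>\<phi>\<in>ell2. \<forall>\<psi>\<in>ell2. \<forall>a b.
        \<Phi> f (\<lambda>n. a * \<phi> n + b * \<psi> n) = (\<lambda>n. a * \<Phi> f \<phi> n + b * \<Phi> f \<psi> n)) \<and>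
     (\<forall>f\<in>bounded_borel. \<forall>g\<in>bounded_borel. \<forall>a b. \<forall>\<psi>\<in>ell2.
        \<Phi> (\<lambda>x. a * f x + b * g x) \<psi> = (\<lambda>n. a * \<Phi> f \<psi> n + b * \<Phi> g \<psi> n)) \<and>
     (\<forall>f\<in>bounded_borel. \<forall>g\<in>bounded_borel. \<forall>\<psi>\<in>ell2. \<Phi> (\<lambda>x. f x * g x) \<psi> = \<Phi> f (\<Phi> g \<psi>)) \<and>
     (\<forall>\<psi>\<in>ell2. \<Phi> (\<lambda>x. 1) \<psi> = \<psi>) \<and>
     (\<forall>f\<in>bounded_borel. \<forall>\<phi>\<in>ell2. \<forall>\<psi>\<in>ell2.
        l2_inner \<phi> (\<Phi> (\<lambda>x. cnj (f x)) \<psi>) = l2_inner (\<Phi> f \<phi>) \<psi>) \<and>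
     (\<forall>f\<in>bounded_borel. \<forall>C. (\<forall>x. cmod (f x) \<le> C) \<longrightarrow> (\<forall>\<psi>\<in>ell2. l2_norm (\<Phi> f \<psi>) \<le> C * l2_norm \<psi>)) \<and>
     (\<forall>h. (\<forall>k. h k \<in> bounded_borel) \<and> (\<forall>x. (\<lambda>k. h k x) \<longlonglongrightarrow> of_real x) \<and>
          (\<forall>k x. cmod (h k x) \<le> \<bar>x\<bar>) \<longrightarrow>
        (\<forall>\<psi>\<in>op_dom A. l2_tendsto (\<lambda>k. \<Phi> (h k) \<psi>) (op_app A \<psi>))) \<and>
     (\<forall>h f C. (\<forall>k. h k \<in> bounded_borel) \<and> f \<in> bounded_borel \<and> (\<forall>x. (\<lambda>k. h k x) \<longlonglongrightarrow> f x) \<and>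
          (\<forall>k x. cmod (h k x) \<le> C) \<longrightarrow>
        (\<forall>\<psi>\<in>ell2. l2_tendsto (\<lambda>k. \<Phi> (h k) \<psi>) (\<Phi> f \<psi>)))"

definition is_spectral_measure :: "l2_operator \<Rightarrow> cseq \<Rightarrow> real measure \<Rightarrow> bool" where
  "is_spectral_measure A \<psi> \<mu> \<longleftrightarrow>
     sets \<mu> = sets borel \<and> finite_measure \<mu> \<and>
     (\<exists>\<Phi>. borel_functional_calculus A \<Phi> \<and>
          (\<forall>f\<in>bounded_borel. l2_inner \<psi> (\<Phi> f \<psi>) = (\<integral>x. f x \<partial>\<mu>)))"

definition spectral_measure :: "l2_operator \<Rightarrow> cseq \<Rightarrow> real measure" where
  "spectral_measure A \<psi> = (THE \<mu>. is_spectral_measure A \<psi> \<mu>)"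

definition measure_fourier :: "real measure \<Rightarrow> real \<Rightarrow> complex" where
  "measure_fourier \<mu> t = (\<integral>x. exp (- \<i> * of_real t * of_real x) \<partial>\<mu>)"

definition rajchman :: "real measure \<Rightarrow> bool" where
  "rajchman \<mu> \<longleftrightarrow> (measure_fourier \<mu> \<longlongrightarrow> 0) at_infinity"

end

theory Submission
  imports Defs "HOL-Computational_Algebra.Fundamental_Theorem_Algebra"
begin

text \<open>
  The potential is 0 except at the perfect squares \<open>m\<^sup>2\<close> with \<open>m \<ge> 2\<close>, where it has a barrier whose height
  grows faster than exponentially in the position.

  Essential spectrum: the gaps between the barriers get longer, so plane waves cut off to a gap show
  that \<open>[-2, 2]\<close> lies in the spectrum; none of its points is isolated. If \<open>\<bar>E\<bar> > 2\<close>, then far out every site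
  satisfies \<open>\<bar>V n - E\<bar> \<ge> \<bar>E\<bar>\<close>, because \<open>V n\<close> is 0 or huge. The hopping terms have norm at most 2, hence
  \<open>H - E\<close> is bounded below by \<open>\<bar>E\<bar> - 2\<close> on sequences that vanish at the first \<open>M\<close> sites
  (\<open>schrodinger_lower_bound_at_infinity\<close>). A spectral subspace for a short interval around \<open>E\<close> therefore has
  dimension at most \<open>M\<close> (\<open>few_charged_sets_outside_band\<close>), and \<open>E\<close> is a regular value or an isolated
  eigenvalue.

  Failure of the Rajchman property: seen from site 1, a barrier of height \<open>h\<close> at site \<open>N + 1\<close> cuts the half-line
  at \<open>N\<close>. The eigenvectors of the truncation to \<open>{1..N}\<close>, corrected by a term of size \<open>1/h\<close> at the barrier,
  are approximate eigenvectors of \<open>H\<close> with error \<open>O(1/h)\<close>, and they sum up to \<open>\<delta>\<^sub>1\<close>. Up to times much smaller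
  than \<open>h\<close> the Fourier transform of the spectral measure thus behaves like that of a probability measure on \<open>N\<close>
  points. By Dirichlet's theorem on simultaneous approximation, \<open>N\<close> phases all come back close to 1 at a time that
  is bounded in terms of \<open>N\<close> only, whatever the \<open>N\<close> points are; the barrier is built higher than
  this time (\<open>fourier_recurrence\<close>). Changing the coupling \<open>\<lambda>\<close> changes \<open>V 1\<close>, which enters the error bound but
  not the recurrence time, so the barrier at \<open>n\<close> works for all \<open>\<bar>\<lambda>\<bar> \<le> n\<close>.

  All this takes place in a concrete spectral representation. The solutions of the formal eigenvalue equation are the
  polynomials \<open>opoly V n\<close>. Gauss quadrature and a weak limit give a measure \<open>\<mu>\<close> for which they are orthonormal,
  and \<open>f(H)\<close> is defined by the matrix with entries \<open>\<integral> p\<^sub>m f p\<^sub>n d\<mu>\<close>. Self-adjointness enters through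
  \<open>green_identity\<close>: boundary terms of square summable sequences vanish, and so the
  matrix of \<open>1/(x - z)\<close> is the inverse of \<open>H - z\<close>. Since these kernels generate all bounded Borel functions
  (\<open>bounded_borel_monotone_class\<close>), the calculus is multiplicative and is the only one, and \<open>\<mu>\<close> is the
  spectral measure of \<open>\<delta>\<^sub>1\<close> (\<open>spectral_measure_eq\<close>).
\<close>

section \<open>Orthogonal polynomials and Gauss quadrature\<close>

text \<open>Gaussian elimination: if some vector has a nonzero entry at \<open>j\<close>, use it to clear the entry \<open>j\<close> of all the others and
  induct.\<close>

lemma exists_linear_dependency:
  fixes v :: "'i \<Rightarrow> 'j \<Rightarrow> 'a::field"
  assumes "finite J" "finite I" "card J < card I"
  shows "\<exists>a. (\<exists>i\<in>I. a i \<noteq> 0) \<and> (\<forall>j\<in>J. (\<Sum>i\<in>I. a i * v i j) = 0)"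
  using assms
proof (induction J arbitrary: I v rule: finite_induct)
  case empty
  then have "I \<noteq> {}" by auto
  then show ?case by (intro exI[of _ "\<lambda>_. 1"]) auto
next
  case (insert j J)
  show ?case
  proof (cases "\<forall>i\<in>I. v i j = 0")
    case True
    have "card J < card I" using insert by simp
    from insert.IH[OF insert.prems(1) this, of v] show ?thesis using True by auto
  next
    case False
    then obtain k where k: "k \<in> I" "v k j \<noteq> 0" by blast
    define u where "u i l = v i l - v i j / v k j * v k l" for i l
    have "card J < card (I - {k})" using insert k by simp
    from insert.IH[OF _ this, of u] insert.prems obtain a
      where a: "\<exists>i\<in>I-{k}. a i \<noteq> 0" "\<And>l. l \<in> J \<Longrightarrow> (\<Sum>i\<in>I-{k}. a i * u i l) = 0" by auto
    \<comment> \<open>The coefficient of the pivot \<open>k\<close> undoes the elimination.\<close>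
    define b where "b i = (if i = k then - (\<Sum>i\<in>I-{k}. a i * v i j / v k j) else a i)" for i
    have sum_b: "(\<Sum>i\<in>I. b i * v i l) = (\<Sum>i\<in>I-{k}. a i * u i l)" for l
    proof -
      have "(\<Sum>i\<in>I. b i * v i l) = b k * v k l + (\<Sum>i\<in>I-{k}. b i * v i l)"
        using k insert.prems by (subst sum.remove[of _ k]) auto
      also have "(\<Sum>i\<in>I-{k}. b i * v i l) = (\<Sum>i\<in>I-{k}. a i * v i l)"
        by (rule sum.cong) (auto simp: b_def)
      also have "b k * v k l + \<dots> = (\<Sum>i\<in>I-{k}. a i * u i l)"
        by (simp add: b_def u_def sum_distrib_right sum_distrib_left sum_subtractf sum_negf
            algebra_simps)
      finally show ?thesis .
    qed
    have "(\<Sum>i\<in>I-{k}. a i * u i j) = 0" using k by (simp add: u_def)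
    moreover have "\<exists>i\<in>I. b i \<noteq> 0" using a(1) by (auto simp: b_def)
    ultimately show ?thesis using a(2) by (intro exI[of _ b]) (auto simp: sum_b)
  qed
qed

text \<open>The solution of \<open>H \<psi> = z \<psi>\<close> as a recurrence, with \<open>\<psi> 0 = 0\<close> and \<open>\<psi> 1 = 1\<close>. As a polynomial in \<open>z\<close> the entry \<open>n + 1\<close>
  is the characteristic polynomial of the truncation of \<open>H\<close> to \<open>{1..n}\<close>.\<close>

fun opoly :: "(nat \<Rightarrow> real) \<Rightarrow> nat \<Rightarrow> 'a::real_normed_field \<Rightarrow> 'a" where
  "opoly V 0 z = 0"
| "opoly V (Suc 0) z = 1"
| "opoly V (Suc (Suc n)) z = (z - of_real (V (Suc n))) * opoly V (Suc n) z - opoly V n z"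

lemma opoly_of_real: "opoly V n (of_real x) = of_real (opoly V n x)"
  by (induction V n x rule: opoly.induct) auto

lemma opoly_cnj: "opoly V n (cnj z) = cnj (opoly V n z)"
  by (induction V n z rule: opoly.induct) auto

lemma opoly_recurrence:
  "1 \<le> n \<Longrightarrow> z * opoly V n z = opoly V (n - 1) z + opoly V (n + 1) z + of_real (V n) * opoly V n z"
  by (cases n) (auto simp: algebra_simps)

text \<open>The discrete Green formula for the solutions at \<open>z\<close> and \<open>w\<close>. It makes the truncated eigenvectors orthogonal
  and, with \<open>w\<close> the conjugate of \<open>z\<close>, the eigenvalues real.\<close>

lemma christoffel_darboux:
  "(z - w) * (\<Sum>n=1..N. opoly V n z * opoly V n w) =
     opoly V (Suc N) z * opoly V N w - opoly V N z * opoly V (Suc N) w"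
proof (induction N)
  case (Suc N)
  then show ?case by (simp add: algebra_simps)
qed auto

text \<open>The same recurrence as a formal polynomial, so that roots can be counted with multiplicity.\<close>

fun cpoly :: "(nat \<Rightarrow> real) \<Rightarrow> nat \<Rightarrow> complex poly" where
  "cpoly V 0 = 0"
| "cpoly V (Suc 0) = 1"
| "cpoly V (Suc (Suc n)) = [:- of_real (V (Suc n)), 1:] * cpoly V (Suc n) - cpoly V n"

lemma poly_cpoly: "poly (cpoly V n) z = opoly V n z"
  by (induction V n rule: cpoly.induct) (auto simp: algebra_simps)

lemma degree_cpoly: "degree (cpoly V (Suc n)) = n \<and> cpoly V (Suc n) \<noteq> 0"
proof (induction n rule: less_induct)
  case (less n)
  show ?case
  proof (cases n)
    case (Suc m)
    have m: "degree (cpoly V (Suc m)) = m" "cpoly V (Suc m) \<noteq> 0" using less Suc by auto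
    have "degree (cpoly V m) \<le> m"
      using less[of "m - 1"] Suc by (cases m) auto
    moreover have "degree ([:- of_real (V (Suc m)), 1:] * cpoly V (Suc m)) = Suc m"
      using m by (subst degree_mult_eq) auto
    ultimately have "degree (cpoly V (Suc (Suc m))) = Suc m"
      by (simp only: cpoly.simps diff_conv_add_uminus) (subst degree_add_eq_left; simp)
    then show ?thesis using Suc by auto
  qed auto
qed

text \<open>The limit of the Christoffel-Darboux formula on the diagonal. At a real root the right-hand side is at least 1, so the
  derivative is nonzero there and the root is simple.\<close>

lemma confluent_christoffel_darboux:
  "poly (pderiv (cpoly V (Suc N))) z * opoly V N z - poly (pderiv (cpoly V N)) z * opoly V (Suc N) z
    = (\<Sum>n=1..N. (opoly V n z)\<^sup>2)"
proof (induction N)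
  case (Suc N)
  have "poly (pderiv (cpoly V (Suc (Suc N)))) z =
        opoly V (Suc N) z + (z - of_real (V (Suc N))) * poly (pderiv (cpoly V (Suc N))) z
          - poly (pderiv (cpoly V N)) z"
    by (simp only: cpoly.simps pderiv_diff pderiv_mult poly_diff poly_add poly_mult poly_cpoly)
      (simp add: pderiv_pCons)
  then have "poly (pderiv (cpoly V (Suc (Suc N)))) z * opoly V (Suc N) z
        - poly (pderiv (cpoly V (Suc N))) z * opoly V (Suc (Suc N)) z
      = (opoly V (Suc N) z)\<^sup>2 + (poly (pderiv (cpoly V (Suc N))) z * opoly V N z
        - poly (pderiv (cpoly V N)) z * opoly V (Suc N) z)"
    by (simp only: opoly.simps) (simp add: algebra_simps power2_eq_square del: cpoly.simps)
  then show ?case using Suc.IH by simp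
qed auto

lemma sum_opoly_sq_ge_1: "N \<ge> 1 \<Longrightarrow> (\<Sum>n=1..N. (opoly V n (x::real))\<^sup>2) \<ge> 1"
  by (subst sum.atLeast_Suc_atMost) (auto intro!: sum_nonneg)

lemma opoly_roots_real:
  assumes "opoly V (Suc N) (z::complex) = 0" "N \<ge> 1"
  shows "z \<in> \<real>"
proof -
  have "(z - cnj z) * (\<Sum>n=1..N. opoly V n z * opoly V n (cnj z)) = 0"
    using assms christoffel_darboux[of z "cnj z" V N] by (simp only: opoly_cnj) simp
  moreover have "(\<Sum>n=1..N. opoly V n z * opoly V n (cnj z)) \<noteq> 0"
  proof -
    have "(\<Sum>n=1..N. opoly V n z * opoly V n (cnj z)) = of_real (\<Sum>n=1..N. (cmod (opoly V n z))\<^sup>2)"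
      by (simp add: opoly_cnj complex_norm_square del: of_real_power)
    moreover have "(\<Sum>n=1..N. (cmod (opoly V n z))\<^sup>2) \<ge> 1"
      using assms(2) by (subst sum.atLeast_Suc_atMost) (auto intro!: sum_nonneg)
    ultimately show ?thesis by (metis not_one_le_zero of_real_eq_0_iff)
  qed
  ultimately have "z = cnj z" by simp
  then show ?thesis by (metis Reals_cnj_iff)
qed

definition gauss_nodes :: "(nat \<Rightarrow> real) \<Rightarrow> nat \<Rightarrow> real set" where
  "gauss_nodes V N = {x. opoly V (Suc N) x = 0}"

definition gauss_weight :: "(nat \<Rightarrow> real) \<Rightarrow> nat \<Rightarrow> real \<Rightarrow> real" where
  "gauss_weight V N x = 1 / (\<Sum>n=1..N. (opoly V n x)\<^sup>2)"

text \<open>The complex polynomial of degree \<open>N\<close> has \<open>N\<close> roots with multiplicity; they are all real and simple.\<close>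

lemma gauss_nodes:
  assumes "N \<ge> 1"
  shows "finite (gauss_nodes V N)" "card (gauss_nodes V N) = N"
proof -
  define p where "p = cpoly V (Suc N)"
  have p: "p \<noteq> 0" "degree p = N" using degree_cpoly by (auto simp: p_def)
  have roots: "{z. poly p z = 0} = complex_of_real ` gauss_nodes V N"
  proof safe
    fix z assume z: "poly p z = 0"
    then have "z \<in> \<real>" using assms by (intro opoly_roots_real[of V N]) (auto simp: p_def poly_cpoly)
    then obtain x where "z = of_real x" by (auto elim: Reals_cases)
    then show "z \<in> complex_of_real ` gauss_nodes V N"
      using z by (auto simp: gauss_nodes_def p_def poly_cpoly opoly_of_real)
  next
    fix x assume "x \<in> gauss_nodes V N"
    then show "poly p (complex_of_real x) = 0" by (auto simp: gauss_nodes_def p_def poly_cpoly opoly_of_real)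
  qed
  have "order z p = 1" if z: "poly p z = 0" for z
  proof -
    obtain x where x: "x \<in> gauss_nodes V N" "z = of_real x" using z roots by auto
    have "poly (pderiv p) z * opoly V N z = of_real (\<Sum>n=1..N. (opoly V n x)\<^sup>2)"
      using confluent_christoffel_darboux[of V N z] x
      by (simp add: p_def gauss_nodes_def opoly_of_real)
    moreover have "of_real (\<Sum>n=1..N. (opoly V n x)\<^sup>2) \<noteq> (0::complex)"
      using sum_opoly_sq_ge_1[OF assms, of V x] by (simp only: of_real_eq_0_iff)
    ultimately have "poly (pderiv p) z \<noteq> 0" by auto
    then have "order z (pderiv p) = 0" "pderiv p \<noteq> 0" by (auto intro: order_0I)
    then show ?thesis using order_pderiv[of p z] p(1) z order_root by force
  qed
  then have "proots p = mset_set {z. poly p z = 0}"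
    using p(1) poly_roots_finite[OF p(1)] by (intro multiset_eqI) (auto simp: order_0I count_mset_set')
  then have "card {z. poly p z = 0} = N"
    using size_proots_complex[of p] p(2) by simp
  moreover have "finite {z. poly p z = 0}" using poly_roots_finite[OF p(1)] .
  ultimately show "finite (gauss_nodes V N)" "card (gauss_nodes V N) = N"
    unfolding roots by (auto simp: card_image inj_on_def dest!: finite_imageD)
qed

lemma gauss_weight_pos: "N \<ge> 1 \<Longrightarrow> gauss_weight V N x > 0"
  and gauss_weight_le_1: "N \<ge> 1 \<Longrightarrow> gauss_weight V N x \<le> 1"
  using sum_opoly_sq_ge_1[of N V x] by (auto simp: gauss_weight_def divide_simps)

text \<open>The rows \<open>(p\<^sub>1(x), \<dots>, p\<^sub>N(x))\<close> for the \<open>N\<close> nodes \<open>x\<close> are orthogonal by Christoffel-Darboux. The claim is orthogonality of the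
  columns, that is, the rows span: \<open>N + 1\<close> vectors in an \<open>N\<close>-dimensional space are dependent, so each unit vector
  is a combination of the rows.\<close>

lemma gauss_quadrature:
  assumes "m \<in> {1..N}" "n \<in> {1..N}"
  shows "(\<Sum>x\<in>gauss_nodes V N. gauss_weight V N x * (opoly V m x * opoly V n x)) = of_bool (m = n)"
proof -
  have N: "N \<ge> 1" using assms by simp
  let ?X = "gauss_nodes V N" and ?w = "gauss_weight V N"
  note X = gauss_nodes[OF N, of V]
  have orth: "(\<Sum>k=1..N. opoly V k x * opoly V k y) = (if x = y then 1 / ?w x else 0)"
    if "x \<in> ?X" "y \<in> ?X" for x y
    using that christoffel_darboux[of x y V N]
    by (auto simp: gauss_nodes_def gauss_weight_def power2_eq_square)
  define I where "I = insert None (Some ` ?X)"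
  define v where "v i k = (case (i :: real option) of None \<Rightarrow> of_bool (k = n) | Some x \<Rightarrow> opoly V k x)" for i and k :: nat
  have cI: "card I = Suc N" "finite I"
    using X by (auto simp: I_def card_image)
  have "\<exists>a. (\<exists>i\<in>I. a i \<noteq> 0) \<and> (\<forall>k\<in>{1..N}. (\<Sum>i\<in>I. a i * v i k) = 0)"
    by (rule exists_linear_dependency) (use cI in auto)
  then obtain a where a: "\<exists>i\<in>I. a i \<noteq> 0" "\<And>k. k \<in> {1..N} \<Longrightarrow> (\<Sum>i\<in>I. a i * v i k) = 0"
    by blast
  define b where "b = a None"
  have a': "(if k = n then b else 0) + (\<Sum>x\<in>?X. a (Some x) * opoly V k x) = 0" if "k \<in> {1..N}" for k
    using a(2)[OF that] X unfolding I_def b_def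
    by (subst (asm) sum.insert) (auto simp: sum.reindex v_def b_def split: if_splits)
  have ay: "a (Some y) = - b * ?w y * opoly V n y" if y: "y \<in> ?X" for y
  proof -
    have "0 = (\<Sum>k=1..N. opoly V k y * ((if k = n then b else 0) + (\<Sum>x\<in>?X. a (Some x) * opoly V k x)))"
      using a' by simp
    also have "\<dots> = b * opoly V n y + (\<Sum>k=1..N. \<Sum>x\<in>?X. a (Some x) * (opoly V k x * opoly V k y))"
      using assms by (simp add: distrib_left sum.distrib sum_distrib_left mult_ac mult_delta_right)
    also have "(\<Sum>k=1..N. \<Sum>x\<in>?X. a (Some x) * (opoly V k x * opoly V k y)) =
        (\<Sum>x\<in>?X. a (Some x) * (\<Sum>k=1..N. opoly V k x * opoly V k y))"
      by (subst sum.swap) (simp add: sum_distrib_left)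
    also have "\<dots> = (\<Sum>x\<in>?X. if x = y then a (Some x) / ?w x else 0)"
      by (rule sum.cong) (use y orth in auto)
    also have "\<dots> = a (Some y) / ?w y" using y X by simp
    finally show ?thesis using gauss_weight_pos[OF N, of V y] by (simp add: field_simps)
  qed
  have b: "b \<noteq> 0"
  proof
    assume "b = 0"
    then have "a i = 0" if "i \<in> I" for i using that ay by (auto simp: I_def b_def)
    then show False using a(1) by auto
  qed
  have "(\<Sum>x\<in>?X. a (Some x) * opoly V m x) = - (b * (\<Sum>x\<in>?X. ?w x * (opoly V m x * opoly V n x)))"
    unfolding sum_distrib_left sum_negf[symmetric] by (rule sum.cong) (simp_all add: ay)
  then have "b * (of_bool (m = n) - (\<Sum>x\<in>?X. ?w x * (opoly V m x * opoly V n x))) =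
      (if m = n then b else 0) + (\<Sum>x\<in>?X. a (Some x) * opoly V m x)"
    by (simp add: right_diff_distrib)
  also have "\<dots> = 0" using a' assms by blast
  finally show ?thesis using b by simp
qed

section \<open>The orthonormality measure\<close>

text \<open>Weak convergence controls bounded continuous functions only. A bound on the second moments of \<open>q\<close> makes \<open>q\<close> uniformly integrable:
  truncating \<open>q\<close> at height \<open>R\<close> changes all integrals by at most \<open>B/R\<close>.\<close>

lemma weak_conv_integral_of_bounded_square:
  fixes q :: "real \<Rightarrow> real"
  assumes M: "\<And>k. real_distribution (M k)" and \<mu>: "real_distribution \<mu>" and conv: "weak_conv_m M \<mu>"
    and q: "\<And>x. isCont q x"
    and int: "\<And>k. integrable (M k) (\<lambda>x. (q x)\<^sup>2)"
    and bound: "\<forall>\<^sub>F k in sequentially. (\<integral>x. (q x)\<^sup>2 \<partial>M k) \<le> B"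
  shows "integrable \<mu> q" and "(\<lambda>k. \<integral>x. q x \<partial>M k) \<longlonglongrightarrow> (\<integral>x. q x \<partial>\<mu>)"
proof -
  interpret \<mu>: real_distribution \<mu> by fact
  have [measurable]: "q \<in> borel_measurable borel"
    using q by (intro borel_measurable_continuous_onI) (simp add: continuous_at_imp_continuous_on)
  have conv_bdd: "(\<lambda>k. \<integral>x. g x \<partial>M k) \<longlonglongrightarrow> (\<integral>x. g x \<partial>\<mu>)"
    if "\<And>x. isCont g x" "\<And>x. \<bar>g x\<bar> \<le> C" for g :: "real \<Rightarrow> real" and C
    using weak_conv_imp_integral_bdd_continuous_conv[OF M \<mu> conv, of g C] that by auto
  define B' where "B' = max B 0"
  have bound': "\<forall>\<^sub>F k in sequentially. (\<integral>x. (q x)\<^sup>2 \<partial>M k) \<le> B'"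
    using bound by eventually_elim (auto simp: B'_def)
  have int_min: "(\<integral>x. min ((q x)\<^sup>2) (real R) \<partial>\<mu>) \<le> B'" for R
  proof (rule LIMSEQ_le_const2[OF conv_bdd])
    show "isCont (\<lambda>x. min ((q x)\<^sup>2) (real R)) x" for x using q by (intro continuous_intros) auto
    show "\<bar>min ((q x)\<^sup>2) (real R)\<bar> \<le> real R" for x by auto
    show "\<exists>N. \<forall>n\<ge>N. (\<integral>x. min ((q x)\<^sup>2) (real R) \<partial>M n) \<le> B'"
      unfolding eventually_sequentially[symmetric] using bound'
    proof eventually_elim
      case (elim k)
      interpret Mk: real_distribution "M k" by (rule M)
      have "(\<integral>x. min ((q x)\<^sup>2) (real R) \<partial>M k) \<le> (\<integral>x. (q x)\<^sup>2 \<partial>M k)"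
        by (rule integral_mono, rule Mk.integrable_const_bound[of _ "real R"]) (auto intro!: int)
      then show ?case using elim by simp
    qed
  qed
  have "(\<integral>\<^sup>+x. ennreal ((q x)\<^sup>2) \<partial>\<mu>) \<le> B'"
  proof -
    have "(\<integral>\<^sup>+x. ennreal ((q x)\<^sup>2) \<partial>\<mu>) = (\<integral>\<^sup>+x. liminf (\<lambda>R. ennreal (min ((q x)\<^sup>2) (real R))) \<partial>\<mu>)"
    proof (rule nn_integral_cong)
      fix x
      have "\<forall>\<^sub>F R in sequentially. ennreal (min ((q x)\<^sup>2) (real R)) = ennreal ((q x)\<^sup>2)"
        using eventually_ge_at_top[of "nat \<lceil>(q x)\<^sup>2\<rceil>"] by eventually_elim (simp add: min_def; linarith)
      then have "(\<lambda>R. ennreal (min ((q x)\<^sup>2) (real R))) \<longlonglongrightarrow> ennreal ((q x)\<^sup>2)"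
        by (rule tendsto_eventually)
      then show "ennreal ((q x)\<^sup>2) = liminf (\<lambda>R. ennreal (min ((q x)\<^sup>2) (real R)))"
        by (rule lim_imp_Liminf[OF trivial_limit_sequentially, symmetric])
    qed
    also have "\<dots> \<le> liminf (\<lambda>R. \<integral>\<^sup>+x. ennreal (min ((q x)\<^sup>2) (real R)) \<partial>\<mu>)"
      by (rule nn_integral_liminf) auto
    also have "\<dots> \<le> liminf (\<lambda>R. ennreal B')"
    proof (rule Liminf_mono, rule always_eventually, rule allI)
      fix R :: nat
      have "(\<integral>\<^sup>+x. ennreal (min ((q x)\<^sup>2) (real R)) \<partial>\<mu>) = ennreal (\<integral>x. min ((q x)\<^sup>2) (real R) \<partial>\<mu>)"
        by (rule nn_integral_eq_integral, rule \<mu>.integrable_const_bound[of _ "real R"]) auto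
      then show "(\<integral>\<^sup>+x. ennreal (min ((q x)\<^sup>2) (real R)) \<partial>\<mu>) \<le> ennreal B'"
        using int_min[of R] by (simp add: ennreal_leI)
    qed
    also have "\<dots> = ennreal B'" by (simp add: Liminf_const)
    finally show ?thesis .
  qed
  then have q2: "integrable \<mu> (\<lambda>x. (q x)\<^sup>2)"
    by (intro integrableI_bounded) (auto simp: le_less_trans)
  have q_of_q2: "integrable \<nu> q" if "real_distribution \<nu>" "integrable \<nu> (\<lambda>x. (q x)\<^sup>2)" for \<nu>
  proof -
    interpret real_distribution \<nu> by fact
    have le: "\<bar>y\<bar> \<le> 1 + y\<^sup>2" for y :: real
      using sum_squares_bound[of 1 "\<bar>y\<bar>"] by simp
    show ?thesis
      by (rule Bochner_Integration.integrable_bound[of _ "\<lambda>x. 1 + (q x)\<^sup>2"])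
        (use that le in \<open>auto intro: order_trans[OF le abs_ge_self]\<close>)
  qed
  show int_q: "integrable \<mu> q" by (rule q_of_q2[OF \<mu> q2])
  \<comment> \<open>Truncation of the values to the interval from \<open>- R\<close> to \<open>R\<close>.\<close>
  define tr where "tr R y = max (- R) (min R y)" for R y :: real
  have trunc: "\<bar>(\<integral>x. q x \<partial>\<nu>) - (\<integral>x. tr R (q x) \<partial>\<nu>)\<bar> \<le> (\<integral>x. (q x)\<^sup>2 \<partial>\<nu>) / R"
    if \<nu>: "real_distribution \<nu>" "integrable \<nu> (\<lambda>x. (q x)\<^sup>2)" and R: "R > 0" for \<nu> R
  proof -
    interpret real_distribution \<nu> by fact
    have 1: "integrable \<nu> (\<lambda>x. tr R (q x))"
      by (rule integrable_const_bound[of _ R]) (use R in \<open>auto simp: tr_def\<close>)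
    have 2: "integrable \<nu> q" by (rule q_of_q2[OF \<nu>])
    have le: "\<bar>y - tr R y\<bar> \<le> y\<^sup>2 / R" for y
    proof (cases "\<bar>y\<bar> \<le> R")
      case True then show ?thesis using R by (auto simp: tr_def)
    next
      case False
      then have "\<bar>y - tr R y\<bar> \<le> \<bar>y\<bar>" using R by (auto simp: tr_def)
      also have "\<dots> \<le> y\<^sup>2 / R"
        using False R mult_mono[of R "\<bar>y\<bar>" "\<bar>y\<bar>" "\<bar>y\<bar>"] by (simp add: field_simps power2_eq_square)
      finally show ?thesis .
    qed
    have "\<bar>(\<integral>x. q x \<partial>\<nu>) - (\<integral>x. tr R (q x) \<partial>\<nu>)\<bar> = \<bar>\<integral>x. (q x - tr R (q x)) \<partial>\<nu>\<bar>"
      using 1 2 by simp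
    also have "\<dots> \<le> (\<integral>x. \<bar>q x - tr R (q x)\<bar> \<partial>\<nu>)" by (rule integral_abs_bound)
    also have "\<dots> \<le> (\<integral>x. (q x)\<^sup>2 / R \<partial>\<nu>)"
      by (rule integral_mono) (use 1 2 le that in auto)
    finally show ?thesis by simp
  qed
  show "(\<lambda>k. \<integral>x. q x \<partial>M k) \<longlonglongrightarrow> (\<integral>x. q x \<partial>\<mu>)"
  proof (rule LIMSEQ_I)
    fix e :: real assume e: "e > 0"
    \<comment> \<open>The level \<open>R\<close> is chosen so that truncating costs at most \<open>e/4\<close>, for all large \<open>k\<close> and in the limit.\<close>
    define C where "C = max B' (\<integral>x. (q x)\<^sup>2 \<partial>\<mu>) + 1"
    define R where "R = 4 * C / e"
    have C: "C > 0" "B' \<le> C" "(\<integral>x. (q x)\<^sup>2 \<partial>\<mu>) \<le> C" by (auto simp: C_def B'_def)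
    have R: "R > 0" "C / R = e / 4" using C e by (auto simp: R_def)
    have "(\<lambda>k. \<integral>x. tr R (q x) \<partial>M k) \<longlonglongrightarrow> (\<integral>x. tr R (q x) \<partial>\<mu>)"
    proof (rule conv_bdd)
      show "isCont (\<lambda>x. tr R (q x)) x" for x unfolding tr_def using q by (intro continuous_intros) auto
      show "\<bar>tr R (q x)\<bar> \<le> R" for x using R by (auto simp: tr_def)
    qed
    then have "\<forall>\<^sub>F k in sequentially. dist (\<integral>x. tr R (q x) \<partial>M k) (\<integral>x. tr R (q x) \<partial>\<mu>) < e / 4"
      by (rule tendstoD) (use e in simp)
    then have "\<forall>\<^sub>F k in sequentially. norm ((\<integral>x. q x \<partial>M k) - (\<integral>x. q x \<partial>\<mu>)) < e"
      using bound'
    proof eventually_elim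
      case (elim k)
      have "\<bar>(\<integral>x. q x \<partial>M k) - (\<integral>x. tr R (q x) \<partial>M k)\<bar> \<le> e / 4"
        using trunc[OF M int R(1), of k] elim(2) C R divide_right_mono[of "\<integral>x. (q x)\<^sup>2 \<partial>M k" C R] by linarith
      moreover have "\<bar>(\<integral>x. q x \<partial>\<mu>) - (\<integral>x. tr R (q x) \<partial>\<mu>)\<bar> \<le> e / 4"
        using trunc[OF \<mu> q2 R(1)] C R divide_right_mono[of "\<integral>x. (q x)\<^sup>2 \<partial>\<mu>" C R] by linarith
      ultimately show ?case using elim(1) e unfolding dist_real_def real_norm_def by linarith
    qed
    then show "\<exists>no. \<forall>n\<ge>no. norm ((\<integral>x. q x \<partial>M n) - (\<integral>x. q x \<partial>\<mu>)) < e"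
      by (simp add: eventually_sequentially)
  qed
qed

definition gauss_measure :: "(nat \<Rightarrow> real) \<Rightarrow> nat \<Rightarrow> real measure" where
  "gauss_measure V N =
     distr (point_measure (gauss_nodes V N) (\<lambda>x. ennreal (gauss_weight V N x))) borel (\<lambda>x. x)"

lemma real_distribution_gauss_measure:
  assumes "N \<ge> 1"
  shows "real_distribution (gauss_measure V N)"
proof -
  let ?P = "point_measure (gauss_nodes V N) (\<lambda>x. ennreal (gauss_weight V N x))"
  have "(\<Sum>x\<in>gauss_nodes V N. gauss_weight V N x) = 1"
    using gauss_quadrature[of 1 N 1 V] assms by simp
  then have "(\<Sum>x\<in>gauss_nodes V N. ennreal (gauss_weight V N x)) = 1"
    using gauss_weight_pos[OF assms, of V] by (subst sum_ennreal) (auto simp: less_imp_le)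
  then have "prob_space ?P"
    using gauss_nodes(1)[OF assms] by (intro prob_spaceI) (simp add: space_point_measure emeasure_point_measure_finite)
  then interpret prob_space ?P .
  show ?thesis unfolding gauss_measure_def by (rule real_distribution_distr) simp
qed

lemma integral_gauss_measure:
  fixes g :: "real \<Rightarrow> real"
  assumes "N \<ge> 1" "g \<in> borel_measurable borel"
  shows "integrable (gauss_measure V N) g"
    and "(\<integral>x. g x \<partial>gauss_measure V N) = (\<Sum>x\<in>gauss_nodes V N. gauss_weight V N x * g x)"
  unfolding gauss_measure_def using assms gauss_nodes(1)[OF assms(1)] gauss_weight_pos[OF assms(1), of V]
  by (simp_all add: integrable_distr_eq integral_distr integrable_point_measure_finite
      lebesgue_integral_point_measure_finite less_imp_le)

text \<open>The linear span of the polynomials \<open>opoly V n\<close>, as functions on the real line. It is closed under multiplication by them, and the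
  quadrature of any of its members is independent of \<open>N\<close> for large \<open>N\<close>; this supplies the moment
  bounds for the weak limit.\<close>

inductive opoly_span :: "(nat \<Rightarrow> real) \<Rightarrow> (real \<Rightarrow> real) \<Rightarrow> bool" for V where
  zero: "opoly_span V (\<lambda>_. 0)"
| step: "opoly_span V q \<Longrightarrow> 1 \<le> n \<Longrightarrow> opoly_span V (\<lambda>x. q x + c * opoly V n x)"

lemma opoly_span_opoly: "opoly_span V (\<lambda>x. c * opoly V n x)"
  using opoly_span.step[OF opoly_span.zero, of n V c] opoly_span.zero[of V] by (cases n) auto

lemma opoly_span_add:
  assumes "opoly_span V q" "opoly_span V r"
  shows "opoly_span V (\<lambda>x. q x + r x)"
  using assms(2)
proof induction
  case (step r n c)
  from opoly_span.step[OF step(3,2), of c] show ?case by (simp add: add.assoc)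
qed (simp add: assms)

lemma opoly_span_cmult:
  assumes "opoly_span V q"
  shows "opoly_span V (\<lambda>x. a * q x)"
  using assms
proof induction
  case (step q n c)
  from opoly_span.step[OF step(3,2), of "a * c"] show ?case by (simp add: algebra_simps)
qed (simp add: opoly_span.zero)

lemma opoly_span_mult_ident:
  assumes "opoly_span V q"
  shows "opoly_span V (\<lambda>x. x * q x)"
  using assms
proof induction
  case (step q n c)
  have "opoly_span V (\<lambda>x. x * q x + (c * opoly V (n-1) x + (c * opoly V (n+1) x + (c * V n) * opoly V n x)))"
    by (intro opoly_span_add opoly_span_opoly step)
  moreover have "x * q x + (c * opoly V (n-1) x + (c * opoly V (n+1) x + (c * V n) * opoly V n x))
      = x * (q x + c * opoly V n x)" for x
    using opoly_recurrence[OF step(2), of x V] by (simp add: algebra_simps)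
  ultimately show ?case by simp
qed (simp add: opoly_span.zero)

lemma opoly_span_mult_opoly:
  assumes "opoly_span V q"
  shows "opoly_span V (\<lambda>x. opoly V n x * q x)"
proof (induction n rule: less_induct)
  case (less n)
  show ?case
  proof (cases "n \<le> 1")
    case True
    then have "n = 0 \<or> n = Suc 0" by auto
    then show ?thesis using assms by (auto simp: opoly_span.zero)
  next
    case False
    then obtain m where m: "n = Suc (Suc m)" by (metis Suc_le_eq less_eq_Suc_le not_less0 not0_implies_Suc One_nat_def not_le)
    have 1: "opoly_span V (\<lambda>x. opoly V (Suc m) x * q x)" and 2: "opoly_span V (\<lambda>x. opoly V m x * q x)"
      using less m by auto
    have "opoly_span V (\<lambda>x. x * (opoly V (Suc m) x * q x) +
      ((- V (Suc m)) * (opoly V (Suc m) x * q x) + (-1) * (opoly V m x * q x)))"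
      by (intro opoly_span_add opoly_span_cmult opoly_span_mult_ident 1 2)
    then show ?thesis by (simp add: m algebra_simps)
  qed
qed

lemma opoly_span_quadrature:
  assumes "opoly_span V q"
  shows "\<exists>L. \<forall>\<^sub>F N in sequentially. (\<Sum>x\<in>gauss_nodes V N. gauss_weight V N x * q x) = L"
  using assms
proof induction
  case (step q n c)
  then obtain L where L: "\<forall>\<^sub>F N in sequentially. (\<Sum>x\<in>gauss_nodes V N. gauss_weight V N x * q x) = L" by blast
  have "\<forall>\<^sub>F N in sequentially. (\<Sum>x\<in>gauss_nodes V N. gauss_weight V N x * (q x + c * opoly V n x))
     = L + c * of_bool (n = 1)"
    using L eventually_ge_at_top[of n]
  proof eventually_elim
    case (elim N)
    then show ?case using gauss_quadrature[of n N 1 V] step(2)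
      by (simp add: distrib_left sum.distrib mult.left_commute[of _ c] sum_distrib_left[symmetric])
  qed
  then show ?case by blast
qed auto

lemma isCont_opoly [continuous_intros]: "isCont (\<lambda>x. opoly V n x) (a::real)"
  by (induction V n a rule: opoly.induct) (auto intro!: continuous_intros)

lemma borel_measurable_opoly [measurable]: "(\<lambda>x. opoly V n (x::real)) \<in> borel_measurable borel"
  by (intro borel_measurable_continuous_onI continuous_at_imp_continuous_on) (simp add: isCont_opoly)

text \<open>From two nodes on, the Gauss measures have second moment \<open>1 + (V 1)\<^sup>2\<close>, so they are tight, and orthonormality passes to a weak limit because the squares of
  products of two polynomials have bounded integrals.\<close>

theorem exists_measure_orthonormalizing_opoly:
  obtains \<mu> where "real_distribution \<mu>"
    "\<And>m n. m \<ge> 1 \<Longrightarrow> n \<ge> 1 \<Longrightarrow> integrable \<mu> (\<lambda>x. opoly V m x * opoly V n x)"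
    "\<And>m n. m \<ge> 1 \<Longrightarrow> n \<ge> 1 \<Longrightarrow> (\<integral>x. opoly V m x * opoly V n x \<partial>\<mu>) = of_bool (m = n)"
proof -
  define M where "M k = gauss_measure V (k + 2)" for k
  have M: "real_distribution (M k)" for k unfolding M_def by (rule real_distribution_gauss_measure) simp
  have second: "(\<integral>x. x\<^sup>2 \<partial>M k) = 1 + (V 1)\<^sup>2" "integrable (M k) (\<lambda>x. x\<^sup>2)" for k
  proof -
    let ?E = "\<lambda>m n. \<Sum>x\<in>gauss_nodes V (k+2). gauss_weight V (k+2) x * (opoly V m x * opoly V n x)"
    have "(\<integral>x. x\<^sup>2 \<partial>M k) = (\<Sum>x\<in>gauss_nodes V (k+2). gauss_weight V (k+2) x * x\<^sup>2)"
      unfolding M_def by (rule integral_gauss_measure) auto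
    also have "\<dots> = ?E 2 2 + 2 * V 1 * ?E 2 1 + (V 1)\<^sup>2 * ?E 1 1"
      by (simp add: sum.distrib[symmetric] sum_distrib_left numeral_2_eq_2 power2_eq_square algebra_simps)
    also have "\<dots> = 1 + (V 1)\<^sup>2"
      using gauss_quadrature[of 2 "k+2" 2 V] gauss_quadrature[of 2 "k+2" 1 V] gauss_quadrature[of 1 "k+2" 1 V]
      by simp
    finally show "(\<integral>x. x\<^sup>2 \<partial>M k) = 1 + (V 1)\<^sup>2" .
    show "integrable (M k) (\<lambda>x. x\<^sup>2)" unfolding M_def by (rule integral_gauss_measure) auto
  qed
  have "tight M"
    unfolding tight_def
  proof (intro conjI allI impI M)
    fix e :: real assume e: "e > 0"
    define B where "B = 1 + (V 1)\<^sup>2"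
    \<comment> \<open>The mass outside \<open>[-R, R]\<close> is at most \<open>B/R\<^sup>2\<close>; adding 1 makes this strictly less than \<open>e\<close>.\<close>
    define R where "R = B / e + 1"
    have B: "B > 0" by (auto simp: B_def add_pos_nonneg)
    have R: "R > 1" "B / R\<^sup>2 < e"
    proof -
      show "R > 1" using B e by (simp add: R_def)
      then have "R \<le> R\<^sup>2" by (simp add: power2_eq_square)
      moreover have "B < e * R" using e by (simp add: R_def field_simps)
      ultimately have "B < e * R\<^sup>2" using e by (meson less_le_trans mult_left_mono less_imp_le)
      then show "B / R\<^sup>2 < e" using \<open>R > 1\<close> by (simp add: divide_simps mult.commute)
    qed
    have "measure (M k) {-R<..R} > 1 - e" for k
    proof -
      interpret Mk: real_distribution "M k" by (rule M)
      have "measure (M k) (UNIV - {-R<..R}) = (\<integral>x. indicator (UNIV - {-R<..R}) x \<partial>M k)" by simp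
      also have "\<dots> \<le> (\<integral>x. x\<^sup>2 / R\<^sup>2 \<partial>M k)"
      proof (rule integral_mono)
        fix x
        have "R\<^sup>2 \<le> x\<^sup>2" if "x \<notin> {-R<..R}"
          using that R by (intro power2_le_iff_abs_le[THEN iffD2] abs_le_square_iff[THEN iffD1]) auto
        then show "indicator (UNIV - {-R<..R}) x \<le> x\<^sup>2 / R\<^sup>2" using R by (auto simp: indicator_def divide_simps)
      qed (use second in \<open>auto intro!: Mk.integrable_const_bound[of _ 1] simp: indicator_def\<close>)
      also have "\<dots> < e" using R second by (simp add: B_def)
      finally show ?thesis using Mk.prob_compl[of "{-R<..R}"] by simp
    qed
    then show "\<exists>a b. a < b \<and> (\<forall>n. measure (M n) {a<..b} > 1 - e)"
      using R by (intro exI[of _ "-R"] exI[of _ R]) auto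
  qed
  from tight_imp_convergent_subsubsequence[OF this, of id] obtain r \<mu>
    where r: "strict_mono (r :: nat \<Rightarrow> nat)" and \<mu>: "real_distribution \<mu>" and conv: "weak_conv_m (M \<circ> r) \<mu>"
    by (auto simp: strict_mono_def)
  have *: "integrable \<mu> (\<lambda>x. opoly V m x * opoly V n x) \<and> (\<integral>x. opoly V m x * opoly V n x \<partial>\<mu>) = of_bool (m = n)"
    if mn: "m \<ge> 1" "n \<ge> 1" for m n
  proof -
    let ?q = "\<lambda>x::real. opoly V m x * opoly V n x"
    have lim: "filterlim (\<lambda>k. r k + 2) sequentially sequentially"
      using r by (intro filterlim_subseq) (auto simp: strict_mono_def)
    have "opoly_span V (\<lambda>x. opoly V m x * (opoly V n x * (opoly V m x * (1 * opoly V n x))))"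
      by (intro opoly_span_mult_opoly opoly_span_opoly)
    then have "opoly_span V (\<lambda>x. (?q x)\<^sup>2)" by (simp add: power2_eq_square mult_ac)
    then obtain L where "\<forall>\<^sub>F N in sequentially. (\<Sum>x\<in>gauss_nodes V N. gauss_weight V N x * (?q x)\<^sup>2) = L"
      using opoly_span_quadrature by blast
    then have "\<forall>\<^sub>F k in sequentially. (\<Sum>x\<in>gauss_nodes V (r k + 2). gauss_weight V (r k + 2) x * (?q x)\<^sup>2) = L"
      using lim by (rule eventually_compose_filterlim)
    then have bound: "\<forall>\<^sub>F k in sequentially. (\<integral>x. (?q x)\<^sup>2 \<partial>(M \<circ> r) k) \<le> L"
      by eventually_elim (simp add: M_def integral_gauss_measure)
    have int: "integrable ((M \<circ> r) k) (\<lambda>x. (?q x)\<^sup>2)" for k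
      by (simp add: M_def integral_gauss_measure)
    note wk = weak_conv_integral_of_bounded_square[OF _ \<mu> conv _ int bound]
    have cont: "isCont ?q x" for x by (intro continuous_intros)
    have 1: "integrable \<mu> ?q" by (rule wk) (use M cont in auto)
    have 2: "(\<lambda>k. \<integral>x. ?q x \<partial>(M \<circ> r) k) \<longlonglongrightarrow> (\<integral>x. ?q x \<partial>\<mu>)" by (rule wk) (use M cont in auto)
    have "\<forall>\<^sub>F N in sequentially. (\<Sum>x\<in>gauss_nodes V N. gauss_weight V N x * ?q x) = of_bool (m = n)"
      using eventually_ge_at_top[of "max m n"] by eventually_elim (use mn in \<open>simp add: gauss_quadrature\<close>)
    then have "\<forall>\<^sub>F k in sequentially. (\<Sum>x\<in>gauss_nodes V (r k + 2). gauss_weight V (r k + 2) x * ?q x) = of_bool (m = n)"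
      using lim by (rule eventually_compose_filterlim)
    then have "\<forall>\<^sub>F k in sequentially. (\<integral>x. ?q x \<partial>(M \<circ> r) k) = of_bool (m = n)"
      by eventually_elim (simp add: M_def integral_gauss_measure)
    then have "(\<lambda>k. \<integral>x. ?q x \<partial>(M \<circ> r) k) \<longlonglongrightarrow> of_bool (m = n)" by (rule tendsto_eventually)
    then show ?thesis using 1 2 LIMSEQ_unique by blast
  qed
  show ?thesis by (rule that[of \<mu>]) (use \<mu> * in auto)
qed

section \<open>Square summable sequences\<close>

lemma ell2_zero_at_0: "\<psi> \<in> ell2 \<Longrightarrow> \<psi> 0 = 0"
  and ell2_summable: "\<psi> \<in> ell2 \<Longrightarrow> summable (\<lambda>n. (cmod (\<psi> n))\<^sup>2)"
  by (auto simp: ell2_def)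

lemma ell2_lincomb [intro]:
  assumes "\<phi> \<in> ell2" "\<psi> \<in> ell2"
  shows "(\<lambda>n. a * \<phi> n + b * \<psi> n) \<in> ell2"
proof -
  have le: "(cmod (a * \<phi> n + b * \<psi> n))\<^sup>2 \<le> 2 * (cmod a)\<^sup>2 * (cmod (\<phi> n))\<^sup>2 + 2 * (cmod b)\<^sup>2 * (cmod (\<psi> n))\<^sup>2" for n
  proof -
    have "(cmod (a * \<phi> n + b * \<psi> n))\<^sup>2 \<le> (cmod (a * \<phi> n) + cmod (b * \<psi> n))\<^sup>2"
      by (intro power_mono norm_triangle_ineq) auto
    also have "\<dots> \<le> 2 * (cmod (a * \<phi> n))\<^sup>2 + 2 * (cmod (b * \<psi> n))\<^sup>2"
      using sum_squares_bound[of "cmod (a * \<phi> n)" "cmod (b * \<psi> n)"] by (simp add: power2_sum)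
    finally show ?thesis by (simp add: norm_mult power_mult_distrib)
  qed
  have "summable (\<lambda>n. 2 * (cmod a)\<^sup>2 * (cmod (\<phi> n))\<^sup>2 + 2 * (cmod b)\<^sup>2 * (cmod (\<psi> n))\<^sup>2)"
    using assms by (intro summable_add summable_mult ell2_summable)
  then have "summable (\<lambda>n. (cmod (a * \<phi> n + b * \<psi> n))\<^sup>2)"
    by (rule summable_comparison_test'[where N=0]) (use le in simp)
  then show ?thesis using assms by (auto simp: ell2_def)
qed

lemma ell2_add [intro]: "\<phi> \<in> ell2 \<Longrightarrow> \<psi> \<in> ell2 \<Longrightarrow> (\<lambda>n. \<phi> n + \<psi> n) \<in> ell2"
  using ell2_lincomb[of \<phi> \<psi> 1 1] by simp

lemma ell2_diff [intro]: "\<phi> \<in> ell2 \<Longrightarrow> \<psi> \<in> ell2 \<Longrightarrow> (\<lambda>n. \<phi> n - \<psi> n) \<in> ell2"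
  using ell2_lincomb[of \<phi> \<psi> 1 "-1"] by simp

lemma ell2_cmult [intro]: "\<phi> \<in> ell2 \<Longrightarrow> (\<lambda>n. a * \<phi> n) \<in> ell2"
  using ell2_lincomb[of \<phi> \<phi> a 0] by simp

lemma l2_norm_nonneg [simp]: "\<psi> \<in> ell2 \<Longrightarrow> l2_norm \<psi> \<ge> 0"
  by (auto simp: l2_norm_def suminf_nonneg ell2_summable)

lemma l2_norm_sq: "\<psi> \<in> ell2 \<Longrightarrow> (l2_norm \<psi>)\<^sup>2 = (\<Sum>n. (cmod (\<psi> n))\<^sup>2)"
  unfolding l2_norm_def by (simp add: suminf_nonneg ell2_summable)

lemma sum_le_l2_norm_sq:
  assumes "\<psi> \<in> ell2" "finite A" shows "(\<Sum>n\<in>A. (cmod (\<psi> n))\<^sup>2) \<le> (l2_norm \<psi>)\<^sup>2"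
  unfolding l2_norm_sq[OF assms(1)] by (rule sum_le_suminf) (use assms in \<open>auto intro: ell2_summable\<close>)

text \<open>Almost all norm estimates below are obtained on finite partial sums first; this lemma passes to the limit.\<close>

lemma ell2_l2_norm_leI:
  assumes "\<And>N. (\<Sum>n<N. (cmod (\<psi> n))\<^sup>2) \<le> C\<^sup>2" "C \<ge> 0" "\<psi> 0 = 0"
  shows "\<psi> \<in> ell2" "l2_norm \<psi> \<le> C"
proof -
  have "summable (\<lambda>n. (cmod (\<psi> n))\<^sup>2)" using assms(1) by (intro summableI_nonneg_bounded) auto
  then show *: "\<psi> \<in> ell2" using assms by (auto simp: ell2_def)
  have "(l2_norm \<psi>)\<^sup>2 \<le> C\<^sup>2" unfolding l2_norm_sq[OF *]
    by (intro suminf_le_const ell2_summable * assms)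
  then show "l2_norm \<psi> \<le> C" using assms(2) by (rule power2_le_imp_le)
qed

lemma ell2_l2_norm_mono:
  assumes "\<psi> \<in> ell2" "\<And>n. cmod (\<phi> n) \<le> cmod (\<psi> n)"
  shows "\<phi> \<in> ell2" "l2_norm \<phi> \<le> l2_norm \<psi>"
proof -
  have le: "(\<Sum>n<N. (cmod (\<phi> n))\<^sup>2) \<le> (l2_norm \<psi>)\<^sup>2" for N
    by (rule order_trans[OF sum_mono sum_le_l2_norm_sq[OF assms(1)]]) (use assms in \<open>auto intro: power_mono\<close>)
  have z: "\<phi> 0 = 0" using assms(2)[of 0] ell2_zero_at_0[OF assms(1)] by simp
  show "\<phi> \<in> ell2" "l2_norm \<phi> \<le> l2_norm \<psi>" using ell2_l2_norm_leI[OF le l2_norm_nonneg[OF assms(1)] z] by auto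
qed

lemma cmod_le_l2_norm:
  assumes "\<psi> \<in> ell2" shows "cmod (\<psi> n) \<le> l2_norm \<psi>"
  using sum_le_l2_norm_sq[OF assms, of "{n}"] assms by (auto intro: power2_le_imp_le)

lemma l2_norm_eq_0: "\<psi> \<in> ell2 \<Longrightarrow> l2_norm \<psi> = 0 \<Longrightarrow> \<psi> n = 0"
  using cmod_le_l2_norm[of \<psi> n] by simp

lemma ell2_L2_set_le: "\<psi> \<in> ell2 \<Longrightarrow> L2_set (\<lambda>n. cmod (\<psi> n)) {..<N} \<le> l2_norm \<psi>"
  unfolding L2_set_def using sum_le_l2_norm_sq[of \<psi> "{..<N}"]
  by (intro real_le_lsqrt) auto

lemma l2_norm_triangle:
  assumes "\<phi> \<in> ell2" "\<psi> \<in> ell2"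
  shows "l2_norm (\<lambda>n. \<phi> n + \<psi> n) \<le> l2_norm \<phi> + l2_norm \<psi>"
proof (rule ell2_l2_norm_leI(2))
  fix N
  have "L2_set (\<lambda>n. cmod (\<phi> n + \<psi> n)) {..<N} \<le> L2_set (\<lambda>n. cmod (\<phi> n) + cmod (\<psi> n)) {..<N}"
    by (intro L2_set_mono norm_triangle_ineq) auto
  also have "\<dots> \<le> L2_set (\<lambda>n. cmod (\<phi> n)) {..<N} + L2_set (\<lambda>n. cmod (\<psi> n)) {..<N}"
    by (rule L2_set_triangle_ineq)
  also have "\<dots> \<le> l2_norm \<phi> + l2_norm \<psi>" by (intro add_mono ell2_L2_set_le assms)
  finally have "(L2_set (\<lambda>n. cmod (\<phi> n + \<psi> n)) {..<N})\<^sup>2 \<le> (l2_norm \<phi> + l2_norm \<psi>)\<^sup>2"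
    by (intro power_mono) auto
  then show "(\<Sum>n<N. (cmod (\<phi> n + \<psi> n))\<^sup>2) \<le> (l2_norm \<phi> + l2_norm \<psi>)\<^sup>2"
    by (simp add: L2_set_def sum_nonneg)
qed (use assms in \<open>auto simp: ell2_zero_at_0\<close>)

lemma l2_norm_cmult:
  assumes "\<psi> \<in> ell2" shows "l2_norm (\<lambda>n. a * \<psi> n) = cmod a * l2_norm \<psi>"
  unfolding l2_norm_def
  by (simp add: norm_mult power_mult_distrib suminf_mult ell2_summable[OF assms] real_sqrt_mult)

lemma l2_norm_triangle_diff:
  assumes "\<phi> \<in> ell2" "\<psi> \<in> ell2"
  shows "l2_norm (\<lambda>n. \<phi> n - \<psi> n) \<le> l2_norm \<phi> + l2_norm \<psi>"
  using l2_norm_triangle[OF assms(1) ell2_cmult[OF assms(2), of "-1"]] l2_norm_cmult[OF assms(2), of "-1"]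
  by simp

lemma l2_norm_finite:
  assumes "finite A" "\<And>n. n \<notin> A \<Longrightarrow> \<psi> n = 0"
  shows "l2_norm \<psi> = sqrt (\<Sum>n\<in>A. (cmod (\<psi> n))\<^sup>2)"
  unfolding l2_norm_def using assms by (subst suminf_finite[of A]) auto

lemma ell2_finite:
  assumes "finite A" "\<And>n. n \<notin> A \<Longrightarrow> \<psi> n = 0" "\<psi> 0 = 0"
  shows "\<psi> \<in> ell2"
  using assms unfolding ell2_def by (auto intro: summable_finite[of A])

lemma l2_inner_summable:
  assumes "\<phi> \<in> ell2" "\<psi> \<in> ell2"
  shows "summable (\<lambda>n. cmod (\<phi> n) * cmod (\<psi> n))" "(\<Sum>n. cmod (\<phi> n) * cmod (\<psi> n)) \<le> l2_norm \<phi> * l2_norm \<psi>"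
proof -
  have le: "(\<Sum>n<N. cmod (\<phi> n) * cmod (\<psi> n)) \<le> l2_norm \<phi> * l2_norm \<psi>" for N
  proof -
    have "(\<Sum>n<N. cmod (\<phi> n) * cmod (\<psi> n)) \<le> L2_set (\<lambda>n. cmod (\<phi> n)) {..<N} * L2_set (\<lambda>n. cmod (\<psi> n)) {..<N}"
      using L2_set_mult_ineq[of "\<lambda>n. cmod (\<phi> n)" "\<lambda>n. cmod (\<psi> n)" "{..<N}"] by simp
    also have "\<dots> \<le> l2_norm \<phi> * l2_norm \<psi>" by (intro mult_mono ell2_L2_set_le assms l2_norm_nonneg) auto
    finally show ?thesis .
  qed
  show s: "summable (\<lambda>n. cmod (\<phi> n) * cmod (\<psi> n))" using le by (intro summableI_nonneg_bounded) auto
  show "(\<Sum>n. cmod (\<phi> n) * cmod (\<psi> n)) \<le> l2_norm \<phi> * l2_norm \<psi>" using s le by (rule suminf_le_const)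
qed

lemma ell2_mult_summable:
  assumes "\<phi> \<in> ell2" "\<psi> \<in> ell2"
  shows "summable (\<lambda>n. \<phi> n * \<psi> n)"
  by (rule summable_norm_cancel) (use l2_inner_summable[OF assms] in \<open>simp add: norm_mult\<close>)

lemma ell2_cnj: "\<phi> \<in> ell2 \<Longrightarrow> (\<lambda>n. cnj (\<phi> n)) \<in> ell2"
  by (auto simp: ell2_def)

lemma l2_inner_terms_summable: "\<phi> \<in> ell2 \<Longrightarrow> \<psi> \<in> ell2 \<Longrightarrow> summable (\<lambda>n. cnj (\<phi> n) * \<psi> n)"
  by (intro ell2_mult_summable ell2_cnj)

lemma cauchy_schwarz_l2_inner:
  assumes "\<phi> \<in> ell2" "\<psi> \<in> ell2"
  shows "cmod (l2_inner \<phi> \<psi>) \<le> l2_norm \<phi> * l2_norm \<psi>"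
proof -
  have "cmod (l2_inner \<phi> \<psi>) \<le> (\<Sum>n. cmod (cnj (\<phi> n) * \<psi> n))"
    unfolding l2_inner_def using l2_inner_summable(1)[OF assms]
    by (intro summable_norm) (simp add: norm_mult)
  also have "\<dots> \<le> l2_norm \<phi> * l2_norm \<psi>" using l2_inner_summable(2)[OF assms] by (simp add: norm_mult)
  finally show ?thesis .
qed

lemma l2_inner_diff_left:
  "\<phi> \<in> ell2 \<Longrightarrow> \<eta> \<in> ell2 \<Longrightarrow> \<psi> \<in> ell2 \<Longrightarrow> l2_inner (\<lambda>n. \<phi> n - \<eta> n) \<psi> = l2_inner \<phi> \<psi> - l2_inner \<eta> \<psi>"
  unfolding l2_inner_def by (simp add: suminf_diff[OF l2_inner_terms_summable l2_inner_terms_summable] left_diff_distrib)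

definition cutoff :: "nat \<Rightarrow> cseq \<Rightarrow> cseq" where
  "cutoff L \<psi> n = (if n < L then \<psi> n else 0)"

lemma ell2_cutoff [intro]: "\<psi> \<in> ell2 \<Longrightarrow> cutoff L \<psi> \<in> ell2"
  by (rule ell2_finite[of "{..<L}"]) (auto simp: cutoff_def ell2_zero_at_0)

lemma cutoff_tendsto:
  assumes "\<psi> \<in> ell2"
  shows "(\<lambda>L. l2_norm (\<lambda>n. \<psi> n - cutoff L \<psi> n)) \<longlonglongrightarrow> 0"
proof -
  have "l2_norm (\<lambda>n. \<psi> n - cutoff L \<psi> n) = sqrt ((\<Sum>n. (cmod (\<psi> n))\<^sup>2) - (\<Sum>n<L. (cmod (\<psi> n))\<^sup>2))" for L
  proof -
    have "(\<Sum>n. (cmod (\<psi> n - cutoff L \<psi> n))\<^sup>2) = (\<Sum>n. (cmod (\<psi> n))\<^sup>2 - (if n < L then (cmod (\<psi> n))\<^sup>2 else 0))"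
      by (rule suminf_cong) (auto simp: cutoff_def)
    also have "\<dots> = (\<Sum>n. (cmod (\<psi> n))\<^sup>2) - (\<Sum>n. if n < L then (cmod (\<psi> n))\<^sup>2 else 0)"
      by (intro suminf_diff[symmetric] ell2_summable assms summable_finite[of "{..<L}"]) auto
    also have "(\<Sum>n. if n < L then (cmod (\<psi> n))\<^sup>2 else 0) = (\<Sum>n<L. (cmod (\<psi> n))\<^sup>2)"
      by (subst suminf_finite[of "{..<L}"]) auto
    finally show ?thesis by (simp add: l2_norm_def)
  qed
  moreover have "(\<lambda>L. sqrt ((\<Sum>n. (cmod (\<psi> n))\<^sup>2) - (\<Sum>n<L. (cmod (\<psi> n))\<^sup>2))) \<longlonglongrightarrow> sqrt 0"
    using tendsto_diff[OF tendsto_const summable_LIMSEQ[OF ell2_summable[OF assms]], of "\<Sum>n. (cmod (\<psi> n))\<^sup>2"]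
    by (intro tendsto_real_sqrt) simp
  ultimately show ?thesis by simp
qed

lemma l2_tendsto_component:
  assumes "l2_tendsto X \<psi>" "\<And>k. X k \<in> ell2" "\<psi> \<in> ell2"
  shows "(\<lambda>k. X k n) \<longlonglongrightarrow> \<psi> n"
proof -
  have "(\<lambda>k. X k n - \<psi> n) \<longlonglongrightarrow> 0"
    by (rule Lim_null_comparison[OF _ assms(1)[unfolded l2_tendsto_def]])
      (use assms in \<open>auto intro!: always_eventually cmod_le_l2_norm[of "\<lambda>n. X _ n - \<psi> n"]\<close>)
  then show ?thesis by (simp add: LIM_zero_iff)
qed

lemma l2_tendsto_unique:
  assumes "l2_tendsto X \<phi>" "l2_tendsto X \<psi>" "\<And>k. X k \<in> ell2" "\<phi> \<in> ell2" "\<psi> \<in> ell2"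
  shows "\<phi> = \<psi>"
  using LIMSEQ_unique[OF l2_tendsto_component[OF assms(1,3,4)] l2_tendsto_component[OF assms(2,3,5)]] by auto

lemma l2_tendsto_bounded_operator:
  assumes "l2_tendsto X \<psi>" "\<And>k. X k \<in> ell2" "\<psi> \<in> ell2"
    and maps: "\<And>\<phi>. \<phi> \<in> ell2 \<Longrightarrow> T \<phi> \<in> ell2"
    and bound: "\<And>\<phi>. \<phi> \<in> ell2 \<Longrightarrow> l2_norm (T \<phi>) \<le> C * l2_norm \<phi>"
    and diff: "\<And>\<phi> \<eta>. \<phi> \<in> ell2 \<Longrightarrow> \<eta> \<in> ell2 \<Longrightarrow> T (\<lambda>n. \<phi> n - \<eta> n) = (\<lambda>n. T \<phi> n - T \<eta> n)"
  shows "l2_tendsto (\<lambda>k. T (X k)) (T \<psi>)"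
  unfolding l2_tendsto_def
proof (rule Lim_null_comparison)
  show "\<forall>\<^sub>F k in sequentially. norm (l2_norm (\<lambda>n. T (X k) n - T \<psi> n)) \<le> C * l2_norm (\<lambda>n. X k n - \<psi> n)"
    using bound[OF ell2_diff[OF assms(2,3)]] diff[OF assms(2,3)] l2_norm_nonneg[OF maps[OF ell2_diff[OF assms(2,3)]]]
    by (intro always_eventually) simp
  show "(\<lambda>k. C * l2_norm (\<lambda>n. X k n - \<psi> n)) \<longlonglongrightarrow> 0"
    using tendsto_mult_right_zero[OF assms(1)[unfolded l2_tendsto_def]] by simp
qed

section \<open>Bounded Borel functions\<close>

lemma bounded_borelI: "f \<in> borel_measurable borel \<Longrightarrow> (\<And>x. cmod (f x) \<le> C) \<Longrightarrow> f \<in> bounded_borel"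
  by (auto simp: bounded_borel_def bounded_iff)

lemma bounded_borelE:
  assumes "f \<in> bounded_borel"
  obtains C where "C \<ge> 0" "\<And>x. cmod (f x) \<le> C"
proof -
  obtain B where "\<forall>x. cmod (f x) \<le> B" using assms by (auto simp: bounded_borel_def bounded_iff)
  then show ?thesis by (intro that[of "max 0 B"]) (auto simp: le_max_iff_disj)
qed

lemma bounded_borel_measurable: "f \<in> bounded_borel \<Longrightarrow> f \<in> borel_measurable borel"
  by (simp add: bounded_borel_def)

lemma bounded_borel_const [intro]: "(\<lambda>_. c) \<in> bounded_borel"
  by (rule bounded_borelI[of _ "cmod c"]) auto

lemma bounded_borel_mult [intro]:
  assumes "f \<in> bounded_borel" "g \<in> bounded_borel"
  shows "(\<lambda>x. f x * g x) \<in> bounded_borel"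
proof -
  obtain C D where C: "C \<ge> 0" "\<And>x. cmod (f x) \<le> C" and D: "\<And>x. cmod (g x) \<le> D"
    using assms by (metis bounded_borelE)
  show ?thesis
    by (rule bounded_borelI[of _ "C * D"])
      (use assms C D in \<open>auto simp: norm_mult bounded_borel_measurable intro!: mult_mono borel_measurable_times\<close>)
qed

lemma bounded_borel_add [intro]:
  assumes "f \<in> bounded_borel" "g \<in> bounded_borel"
  shows "(\<lambda>x. f x + g x) \<in> bounded_borel"
proof -
  obtain C D where C: "\<And>x. cmod (f x) \<le> C" and D: "\<And>x. cmod (g x) \<le> D"
    using assms by (metis bounded_borelE)
  show ?thesis
    by (rule bounded_borelI[of _ "C + D"])
      (use assms C D in \<open>auto simp: bounded_borel_measurable intro!: norm_triangle_le add_mono borel_measurable_add\<close>)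
qed

lemma bounded_borel_lincomb [intro]:
  "f \<in> bounded_borel \<Longrightarrow> g \<in> bounded_borel \<Longrightarrow> (\<lambda>x. a * f x + b * g x) \<in> bounded_borel"
  by (intro bounded_borel_add bounded_borel_mult bounded_borel_const)

lemma bounded_borel_sum:
  "(\<And>i. i \<in> I \<Longrightarrow> f i \<in> bounded_borel) \<Longrightarrow> (\<lambda>x. \<Sum>i\<in>I. f i x) \<in> bounded_borel"
  by (induction I rule: infinite_finite_induct) auto

lemma bounded_borel_diff [intro]:
  "f \<in> bounded_borel \<Longrightarrow> g \<in> bounded_borel \<Longrightarrow> (\<lambda>x. f x - g x) \<in> bounded_borel"
  using bounded_borel_lincomb[of f g 1 "-1"] by simp

lemma bounded_borel_cnj [intro]:
  assumes "f \<in> bounded_borel" shows "(\<lambda>x. cnj (f x)) \<in> bounded_borel"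
proof -
  obtain C where "\<And>x. cmod (f x) \<le> C" using assms by (metis bounded_borelE)
  moreover have "(\<lambda>x. cnj (f x)) \<in> borel_measurable borel"
    by (rule borel_measurable_continuous_on[OF _ bounded_borel_measurable[OF assms]]) (intro continuous_intros)
  ultimately show ?thesis by (intro bounded_borelI[of _ C]) auto
qed

lemma bounded_borel_indicator [intro]: "S \<in> sets borel \<Longrightarrow> indicator S \<in> bounded_borel"
  by (rule bounded_borelI[of _ 1]) (auto simp: indicator_def)

text \<open>As a function of the operator this is the resolvent at \<open>z\<close>.\<close>

definition cauchy_kernel :: "complex \<Rightarrow> real \<Rightarrow> complex" where
  "cauchy_kernel z x = 1 / (of_real x - z)"

lemma of_real_neq_nonreal: "Im z \<noteq> 0 \<Longrightarrow> of_real x - z \<noteq> 0"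
  by (metis Im_complex_of_real eq_iff_diff_eq_0)

lemma cmod_cauchy_kernel_le:
  assumes "Im z \<noteq> 0" shows "cmod (cauchy_kernel z x) \<le> 1 / \<bar>Im z\<bar>"
proof -
  have "\<bar>Im z\<bar> \<le> cmod (of_real x - z)" using abs_Im_le_cmod[of "of_real x - z"] by simp
  then show ?thesis using assms of_real_neq_nonreal[OF assms, of x]
    unfolding cauchy_kernel_def norm_divide by (auto intro!: divide_left_mono mult_pos_pos)
qed

lemma bounded_borel_cauchy_kernel [intro]: "Im z \<noteq> 0 \<Longrightarrow> cauchy_kernel z \<in> bounded_borel"
  by (rule bounded_borelI[OF _ cmod_cauchy_kernel_le]) (auto simp: cauchy_kernel_def)

text \<open>A monotone class theorem adapted to resolvents. The function \<open>c(x) = (x - a)/(1 + (x - a)\<^sup>2)\<close> is a combination of the kernels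
  at \<open>a + \<i>\<close> and \<open>a - \<i>\<close>, is bounded by 1, and is positive exactly on the ray \<open>x > a\<close>. By the Weierstrass theorem \<open>G\<close>
  contains every continuous function of \<open>c\<close>, hence in the limit the indicator of the ray. Dynkin's lemma extends this to Borel sets, and
  simple functions approximate the rest.\<close>

lemma bounded_borel_monotone_class:
  assumes lincomb: "\<And>f g a b. f \<in> G \<Longrightarrow> g \<in> G \<Longrightarrow> (\<lambda>x. a * f x + b * g x) \<in> G"
    and mult: "\<And>f g. f \<in> G \<Longrightarrow> g \<in> G \<Longrightarrow> (\<lambda>x. f x * g x) \<in> G"
    and one: "(\<lambda>_. 1) \<in> G"
    and limit: "\<And>h f C. (\<And>k. h k \<in> G) \<Longrightarrow> f \<in> bounded_borel \<Longrightarrow> (\<And>x. (\<lambda>k. h k x) \<longlonglongrightarrow> f x) \<Longrightarrow>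
        (\<And>k x. cmod (h k x) \<le> C) \<Longrightarrow> f \<in> G"
    and kernel: "\<And>z. Im z \<noteq> 0 \<Longrightarrow> cauchy_kernel z \<in> G"
  shows "bounded_borel \<subseteq> G"
proof -
  have const: "(\<lambda>_. c) \<in> G" for c using lincomb[OF one one, of c 0] by simp
  have add: "(\<lambda>x. f x + g x) \<in> G" if "f \<in> G" "g \<in> G" for f g using lincomb[OF that, of 1 1] by simp
  have cmult: "(\<lambda>x. c * f x) \<in> G" if "f \<in> G" for f c using lincomb[OF that that, of c 0] by simp
  have sum: "(\<lambda>x. \<Sum>i\<in>I. f i x) \<in> G" if "\<And>i. i \<in> I \<Longrightarrow> f i \<in> G" for I :: "complex set" and f
    using that by (induction I rule: infinite_finite_induct) (auto intro: const add)
  have sum': "(\<lambda>x. \<Sum>i\<in>I. f i x) \<in> G" if "\<And>i. i \<in> I \<Longrightarrow> f i \<in> G" for I :: "nat set" and f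
    using that by (induction I rule: infinite_finite_induct) (auto intro: const add)
  have ray: "indicator {a<..} \<in> G" for a
  proof -
    define c where "c x = (x - a) / (1 + (x - a)\<^sup>2)" for x :: real
    have c_le: "c x \<in> {-1..1}" for x
    proof -
      have "2 * \<bar>x - a\<bar> \<le> 1 + (x - a)\<^sup>2" using sum_squares_bound[of 1 "\<bar>x - a\<bar>"]
        unfolding power2_abs by simp
      moreover have "1 + (x - a)\<^sup>2 > 0" by (simp add: add_pos_nonneg)
      ultimately have "\<bar>c x\<bar> \<le> 1" unfolding c_def abs_divide by (simp add: divide_le_eq)
      then show ?thesis by auto
    qed
    have [measurable]: "c \<in> borel_measurable borel" unfolding c_def by measurable
    have c_pos: "c x > 0 \<longleftrightarrow> x > a" for x
    proof -
      have "1 + (x - a)\<^sup>2 > 0" by (simp add: add_pos_nonneg)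
      then show ?thesis by (simp add: c_def zero_less_divide_iff)
    qed
    have cG: "(\<lambda>x. of_real (c x)) \<in> G"
    proof -
      have "(\<lambda>x. (1/2) * cauchy_kernel (Complex a 1) x + (1/2) * cauchy_kernel (Complex a (-1)) x) \<in> G"
        by (intro lincomb kernel) auto
      moreover have "(1/2) * cauchy_kernel (Complex a 1) x + (1/2) * cauchy_kernel (Complex a (-1)) x = of_real (c x)" for x
      proof -
        define y where "y = complex_of_real (x - a)"
        have nz: "y - \<i> \<noteq> 0" "y + \<i> \<noteq> 0" by (auto simp: y_def complex_eq_iff)
        have fac: "1 + y\<^sup>2 = (y - \<i>) * (y + \<i>)" by (simp add: algebra_simps power2_eq_square)
        have C: "Complex a 1 = of_real a + \<i>" "Complex a (-1) = of_real a - \<i>" by (auto simp: complex_eq_iff)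
        have "(1/2) * cauchy_kernel (Complex a 1) x + (1/2) * cauchy_kernel (Complex a (-1)) x
            = (1/2) / (y - \<i>) + (1/2) / (y + \<i>)"
          unfolding cauchy_kernel_def C y_def by (simp add: algebra_simps)
        also have "\<dots> = ((1/2) * (y + \<i>) + (1/2) * (y - \<i>)) / ((y - \<i>) * (y + \<i>))"
          by (rule add_frac_eq[OF nz])
        also have "(1/2) * (y + \<i>) + (1/2) * (y - \<i>) = y" by (simp add: field_simps)
        also have "y / ((y - \<i>) * (y + \<i>)) = of_real (c x)" unfolding fac[symmetric] unfolding y_def c_def
          by (simp only: of_real_divide of_real_add of_real_power of_real_1)
        finally show ?thesis .
      qed
      ultimately show ?thesis by simp
    qed
    have poly: "(\<lambda>x. complex_of_real (q (c x))) \<in> G" if "real_polynomial_function q" for q :: "real \<Rightarrow> real"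
      using that
    proof induction
      case (linear f)
      have "f y = f 1 * y" for y using linear_scale[OF bounded_linear.linear[OF linear], of y 1] by simp
      then have "complex_of_real (f (c x)) = of_real (f 1) * of_real (c x)" for x
        by (metis of_real_mult)
      then show ?case using cmult[OF cG, of "of_real (f 1)"] by simp
    next
      case (mult f g)
      then show ?case using assms(2)[of "\<lambda>x. of_real (f (c x))" "\<lambda>x. of_real (g (c x))"] by simp
    next
      case (add f g)
      then show ?case using lincomb[of "\<lambda>x. of_real (f (c x))" "\<lambda>x. of_real (g (c x))" 1 1] by simp
    qed (rule const)
    have cont: "(\<lambda>x. complex_of_real (g (c x))) \<in> G" if g: "continuous_on UNIV g" for g :: "real \<Rightarrow> real"
    proof -
      have g': "continuous_on {-1..1} g" using g continuous_on_subset by blast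
      have "\<exists>q. real_polynomial_function q \<and> (\<forall>y\<in>{-1..1}. \<bar>g y - q y\<bar> < inverse (real (Suc k)))" for k
        by (rule Stone_Weierstrass_real_polynomial_function[OF _ g', where e = "inverse (real (Suc k))"]) auto
      then obtain q where q: "\<And>k. real_polynomial_function (q k)"
        "\<And>k y. y \<in> {-1..1} \<Longrightarrow> \<bar>g y - q k y\<bar> < inverse (real (Suc k))" by metis
      obtain B where B: "\<And>y. y \<in> {-1..1} \<Longrightarrow> \<bar>g y\<bar> \<le> B"
        using compact_imp_bounded[OF compact_continuous_image[OF g' compact_Icc]]
        unfolding bounded_iff real_norm_def by blast
      show ?thesis
      proof (rule limit[of "\<lambda>k x. of_real (q k (c x))" _ "B + 1"])
        show "(\<lambda>x. complex_of_real (q k (c x))) \<in> G" for k by (rule poly[OF q(1)])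
        show "(\<lambda>x. complex_of_real (g (c x))) \<in> bounded_borel"
        proof (rule bounded_borelI[of _ B])
          have [measurable]: "g \<in> borel_measurable borel" using g by (rule borel_measurable_continuous_onI)
          show "(\<lambda>x. complex_of_real (g (c x))) \<in> borel_measurable borel" by measurable
        qed (use B c_le in auto)
        show "(\<lambda>k. complex_of_real (q k (c x))) \<longlonglongrightarrow> complex_of_real (g (c x))" for x
        proof (rule tendsto_of_real, rule LIM_zero_cancel, rule Lim_null_comparison[OF always_eventually])
          show "\<forall>k. norm (q k (c x) - g (c x)) \<le> inverse (real (Suc k))"
            using q(2)[OF c_le] by (auto simp: abs_minus_commute less_imp_le)
          show "(\<lambda>k. inverse (real (Suc k))) \<longlonglongrightarrow> 0" by (rule LIMSEQ_inverse_real_of_nat)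
        qed
        show "cmod (complex_of_real (q k (c x))) \<le> B + 1" for k x
        proof -
          have "inverse (real (Suc k)) \<le> 1" by (simp add: inverse_eq_divide)
          then have "\<bar>g (c x) - q k (c x)\<bar> \<le> 1" using q(2)[OF c_le, of x k] by linarith
          then have "\<bar>q k (c x)\<bar> \<le> B + 1" using B[OF c_le, of x] by linarith
          then show ?thesis by simp
        qed
      qed
    qed
    show ?thesis
    proof (rule limit[of "\<lambda>k x. of_real (min 1 (real k * max 0 (c x)))" _ 1])
      show "(\<lambda>x. complex_of_real (min 1 (real k * max 0 (c x)))) \<in> G" for k
        by (rule cont) (intro continuous_intros)
      show "(\<lambda>k. complex_of_real (min 1 (real k * max 0 (c x)))) \<longlonglongrightarrow> indicator {a<..} x" for x
      proof (cases "x > a")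
        case True
        then have "c x > 0" by (simp add: c_pos)
        obtain K where K: "1 / c x < real K" using reals_Archimedean2 by blast
        have "\<forall>\<^sub>F k in sequentially. complex_of_real (min 1 (real k * max 0 (c x))) = indicator {a<..} x"
          using eventually_ge_at_top[of K]
        proof eventually_elim
          case (elim k)
          then have "1 \<le> real k * c x" using K \<open>c x > 0\<close>
            by (simp add: divide_less_eq) (meson less_imp_le mult_right_mono of_nat_le_iff order_trans)
          then show ?case using True \<open>c x > 0\<close> by (simp add: max_def min_def)
        qed
        then show ?thesis by (rule tendsto_eventually)
      next
        case False
        then have "c x \<le> 0" using c_pos[of x] by linarith
        then show ?thesis using False by (simp add: max_def)
      qed
      show "indicator {a<..} \<in> bounded_borel" by (rule bounded_borel_indicator) simp
      show "cmod (complex_of_real (min 1 (real k * max 0 (c x)))) \<le> 1" for k x by simp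
    qed
  qed
  have borel: "indicator S \<in> G" if "S \<in> sets borel" for S :: "real set"
  proof -
    have eq: "sets borel = sigma_sets UNIV (range (\<lambda>a::real. {a<..}))"
      by (simp only: borel_Ioi) (rule sets_measure_of, simp)
    have "{a<..} \<inter> {b<..} = {max a b<..}" for a b :: real by auto
    then have "Int_stable (range (\<lambda>a::real. {a<..}))" by (auto simp: Int_stable_def)
    moreover have "range (\<lambda>a::real. {a<..}) \<subseteq> Pow UNIV" by simp
    moreover have "S \<in> sigma_sets UNIV (range (\<lambda>a::real. {a<..}))" using that eq by simp
    ultimately show ?thesis
    proof (induction rule: sigma_sets_induct_disjoint)
      show "indicator {} \<in> G" using const[of 0] by (simp add: indicator_def[abs_def])
      show "indicator A \<in> G" if "A \<in> range (\<lambda>a::real. {a<..})" for A using that ray by auto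
      show "indicator (UNIV - A) \<in> G" if "indicator A \<in> G" for A
      proof -
        have "(\<lambda>x. 1 * 1 + (-1) * indicator A x) \<in> G" by (rule lincomb[OF one that])
        also have "(\<lambda>x. 1 * 1 + (-1) * indicator A x) = (indicator (UNIV - A) :: real \<Rightarrow> complex)"
          by (auto simp: indicator_def)
        finally show ?thesis .
      qed
      show "indicator (\<Union>i. A i) \<in> G"
        if A: "disjoint_family A" "range A \<subseteq> sigma_sets UNIV (range (\<lambda>a::real. {a<..}))" "\<And>i. indicator (A i) \<in> G"
        for A :: "nat \<Rightarrow> real set"
      proof (rule limit[of "\<lambda>k x. \<Sum>i<k. indicator (A i) x" _ 1])
        show "(\<lambda>x. \<Sum>i<k. indicator (A i) x) \<in> G" for k by (intro sum' A)
        show "indicator (\<Union>i. A i) \<in> bounded_borel"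
          using A(2) unfolding eq[symmetric] by (intro bounded_borel_indicator) auto
        have partial: "(\<Sum>i<k. indicator (A i) x) = (indicator (\<Union>i<k. A i) x :: complex)" for k x
          using A(1) by (intro indicator_UN_disjoint[symmetric]) (auto simp: disjoint_family_on_def)
        show "cmod (\<Sum>i<k. indicator (A i) x) \<le> 1" for k x unfolding partial by (simp add: indicator_def)
        show "(\<lambda>k. \<Sum>i<k. indicator (A i) x) \<longlonglongrightarrow> (indicator (\<Union>i. A i) x :: complex)" for x
        proof (cases "x \<in> (\<Union>i. A i)")
          case True
          then obtain j where j: "x \<in> A j" by auto
          have "\<forall>\<^sub>F k in sequentially. indicator (\<Union>i<k. A i) x = (indicator (\<Union>i. A i) x :: complex)"
            using eventually_gt_at_top[of j] by eventually_elim (use j in \<open>auto simp: indicator_def\<close>)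
          then show ?thesis unfolding partial by (rule tendsto_eventually)
        qed (simp add: partial indicator_def)
      qed
    qed
  qed
  show ?thesis
  proof
    fix f :: "real \<Rightarrow> complex" assume f: "f \<in> bounded_borel"
    obtain C where C: "\<And>x. cmod (f x) \<le> C" using f by (metis bounded_borelE)
    obtain F where F: "\<And>i. simple_function borel (F i)" "\<And>x. (\<lambda>i. F i x) \<longlonglongrightarrow> f x"
      "\<And>i x. dist (F i x) 0 \<le> 2 * dist (f x) 0"
      using borel_measurable_implies_sequence_metric[OF bounded_borel_measurable[OF f], of 0] by auto
    show "f \<in> G"
    proof (rule limit[OF _ f F(2)])
      fix i
      have fin: "finite (range (F i))" using F(1)[of i] by (simp add: simple_function_def)
      have "(\<lambda>x. \<Sum>y\<in>range (F i). y * indicator (F i -` {y}) x) \<in> G"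
      proof (intro sum cmult borel)
        fix y assume "y \<in> range (F i)"
        then show "F i -` {y} \<in> sets borel" using F(1)[of i] by (auto simp: simple_function_def)
      qed
      also have "(\<lambda>x. \<Sum>y\<in>range (F i). y * indicator (F i -` {y}) x) = F i"
      proof
        fix x
        have "(\<Sum>y\<in>range (F i). y * indicator (F i -` {y}) x) = (\<Sum>y\<in>range (F i). if F i x = y then y else 0)"
          by (rule sum.cong) (auto simp: indicator_def)
        also have "\<dots> = F i x" using fin by (subst sum.delta') auto
        finally show "(\<Sum>y\<in>range (F i). y * indicator (F i -` {y}) x) = F i x" .
      qed
      finally show "F i \<in> G" .
    next
      show "cmod (F i x) \<le> 2 * C" for i x using F(3)[of i x] C[of x] by simp
    qed
  qed
qed

section \<open>Functions of the operator\<close>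

text \<open>A probability measure that makes the polynomials orthonormal. Then \<open>\<delta>\<^sub>n \<mapsto> opoly V n\<close> is an isometry from sequences into
  \<open>L\<^sup>2(\<mu>)\<close> which turns \<open>H\<close> into multiplication by \<open>x\<close>.\<close>

locale orthonormality_measure = real_distribution \<mu> for \<mu> :: "real measure" +
  fixes V :: "nat \<Rightarrow> real"
  assumes int_opoly: "m \<ge> 1 \<Longrightarrow> n \<ge> 1 \<Longrightarrow> integrable \<mu> (\<lambda>x. opoly V m x * opoly V n x)"
    and orth_opoly: "m \<ge> 1 \<Longrightarrow> n \<ge> 1 \<Longrightarrow> (\<integral>x. opoly V m x * opoly V n x \<partial>\<mu>) = of_bool (m = n)"
begin

lemma integrable_opoly_opoly: "integrable \<mu> (\<lambda>x. opoly V m x * opoly V n x)"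
  using int_opoly[of m n] by (cases m; cases n) auto

lemma integral_opoly_opoly: "(\<integral>x. opoly V m x * opoly V n x \<partial>\<mu>) = of_bool (m = n \<and> m \<noteq> 0)"
  using orth_opoly[of m n] by (cases m; cases n) auto

definition square_integrable :: "(real \<Rightarrow> complex) \<Rightarrow> bool" where
  "square_integrable g \<longleftrightarrow> g \<in> borel_measurable borel \<and> integrable \<mu> (\<lambda>x. (cmod (g x))\<^sup>2)"

lemma square_integrable_measurable: "square_integrable g \<Longrightarrow> g \<in> borel_measurable borel"
  and square_integrable_integrable: "square_integrable g \<Longrightarrow> integrable \<mu> (\<lambda>x. (cmod (g x))\<^sup>2)"
  by (auto simp: square_integrable_def)

lemma integrable_mult_square_integrable:
  assumes "square_integrable g" "square_integrable h"
  shows "integrable \<mu> (\<lambda>x. g x * h x)"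
proof (rule Bochner_Integration.integrable_bound)
  show "integrable \<mu> (\<lambda>x. (cmod (g x))\<^sup>2 + (cmod (h x))\<^sup>2)"
    using assms by (intro Bochner_Integration.integrable_add square_integrable_integrable)
  have [measurable]: "g \<in> borel_measurable borel" "h \<in> borel_measurable borel"
    using assms by (auto simp: square_integrable_measurable)
  show "(\<lambda>x. g x * h x) \<in> borel_measurable \<mu>" by measurable
  have "cmod (g x) * cmod (h x) \<le> (cmod (g x))\<^sup>2 + (cmod (h x))\<^sup>2" for x
    using sum_squares_bound[of "cmod (g x)" "cmod (h x)"] mult_nonneg_nonneg[OF norm_ge_zero[of "g x"] norm_ge_zero[of "h x"]]
    by linarith
  then show "AE x in \<mu>. norm (g x * h x) \<le> norm ((cmod (g x))\<^sup>2 + (cmod (h x))\<^sup>2)"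
    by (intro AE_I2) (auto simp: norm_mult intro: order_trans[OF _ abs_ge_self])
qed

lemma square_integrable_bounded_mult:
  assumes "f \<in> bounded_borel" "square_integrable g"
  shows "square_integrable (\<lambda>x. f x * g x)"
proof -
  obtain C where C: "C \<ge> 0" "\<And>x. cmod (f x) \<le> C" using assms by (metis bounded_borelE)
  have [measurable]: "g \<in> borel_measurable borel" "f \<in> borel_measurable borel"
    using assms by (auto simp: square_integrable_measurable bounded_borel_measurable)
  have "integrable \<mu> (\<lambda>x. (cmod (f x * g x))\<^sup>2)"
  proof (rule Bochner_Integration.integrable_bound)
    show "integrable \<mu> (\<lambda>x. C\<^sup>2 * (cmod (g x))\<^sup>2)"
      using assms by (intro integrable_mult_right square_integrable_integrable)
    show "AE x in \<mu>. norm ((cmod (f x * g x))\<^sup>2) \<le> norm (C\<^sup>2 * (cmod (g x))\<^sup>2)"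
      using C by (intro AE_I2) (auto simp: norm_mult power_mult_distrib intro!: mult_right_mono power_mono)
  qed measurable
  then show ?thesis by (simp add: square_integrable_def)
qed

lemma square_integrable_add:
  assumes "square_integrable g" "square_integrable h"
  shows "square_integrable (\<lambda>x. g x + h x)"
proof -
  have [measurable]: "g \<in> borel_measurable borel" "h \<in> borel_measurable borel"
    using assms by (auto simp: square_integrable_measurable)
  have "integrable \<mu> (\<lambda>x. (cmod (g x + h x))\<^sup>2)"
  proof (rule Bochner_Integration.integrable_bound)
    show "integrable \<mu> (\<lambda>x. 2 * (cmod (g x))\<^sup>2 + 2 * (cmod (h x))\<^sup>2)"
      using assms by (intro Bochner_Integration.integrable_add integrable_mult_right square_integrable_integrable)
    have "(cmod (g x + h x))\<^sup>2 \<le> 2 * (cmod (g x))\<^sup>2 + 2 * (cmod (h x))\<^sup>2" for x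
    proof -
      have "(cmod (g x + h x))\<^sup>2 \<le> (cmod (g x) + cmod (h x))\<^sup>2"
        by (intro power_mono norm_triangle_ineq) auto
      then show ?thesis using sum_squares_bound[of "cmod (g x)" "cmod (h x)"] by (simp add: power2_sum)
    qed
    then show "AE x in \<mu>. norm ((cmod (g x + h x))\<^sup>2) \<le> norm (2 * (cmod (g x))\<^sup>2 + 2 * (cmod (h x))\<^sup>2)"
      by (intro AE_I2) (auto intro: order_trans[OF _ abs_ge_self])
  qed measurable
  then show ?thesis by (simp add: square_integrable_def)
qed

lemma square_integrable_opoly: "square_integrable (\<lambda>x. of_real (opoly V n x))"
  using integrable_opoly_opoly[of n n] by (simp add: square_integrable_def power2_eq_square abs_mult_self_eq)

lemma square_integrable_cmult: "square_integrable g \<Longrightarrow> square_integrable (\<lambda>x. c * g x)"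
  by (rule square_integrable_bounded_mult) auto

lemma square_integrable_sum:
  "(\<And>i. i \<in> I \<Longrightarrow> square_integrable (g i)) \<Longrightarrow> square_integrable (\<lambda>x. \<Sum>i\<in>I. g i x)"
proof (induction I rule: infinite_finite_induct)
  case (insert i I)
  then show ?case using square_integrable_add[of "g i"] by simp
qed (auto simp: square_integrable_def)

text \<open>The image of the first \<open>L\<close> entries of \<open>a\<close> under the isometry.\<close>

definition opoly_comb :: "cseq \<Rightarrow> nat \<Rightarrow> real \<Rightarrow> complex" where
  "opoly_comb a L x = (\<Sum>n<L. a n * of_real (opoly V n x))"

lemma square_integrable_opoly_comb: "square_integrable (opoly_comb a L)"
  unfolding opoly_comb_def[abs_def]
  by (intro square_integrable_sum square_integrable_cmult square_integrable_opoly)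

lemma integral_of_real_opoly_opoly:
  "(\<integral>x. complex_of_real (opoly V m x) * of_real (opoly V n x) \<partial>\<mu>) = of_bool (m = n \<and> m \<noteq> 0)"
  unfolding of_real_mult[symmetric] integral_complex_of_real integral_opoly_opoly by simp

lemma integral_opoly_opoly_comb:
  "(\<integral>x. of_real (opoly V m x) * opoly_comb a L x \<partial>\<mu>) = (if m < L \<and> m \<noteq> 0 then a m else 0)"
proof -
  have "(\<integral>x. of_real (opoly V m x) * opoly_comb a L x \<partial>\<mu>) =
      (\<integral>x. (\<Sum>n<L. a n * (of_real (opoly V m x) * of_real (opoly V n x))) \<partial>\<mu>)"
    by (simp add: opoly_comb_def sum_distrib_left mult_ac)
  also have "\<dots> = (\<Sum>n<L. a n * (\<integral>x. of_real (opoly V m x) * of_real (opoly V n x) \<partial>\<mu>))"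
    by (subst Bochner_Integration.integral_sum)
      (auto intro!: integrable_mult_right integrable_mult_square_integrable square_integrable_opoly)
  also have "\<dots> = (\<Sum>n<L. if m = n then a n * of_bool (m \<noteq> 0) else 0)"
    by (rule sum.cong) (auto simp: integral_of_real_opoly_opoly)
  also have "\<dots> = (if m < L \<and> m \<noteq> 0 then a m else 0)" by (subst sum.delta') auto
  finally show ?thesis .
qed

lemma square_integrable_cnj:
  assumes "square_integrable g" shows "square_integrable (\<lambda>x. cnj (g x))"
proof -
  have "(\<lambda>x. cnj (g x)) \<in> borel_measurable borel"
    by (rule borel_measurable_continuous_on[OF _ square_integrable_measurable[OF assms]]) (intro continuous_intros)
  then show ?thesis using assms by (simp add: square_integrable_def)
qed

lemma integral_cnj_opoly_comb_mult:
  assumes "square_integrable g"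
  shows "(\<integral>x. cnj (opoly_comb a L x) * g x \<partial>\<mu>) = (\<Sum>n<L. cnj (a n) * (\<integral>x. of_real (opoly V n x) * g x \<partial>\<mu>))"
proof -
  have "(\<integral>x. cnj (opoly_comb a L x) * g x \<partial>\<mu>) = (\<integral>x. (\<Sum>n<L. cnj (a n) * (of_real (opoly V n x) * g x)) \<partial>\<mu>)"
    by (rule Bochner_Integration.integral_cong) (simp_all add: opoly_comb_def sum_distrib_left sum_distrib_right mult_ac)
  then show ?thesis
    by (subst (asm) Bochner_Integration.integral_sum)
      (auto intro!: integrable_mult_right integrable_mult_square_integrable square_integrable_opoly assms)
qed

lemma integral_cmod_sq:
  assumes "square_integrable g" shows "of_real (\<integral>x. (cmod (g x))\<^sup>2 \<partial>\<mu>) = (\<integral>x. cnj (g x) * g x \<partial>\<mu>)"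
  unfolding integral_complex_of_real[symmetric] by (simp add: complex_norm_square mult.commute del: of_real_power)

lemma norm_opoly_comb:
  assumes "a 0 = 0"
  shows "(\<integral>x. (cmod (opoly_comb a L x))\<^sup>2 \<partial>\<mu>) = (\<Sum>n<L. (cmod (a n))\<^sup>2)"
proof -
  have "complex_of_real (\<integral>x. (cmod (opoly_comb a L x))\<^sup>2 \<partial>\<mu>) = (\<Sum>n<L. cnj (a n) * (if n < L \<and> n \<noteq> 0 then a n else 0))"
    unfolding integral_cmod_sq[OF square_integrable_opoly_comb]
      integral_cnj_opoly_comb_mult[OF square_integrable_opoly_comb] integral_opoly_opoly_comb ..
  also have "\<dots> = (\<Sum>n<L. of_real ((cmod (a n))\<^sup>2))"
    by (rule sum.cong) (auto simp: assms complex_norm_square mult.commute simp del: of_real_power)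
  finally show ?thesis unfolding of_real_sum[symmetric] of_real_eq_iff .
qed

text \<open>Bessel's inequality, the source of all bounds on \<open>f(H)\<close>. Equality, that is, completeness of the polynomials, comes only with
  self-adjointness, in the form that \<open>f \<mapsto> f(H)\<close> is multiplicative.\<close>

lemma bessel_opoly:
  assumes g: "square_integrable g"
  shows "(\<Sum>m<N. (cmod (\<integral>x. of_real (opoly V m x) * g x \<partial>\<mu>))\<^sup>2) \<le> (\<integral>x. (cmod (g x))\<^sup>2 \<partial>\<mu>)"
proof -
  define c where "c m = (\<integral>x. of_real (opoly V m x) * g x \<partial>\<mu>)" for m
  have c0: "c 0 = 0" by (simp add: c_def)
  let ?u = "opoly_comb c N"
  note u = square_integrable_opoly_comb[of c N]
  have int_ug: "integrable \<mu> (\<lambda>x. cnj (?u x) * g x)"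
    by (intro integrable_mult_square_integrable square_integrable_cnj u g)
  have eq: "(cmod (g x - ?u x))\<^sup>2 = (cmod (g x))\<^sup>2 + (cmod (?u x))\<^sup>2 - 2 * Re (cnj (?u x) * g x)" for x
    unfolding cmod_power2 by (simp add: power2_eq_square algebra_simps)
  have "(\<integral>x. cnj (?u x) * g x \<partial>\<mu>) = (\<Sum>n<N. of_real ((cmod (c n))\<^sup>2))"
    unfolding integral_cnj_opoly_comb_mult[OF g] c_def[symmetric]
    by (simp add: complex_norm_square mult.commute del: of_real_power)
  then have "Re (\<integral>x. cnj (?u x) * g x \<partial>\<mu>) = (\<Sum>n<N. (cmod (c n))\<^sup>2)"
    by (simp add: of_real_sum[symmetric] del: of_real_sum of_real_power)
  then have ug: "(\<integral>x. Re (cnj (?u x) * g x) \<partial>\<mu>) = (\<Sum>n<N. (cmod (c n))\<^sup>2)"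
    using int_ug by (simp only: integral_Re)
  have "0 \<le> (\<integral>x. (cmod (g x - ?u x))\<^sup>2 \<partial>\<mu>)" by (rule Bochner_Integration.integral_nonneg) simp
  also have "\<dots> = (\<integral>x. (cmod (g x))\<^sup>2 \<partial>\<mu>) + (\<integral>x. (cmod (?u x))\<^sup>2 \<partial>\<mu>) - 2 * (\<integral>x. Re (cnj (?u x) * g x) \<partial>\<mu>)"
    unfolding eq using square_integrable_integrable[OF g] square_integrable_integrable[OF u]
      integrable_Re[OF int_ug]
    by (simp only: Bochner_Integration.integral_diff Bochner_Integration.integral_add Bochner_Integration.integrable_add
        integrable_mult_right integral_mult_right_zero)
  also have "\<dots> = (\<integral>x. (cmod (g x))\<^sup>2 \<partial>\<mu>) - (\<Sum>n<N. (cmod (c n))\<^sup>2)"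
    unfolding ug norm_opoly_comb[of c, OF c0] by simp
  finally show ?thesis by (simp add: c_def)
qed

text \<open>The matrix of multiplication by \<open>f\<close> in the orthonormal polynomials.\<close>

definition fmat :: "(real \<Rightarrow> complex) \<Rightarrow> nat \<Rightarrow> nat \<Rightarrow> complex" where
  "fmat f m n = (\<integral>x. of_real (opoly V m x) * (f x * of_real (opoly V n x)) \<partial>\<mu>)"

definition funcalc :: "(real \<Rightarrow> complex) \<Rightarrow> cseq \<Rightarrow> cseq" where
  "funcalc f \<psi> m = (\<Sum>n. fmat f m n * \<psi> n)"

lemma integrable_fmat:
  assumes "f \<in> bounded_borel"
  shows "integrable \<mu> (\<lambda>x. of_real (opoly V m x) * (f x * of_real (opoly V n x)))"
  by (intro integrable_mult_square_integrable square_integrable_bounded_mult square_integrable_opoly assms)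

lemma fmat_commute: "fmat f m n = fmat f n m"
  by (simp add: fmat_def mult_ac)

lemma fmat_0 [simp]: "fmat f 0 n = 0" "fmat f m 0 = 0"
  by (simp_all add: fmat_def)

lemma fmat_one: "fmat (\<lambda>_. 1) m n = of_bool (m = n \<and> m \<noteq> 0)"
  by (simp add: fmat_def integral_of_real_opoly_opoly)

lemma fmat_lincomb:
  assumes "f \<in> bounded_borel" "g \<in> bounded_borel"
  shows "fmat (\<lambda>x. a * f x + b * g x) m n = a * fmat f m n + b * fmat g m n"
proof -
  have "fmat (\<lambda>x. a * f x + b * g x) m n = (\<integral>x. a * (of_real (opoly V m x) * (f x * of_real (opoly V n x)))
     + b * (of_real (opoly V m x) * (g x * of_real (opoly V n x))) \<partial>\<mu>)"
    unfolding fmat_def by (rule Bochner_Integration.integral_cong) (auto simp: algebra_simps)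
  also have "\<dots> = a * fmat f m n + b * fmat g m n"
    unfolding fmat_def using integrable_fmat[OF assms(1)] integrable_fmat[OF assms(2)]
    by (subst Bochner_Integration.integral_add) auto
  finally show ?thesis .
qed

lemma fmat_cnj: "fmat (\<lambda>x. cnj (f x)) m n = cnj (fmat f m n)"
proof -
  have "fmat (\<lambda>x. cnj (f x)) m n = (\<integral>x. cnj (of_real (opoly V m x) * (f x * of_real (opoly V n x))) \<partial>\<mu>)"
    unfolding fmat_def by (rule Bochner_Integration.integral_cong) simp_all
  also have "\<dots> = cnj (fmat f m n)" unfolding fmat_def by (rule Bochner_Integration.integral_cnj)
  finally show ?thesis .
qed

text \<open>Since \<open>x p\<^sub>m = p\<^sub>m\<^sub>-\<^sub>1 + p\<^sub>m\<^sub>+\<^sub>1 + V(m) p\<^sub>m\<close>, applying the difference operator to a row or column of the matrix multiplies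
  the symbol \<open>f\<close> by \<open>x\<close>. The product is written as \<open>(x - z) f + z f\<close>, because the first term is 1 for the kernel \<open>f\<close> at \<open>z\<close>.\<close>

lemma fmat_recurrence:
  assumes f: "f \<in> bounded_borel" and g: "g \<in> bounded_borel" and eq: "\<And>x. g x = (of_real x - z) * f x"
    and m: "m \<ge> 1"
  shows "fmat f (m - 1) n + fmat f (m + 1) n + of_real (V m) * fmat f m n = fmat g m n + z * fmat f m n"
proof -
  let ?i = "\<lambda>m x. of_real (opoly V m x) * (f x * of_real (opoly V n x)) :: complex"
  have "fmat g m n + z * fmat f m n = fmat (\<lambda>x. 1 * g x + z * f x) m n"
    by (subst fmat_lincomb) (use f g in auto)
  also have "\<dots> = (\<integral>x. of_real (x * opoly V m x) * (f x * of_real (opoly V n x)) \<partial>\<mu>)"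
    unfolding fmat_def by (rule Bochner_Integration.integral_cong) (auto simp: eq algebra_simps)
  also have "\<dots> = (\<integral>x. (?i (m-1) x + ?i (m+1) x) + of_real (V m) * ?i m x \<partial>\<mu>)"
    by (rule Bochner_Integration.integral_cong) (simp_all add: opoly_recurrence[OF m] algebra_simps)
  also have "\<dots> = fmat f (m - 1) n + fmat f (m + 1) n + of_real (V m) * fmat f m n"
    unfolding fmat_def using integrable_fmat[OF f]
    by (simp only: Bochner_Integration.integral_add Bochner_Integration.integrable_add integrable_mult_right
        integral_mult_right_zero)
  finally show ?thesis by simp
qed

lemma fmat_row_ell2:
  assumes f: "f \<in> bounded_borel"
  shows "fmat f m \<in> ell2"
proof (rule ell2_l2_norm_leI(1))
  let ?B = "\<integral>x. (cmod (f x * of_real (opoly V m x)))\<^sup>2 \<partial>\<mu>"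
  have B: "?B \<ge> 0" by (rule Bochner_Integration.integral_nonneg) simp
  show "(\<Sum>n<N. (cmod (fmat f m n))\<^sup>2) \<le> (sqrt ?B)\<^sup>2" for N
    using bessel_opoly[OF square_integrable_bounded_mult[OF f square_integrable_opoly[of m]], of N] B
    unfolding fmat_commute[of f m] by (simp add: fmat_def)
  show "sqrt ?B \<ge> 0" using B by simp
qed simp

lemma funcalc_0 [simp]: "funcalc f \<psi> 0 = 0"
  by (simp add: funcalc_def)

lemma funcalc_summable: "f \<in> bounded_borel \<Longrightarrow> \<psi> \<in> ell2 \<Longrightarrow> summable (\<lambda>n. fmat f m n * \<psi> n)"
  by (intro ell2_mult_summable fmat_row_ell2)

lemma integral_opoly_mult_opoly_comb:
  assumes f: "f \<in> bounded_borel"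
  shows "(\<integral>x. of_real (opoly V m x) * (f x * opoly_comb a L x) \<partial>\<mu>) = (\<Sum>n<L. fmat f m n * a n)"
proof -
  have "(\<integral>x. of_real (opoly V m x) * (f x * opoly_comb a L x) \<partial>\<mu>) =
     (\<integral>x. (\<Sum>n<L. (of_real (opoly V m x) * (f x * of_real (opoly V n x))) * a n) \<partial>\<mu>)"
    by (simp add: opoly_comb_def sum_distrib_left mult_ac)
  also have "\<dots> = (\<Sum>n<L. fmat f m n * a n)"
    unfolding fmat_def using integrable_fmat[OF f] by (subst Bochner_Integration.integral_sum) auto
  finally show ?thesis .
qed

lemma sum_funcalc_cutoff_le:
  assumes f: "f \<in> bounded_borel"
  shows "(\<Sum>m<N. (cmod (\<Sum>n<L. fmat f m n * a n))\<^sup>2) \<le> (\<integral>x. (cmod (f x * opoly_comb a L x))\<^sup>2 \<partial>\<mu>)"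
  using bessel_opoly[OF square_integrable_bounded_mult[OF f square_integrable_opoly_comb[of a L]], of N]
  unfolding integral_opoly_mult_opoly_comb[OF f] .

lemma funcalc_cutoff: "funcalc f (cutoff L \<psi>) m = (\<Sum>n<L. fmat f m n * \<psi> n)"
  unfolding funcalc_def by (subst suminf_finite[of "{..<L}"]) (auto simp: cutoff_def)

lemma funcalc_cutoff_norm:
  assumes f: "f \<in> bounded_borel"
  shows "l2_norm (funcalc f (cutoff L \<psi>)) \<le> sqrt (\<integral>x. (cmod (f x * opoly_comb \<psi> L x))\<^sup>2 \<partial>\<mu>)"
proof (rule ell2_l2_norm_leI(2))
  have B: "(\<integral>x. (cmod (f x * opoly_comb \<psi> L x))\<^sup>2 \<partial>\<mu>) \<ge> 0"
    by (rule Bochner_Integration.integral_nonneg) simp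
  then show "(\<Sum>m<N. (cmod (funcalc f (cutoff L \<psi>) m))\<^sup>2) \<le> (sqrt (\<integral>x. (cmod (f x * opoly_comb \<psi> L x))\<^sup>2 \<partial>\<mu>))\<^sup>2" for N
    unfolding funcalc_cutoff using sum_funcalc_cutoff_le[OF f, where N = N and L = L and a = \<psi>] by simp
  show "sqrt (\<integral>x. (cmod (f x * opoly_comb \<psi> L x))\<^sup>2 \<partial>\<mu>) \<ge> 0" using B by simp
qed (simp add: funcalc_def)

lemma funcalc_bounded:
  assumes f: "f \<in> bounded_borel" and C: "\<And>x. cmod (f x) \<le> C" and \<psi>: "\<psi> \<in> ell2"
  shows "funcalc f \<psi> \<in> ell2" "l2_norm (funcalc f \<psi>) \<le> C * l2_norm \<psi>"
proof -
  have C0: "C \<ge> 0" using C[of 0] norm_ge_zero order_trans by blast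
  have fin: "(\<Sum>m<N. (cmod (\<Sum>n<L. fmat f m n * \<psi> n))\<^sup>2) \<le> (C * l2_norm \<psi>)\<^sup>2" for N L
  proof -
    have "(\<Sum>m<N. (cmod (\<Sum>n<L. fmat f m n * \<psi> n))\<^sup>2) \<le> (\<integral>x. (cmod (f x * opoly_comb \<psi> L x))\<^sup>2 \<partial>\<mu>)"
      by (rule sum_funcalc_cutoff_le[OF f])
    also have "\<dots> \<le> (\<integral>x. C\<^sup>2 * (cmod (opoly_comb \<psi> L x))\<^sup>2 \<partial>\<mu>)"
    proof (rule integral_mono)
      show "integrable \<mu> (\<lambda>x. (cmod (f x * opoly_comb \<psi> L x))\<^sup>2)"
        by (intro square_integrable_integrable square_integrable_bounded_mult f square_integrable_opoly_comb)
      show "integrable \<mu> (\<lambda>x. C\<^sup>2 * (cmod (opoly_comb \<psi> L x))\<^sup>2)"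
        by (intro integrable_mult_right square_integrable_integrable square_integrable_opoly_comb)
      show "(cmod (f x * opoly_comb \<psi> L x))\<^sup>2 \<le> C\<^sup>2 * (cmod (opoly_comb \<psi> L x))\<^sup>2" for x
        using C by (auto simp: norm_mult power_mult_distrib intro!: mult_right_mono power_mono)
    qed
    also have "\<dots> = C\<^sup>2 * (\<Sum>n<L. (cmod (\<psi> n))\<^sup>2)"
      by (simp add: norm_opoly_comb ell2_zero_at_0[OF \<psi>])
    also have "\<dots> \<le> C\<^sup>2 * (l2_norm \<psi>)\<^sup>2" by (intro mult_left_mono sum_le_l2_norm_sq \<psi>) auto
    finally show ?thesis by (simp add: power_mult_distrib)
  qed
  have le: "(\<Sum>m<N. (cmod (funcalc f \<psi> m))\<^sup>2) \<le> (C * l2_norm \<psi>)\<^sup>2" for N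
  proof (rule LIMSEQ_le_const2)
    show "(\<lambda>L. \<Sum>m<N. (cmod (\<Sum>n<L. fmat f m n * \<psi> n))\<^sup>2) \<longlonglongrightarrow> (\<Sum>m<N. (cmod (funcalc f \<psi> m))\<^sup>2)"
      unfolding funcalc_def by (intro tendsto_intros summable_LIMSEQ funcalc_summable f \<psi>)
  qed (use fin in auto)
  have "C * l2_norm \<psi> \<ge> 0" using C0 \<psi> by simp
  then show "funcalc f \<psi> \<in> ell2" "l2_norm (funcalc f \<psi>) \<le> C * l2_norm \<psi>"
    using ell2_l2_norm_leI[OF le] by auto
qed

lemma funcalc_ell2: "f \<in> bounded_borel \<Longrightarrow> \<psi> \<in> ell2 \<Longrightarrow> funcalc f \<psi> \<in> ell2"
  by (metis bounded_borelE funcalc_bounded(1))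

lemma funcalc_lincomb_right:
  assumes "f \<in> bounded_borel" "\<phi> \<in> ell2" "\<psi> \<in> ell2"
  shows "funcalc f (\<lambda>n. a * \<phi> n + b * \<psi> n) = (\<lambda>n. a * funcalc f \<phi> n + b * funcalc f \<psi> n)"
proof
  fix m
  have "funcalc f (\<lambda>n. a * \<phi> n + b * \<psi> n) m = (\<Sum>n. a * (fmat f m n * \<phi> n) + b * (fmat f m n * \<psi> n))"
    unfolding funcalc_def by (simp add: algebra_simps)
  also have "\<dots> = a * funcalc f \<phi> m + b * funcalc f \<psi> m"
    unfolding funcalc_def using funcalc_summable[OF assms(1,2), of m] funcalc_summable[OF assms(1,3), of m]
    by (simp add: suminf_add[symmetric] suminf_mult summable_mult)
  finally show "funcalc f (\<lambda>n. a * \<phi> n + b * \<psi> n) m = a * funcalc f \<phi> m + b * funcalc f \<psi> m" .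
qed

lemma funcalc_diff_right:
  "f \<in> bounded_borel \<Longrightarrow> \<phi> \<in> ell2 \<Longrightarrow> \<psi> \<in> ell2 \<Longrightarrow>
    funcalc f (\<lambda>n. \<phi> n - \<psi> n) = (\<lambda>n. funcalc f \<phi> n - funcalc f \<psi> n)"
  using funcalc_lincomb_right[of f \<phi> \<psi> 1 "-1"] by simp

lemma funcalc_lincomb_left:
  assumes "f \<in> bounded_borel" "g \<in> bounded_borel" "\<psi> \<in> ell2"
  shows "funcalc (\<lambda>x. a * f x + b * g x) \<psi> = (\<lambda>n. a * funcalc f \<psi> n + b * funcalc g \<psi> n)"
proof
  fix m
  have "funcalc (\<lambda>x. a * f x + b * g x) \<psi> m = (\<Sum>n. a * (fmat f m n * \<psi> n) + b * (fmat g m n * \<psi> n))"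
    unfolding funcalc_def fmat_lincomb[OF assms(1,2)] by (simp add: algebra_simps)
  also have "\<dots> = a * funcalc f \<psi> m + b * funcalc g \<psi> m"
    unfolding funcalc_def using funcalc_summable[OF assms(1,3), of m] funcalc_summable[OF assms(2,3), of m]
    by (simp add: suminf_add[symmetric] suminf_mult summable_mult)
  finally show "funcalc (\<lambda>x. a * f x + b * g x) \<psi> m = a * funcalc f \<psi> m + b * funcalc g \<psi> m" .
qed

lemma funcalc_diff_left:
  "f \<in> bounded_borel \<Longrightarrow> g \<in> bounded_borel \<Longrightarrow> \<psi> \<in> ell2 \<Longrightarrow>
    funcalc (\<lambda>x. f x - g x) \<psi> = (\<lambda>n. funcalc f \<psi> n - funcalc g \<psi> n)"
  using funcalc_lincomb_left[of f g \<psi> 1 "-1"] by simp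

lemma funcalc_one:
  assumes "\<psi> \<in> ell2" shows "funcalc (\<lambda>_. 1) \<psi> = \<psi>"
proof
  fix m
  show "funcalc (\<lambda>_. 1) \<psi> m = \<psi> m"
  proof (cases "m = 0")
    case False
    then show ?thesis unfolding funcalc_def fmat_one by (subst suminf_finite[of "{m}"]) auto
  qed (simp add: ell2_zero_at_0[OF assms])
qed

text \<open>On a finite sequence this is dominated convergence for \<open>\<bar>h\<^sub>k - f\<bar>\<^sup>2 \<bar>u\<bar>\<^sup>2\<close> with the polynomial \<open>u\<close> that represents the sequence.
  The operators are uniformly bounded, so the tail of \<open>\<psi>\<close> is negligible.\<close>

lemma funcalc_dominated_convergence:
  assumes h: "\<And>k. h k \<in> bounded_borel" and f: "f \<in> bounded_borel"
    and lim: "\<And>x. (\<lambda>k. h k x) \<longlonglongrightarrow> f x" and C: "\<And>k x. cmod (h k x) \<le> C" and \<psi>: "\<psi> \<in> ell2"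
  shows "l2_tendsto (\<lambda>k. funcalc (h k) \<psi>) (funcalc f \<psi>)"
  unfolding l2_tendsto_def
proof (rule LIMSEQ_I)
  fix e :: real assume e: "e > 0"
  have C0: "C \<ge> 0" using C[of 0 0] norm_ge_zero order_trans by blast
  have Cf: "cmod (f x) \<le> C" for x by (rule LIMSEQ_le_const2[OF tendsto_norm[OF lim[of x]]]) (use C in auto)
  define g where "g k x = h k x - f x" for k x
  have g: "g k \<in> bounded_borel" for k unfolding g_def by (intro bounded_borel_diff h f)
  have g_le: "cmod (g k x) \<le> 2 * C" for k x
    unfolding g_def using norm_triangle_ineq4[of "h k x" "f x"] C[of k x] Cf[of x] by linarith
  have "e / (4 * C + 1) > 0" using e C0 by simp
  from LIMSEQ_D[OF cutoff_tendsto[OF \<psi>] this] obtain L where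
    "norm (l2_norm (\<lambda>n. \<psi> n - cutoff L \<psi> n) - 0) < e / (4 * C + 1)" by blast
  then have L: "(4 * C + 1) * norm (l2_norm (\<lambda>n. \<psi> n - cutoff L \<psi> n) - 0) < e"
    using C0 by (simp add: pos_less_divide_eq mult.commute)
  have L0: "l2_norm (\<lambda>n. \<psi> n - cutoff L \<psi> n) \<ge> 0" using \<psi> by (intro l2_norm_nonneg) auto
  then have L: "(4 * C + 1) * l2_norm (\<lambda>n. \<psi> n - cutoff L \<psi> n) < e"
    using L by simp
  let ?u = "opoly_comb \<psi> L"
  have [measurable]: "?u \<in> borel_measurable borel" "h k \<in> borel_measurable borel" "f \<in> borel_measurable borel" for k
    using square_integrable_opoly_comb h f by (auto simp: square_integrable_measurable bounded_borel_measurable)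
  have "(\<lambda>k. \<integral>x. (cmod (g k x * ?u x))\<^sup>2 \<partial>\<mu>) \<longlonglongrightarrow> (\<integral>x. 0 \<partial>\<mu>)"
  proof (rule integral_dominated_convergence[where w = "\<lambda>x. (2 * C)\<^sup>2 * (cmod (?u x))\<^sup>2"])
    show "integrable \<mu> (\<lambda>x. (2 * C)\<^sup>2 * (cmod (?u x))\<^sup>2)"
      by (intro integrable_mult_right square_integrable_integrable square_integrable_opoly_comb)
    show "(\<lambda>x. (cmod (g k x * ?u x))\<^sup>2) \<in> borel_measurable \<mu>" for k unfolding g_def by measurable
    have "(\<lambda>k. (cmod (g k x * ?u x))\<^sup>2) \<longlonglongrightarrow> (cmod ((f x - f x) * ?u x))\<^sup>2" for x
      unfolding g_def by (intro tendsto_intros lim)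
    then show "AE x in \<mu>. (\<lambda>k. (cmod (g k x * ?u x))\<^sup>2) \<longlonglongrightarrow> 0" by simp
    have "(cmod (g k x * ?u x))\<^sup>2 \<le> (2 * C)\<^sup>2 * (cmod (?u x))\<^sup>2" for k x
      unfolding norm_mult power_mult_distrib[of "cmod _"] by (intro mult_right_mono power_mono g_le) auto
    then show "AE x in \<mu>. norm ((cmod (g k x * ?u x))\<^sup>2) \<le> (2 * C)\<^sup>2 * (cmod (?u x))\<^sup>2" for k
      by simp
  qed simp
  then have "(\<lambda>k. sqrt (\<integral>x. (cmod (g k x * ?u x))\<^sup>2 \<partial>\<mu>)) \<longlonglongrightarrow> sqrt 0" by (intro tendsto_real_sqrt) simp
  from LIMSEQ_D[OF this, of "e / 2"] e obtain K
    where "\<forall>k\<ge>K. norm (sqrt (\<integral>x. (cmod (g k x * ?u x))\<^sup>2 \<partial>\<mu>) - sqrt 0) < e / 2" by auto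
  then have K: "sqrt (\<integral>x. (cmod (g k x * ?u x))\<^sup>2 \<partial>\<mu>) < e / 2" if "k \<ge> K" for k
    using that by fastforce
  have "norm (l2_norm (\<lambda>n. funcalc (h k) \<psi> n - funcalc f \<psi> n) - 0) < e" if k: "k \<ge> K" for k
  proof -
    have \<psi>': "(\<lambda>n. \<psi> n - cutoff L \<psi> n) \<in> ell2" "cutoff L \<psi> \<in> ell2" using \<psi> by auto
    have "(\<lambda>n. funcalc (h k) \<psi> n - funcalc f \<psi> n) = funcalc (g k) \<psi>"
      unfolding g_def funcalc_diff_left[OF h f \<psi>] ..
    also have "\<dots> = (\<lambda>n. funcalc (g k) (cutoff L \<psi>) n + funcalc (g k) (\<lambda>n. \<psi> n - cutoff L \<psi> n) n)"
      unfolding funcalc_diff_right[OF g \<psi> \<psi>'(2)] by simp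
    finally have "l2_norm (\<lambda>n. funcalc (h k) \<psi> n - funcalc f \<psi> n) \<le>
        l2_norm (funcalc (g k) (cutoff L \<psi>)) + l2_norm (funcalc (g k) (\<lambda>n. \<psi> n - cutoff L \<psi> n))"
      using l2_norm_triangle[OF funcalc_ell2[OF g \<psi>'(2)] funcalc_ell2[OF g \<psi>'(1)], of k k] by simp
    also have "\<dots> \<le> sqrt (\<integral>x. (cmod (g k x * ?u x))\<^sup>2 \<partial>\<mu>) + 2 * C * l2_norm (\<lambda>n. \<psi> n - cutoff L \<psi> n)"
      by (intro add_mono funcalc_cutoff_norm funcalc_bounded(2) g g_le \<psi>')
    also have "\<dots> < e" using K[OF k] L L0 by (simp add: algebra_simps)
    finally show ?thesis using l2_norm_nonneg[OF ell2_diff[OF funcalc_ell2[OF h[of k] \<psi>] funcalc_ell2[OF f \<psi>]]] by simp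
  qed
  then show "\<exists>no. \<forall>k\<ge>no. norm (l2_norm (\<lambda>n. funcalc (h k) \<psi> n - funcalc f \<psi> n) - 0) < e" by blast
qed

text \<open>For a finite sequence \<open>\<phi>\<close> the double sum can be interchanged; both sides are continuous in \<open>\<phi>\<close>.\<close>

lemma funcalc_adjoint:
  assumes f: "f \<in> bounded_borel" and \<phi>: "\<phi> \<in> ell2" and \<psi>: "\<psi> \<in> ell2"
  shows "l2_inner \<phi> (funcalc (\<lambda>x. cnj (f x)) \<psi>) = l2_inner (funcalc f \<phi>) \<psi>"
proof -
  let ?g = "\<lambda>x. cnj (f x)"
  have g: "?g \<in> bounded_borel" using f by auto
  obtain C where C: "\<And>x. cmod (f x) \<le> C" using f by (metis bounded_borelE)
  have cut: "l2_inner (cutoff L \<phi>) (funcalc ?g \<psi>) = l2_inner (funcalc f (cutoff L \<phi>)) \<psi>" for L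
  proof -
    have "l2_inner (cutoff L \<phi>) (funcalc ?g \<psi>) = (\<Sum>n<L. cnj (\<phi> n) * funcalc ?g \<psi> n)"
      unfolding l2_inner_def by (subst suminf_finite[of "{..<L}"]) (auto simp: cutoff_def)
    also have "\<dots> = (\<Sum>n<L. (\<Sum>m. cnj (\<phi> n) * (fmat ?g n m * \<psi> m)))"
      unfolding funcalc_def using funcalc_summable[OF g \<psi>] by (simp add: suminf_mult)
    also have "\<dots> = (\<Sum>m. \<Sum>n<L. cnj (\<phi> n) * (fmat ?g n m * \<psi> m))"
      using funcalc_summable[OF g \<psi>] by (intro suminf_sum[symmetric] summable_mult)
    also have "\<dots> = l2_inner (funcalc f (cutoff L \<phi>)) \<psi>"
      unfolding l2_inner_def funcalc_cutoff
      by (simp add: sum_distrib_left sum_distrib_right fmat_cnj fmat_commute[of f] mult_ac)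
    finally show ?thesis .
  qed
  have "(\<lambda>L. l2_inner \<phi> (funcalc ?g \<psi>) - l2_inner (cutoff L \<phi>) (funcalc ?g \<psi>)) \<longlonglongrightarrow> 0"
  proof (rule Lim_null_comparison[OF always_eventually])
    show "\<forall>L. norm (l2_inner \<phi> (funcalc ?g \<psi>) - l2_inner (cutoff L \<phi>) (funcalc ?g \<psi>)) \<le>
        l2_norm (\<lambda>n. \<phi> n - cutoff L \<phi> n) * l2_norm (funcalc ?g \<psi>)"
      using \<phi> funcalc_ell2[OF g \<psi>] l2_inner_diff_left[of \<phi> "cutoff _ \<phi>"] cauchy_schwarz_l2_inner[of "\<lambda>n. \<phi> n - cutoff _ \<phi> n"]
      by (metis ell2_cutoff ell2_diff)
    show "(\<lambda>L. l2_norm (\<lambda>n. \<phi> n - cutoff L \<phi> n) * l2_norm (funcalc ?g \<psi>)) \<longlonglongrightarrow> 0"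
      using tendsto_mult_left_zero[OF cutoff_tendsto[OF \<phi>]] .
  qed
  moreover have "(\<lambda>L. l2_inner (funcalc f \<phi>) \<psi> - l2_inner (funcalc f (cutoff L \<phi>)) \<psi>) \<longlonglongrightarrow> 0"
  proof (rule Lim_null_comparison[OF always_eventually])
    show "\<forall>L. norm (l2_inner (funcalc f \<phi>) \<psi> - l2_inner (funcalc f (cutoff L \<phi>)) \<psi>) \<le>
        C * l2_norm (\<lambda>n. \<phi> n - cutoff L \<phi> n) * l2_norm \<psi>"
    proof
      fix L
      have "l2_inner (funcalc f \<phi>) \<psi> - l2_inner (funcalc f (cutoff L \<phi>)) \<psi> = l2_inner (funcalc f (\<lambda>n. \<phi> n - cutoff L \<phi> n)) \<psi>"
        by (subst funcalc_diff_right) (use f \<phi> \<psi> in \<open>auto simp: l2_inner_diff_left funcalc_ell2 ell2_cutoff\<close>)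
      also have "norm \<dots> \<le> l2_norm (funcalc f (\<lambda>n. \<phi> n - cutoff L \<phi> n)) * l2_norm \<psi>"
        using f \<phi> \<psi> by (intro cauchy_schwarz_l2_inner funcalc_ell2) auto
      also have "\<dots> \<le> C * l2_norm (\<lambda>n. \<phi> n - cutoff L \<phi> n) * l2_norm \<psi>"
        using f \<phi> \<psi> C by (intro mult_right_mono funcalc_bounded(2)) auto
      finally show "norm (l2_inner (funcalc f \<phi>) \<psi> - l2_inner (funcalc f (cutoff L \<phi>)) \<psi>) \<le>
        C * l2_norm (\<lambda>n. \<phi> n - cutoff L \<phi> n) * l2_norm \<psi>" .
    qed
    show "(\<lambda>L. C * l2_norm (\<lambda>n. \<phi> n - cutoff L \<phi> n) * l2_norm \<psi>) \<longlonglongrightarrow> 0"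
      by (intro tendsto_mult_left_zero tendsto_mult_right_zero cutoff_tendsto \<phi>)
  qed
  ultimately have "(\<lambda>L. (l2_inner \<phi> (funcalc ?g \<psi>) - l2_inner (cutoff L \<phi>) (funcalc ?g \<psi>)) -
     (l2_inner (funcalc f \<phi>) \<psi> - l2_inner (funcalc f (cutoff L \<phi>)) \<psi>)) \<longlonglongrightarrow> 0 - 0"
    by (rule tendsto_diff)
  then have "(\<lambda>L. l2_inner \<phi> (funcalc ?g \<psi>) - l2_inner (funcalc f \<phi>) \<psi>) \<longlonglongrightarrow> 0" by (simp add: cut)
  then show ?thesis by (simp add: LIMSEQ_const_iff)
qed

end

section \<open>Self-adjointness and the spectral measure\<close>

lemma schrodinger_formula_eq:
  assumes "\<psi> 0 = 0"
  shows "schrodinger_formula V \<psi> n = (if n = 0 then 0 else \<psi> (n - 1) + \<psi> (n + 1) + of_real (V n) * \<psi> n)"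
  using assms by (auto simp: schrodinger_formula_def numeral_2_eq_2)

lemma op_dom_schrodinger: "op_dom (schrodinger V) = {\<psi> \<in> ell2. schrodinger_formula V \<psi> \<in> ell2}"
  and op_app_schrodinger: "op_app (schrodinger V) = schrodinger_formula V"
  by (simp_all add: schrodinger_def)

lemma ell2_tendsto_0:
  assumes "\<psi> \<in> ell2" shows "\<psi> \<longlonglongrightarrow> 0"
proof -
  have "(\<lambda>n. sqrt ((cmod (\<psi> n))\<^sup>2)) \<longlonglongrightarrow> sqrt 0"
    by (intro tendsto_real_sqrt summable_LIMSEQ_zero ell2_summable assms)
  then show ?thesis by (simp add: tendsto_norm_zero_iff)
qed

text \<open>Summation by parts leaves the Wronskian \<open>\<phi>(n+1) \<psi>(n) - \<phi>(n) \<psi>(n+1)\<close> as boundary term. Because the off-diagonal coefficients are 1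
  it tends to 0 for square summable sequences, and this is why the maximal operator is self-adjoint.\<close>

lemma green_identity:
  assumes ell2: "\<phi> \<in> ell2" "\<psi> \<in> ell2" "\<alpha> \<in> ell2" "\<beta> \<in> ell2"
    and \<phi>: "\<And>n. n \<ge> 1 \<Longrightarrow> \<phi> (n - 1) + \<phi> (n + 1) + of_real (V n) * \<phi> n = \<alpha> n + z * \<phi> n"
    and \<psi>: "\<And>n. n \<ge> 1 \<Longrightarrow> \<psi> (n - 1) + \<psi> (n + 1) + of_real (V n) * \<psi> n = \<beta> n + z * \<psi> n"
  shows "(\<Sum>n. \<alpha> n * \<psi> n) = (\<Sum>n. \<phi> n * \<beta> n)"
proof -
  define w where "w n = \<phi> (n + 1) * \<psi> n - \<phi> n * \<psi> (n + 1)" for n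
  have partial: "(\<Sum>n<Suc N. \<alpha> n * \<psi> n - \<phi> n * \<beta> n) = w N" for N
  proof (induction N)
    case 0
    then show ?case using ell2 by (simp add: w_def ell2_zero_at_0)
  next
    case (Suc N)
    have h: "\<alpha> (Suc N) = \<phi> N + \<phi> (N + 2) + (of_real (V (Suc N)) - z) * \<phi> (Suc N)"
      "\<beta> (Suc N) = \<psi> N + \<psi> (N + 2) + (of_real (V (Suc N)) - z) * \<psi> (Suc N)"
      using \<phi>[of "Suc N"] \<psi>[of "Suc N"] by (simp_all add: algebra_simps)
    show ?case unfolding sum.lessThan_Suc[of _ "Suc N"] Suc.IH w_def h by (simp add: algebra_simps)
  qed
  have "w \<longlonglongrightarrow> 0 * 0 - 0 * 0"
    unfolding w_def[abs_def] using ell2_tendsto_0[OF ell2(1)] ell2_tendsto_0[OF ell2(2)]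
      LIMSEQ_ignore_initial_segment[OF ell2_tendsto_0[OF ell2(1)], of 1] LIMSEQ_ignore_initial_segment[OF ell2_tendsto_0[OF ell2(2)], of 1]
    by (intro tendsto_intros)
  then have "(\<lambda>N. \<Sum>n<Suc N. \<alpha> n * \<psi> n - \<phi> n * \<beta> n) \<longlonglongrightarrow> 0" unfolding partial by simp
  moreover have "(\<lambda>N. \<Sum>n<Suc N. \<alpha> n * \<psi> n - \<phi> n * \<beta> n) \<longlonglongrightarrow> (\<Sum>n. \<alpha> n * \<psi> n) - (\<Sum>n. \<phi> n * \<beta> n)"
    unfolding suminf_diff[OF ell2_mult_summable[OF ell2(3,2)] ell2_mult_summable[OF ell2(1,4)]]
    by (intro LIMSEQ_Suc summable_LIMSEQ summable_diff ell2_mult_summable ell2)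
  ultimately show ?thesis using LIMSEQ_unique by fastforce
qed

lemma delta1_ell2: "delta1 \<in> ell2"
  by (rule ell2_finite[of "{1}"]) (auto simp: delta1_def)

lemma l2_inner_delta1: "l2_inner delta1 \<psi> = \<psi> 1"
  unfolding l2_inner_def by (subst suminf_finite[of "{1}"]) (auto simp: delta1_def)

lemma integral_indicator_complex:
  assumes "S \<in> sets M" shows "(\<integral>x. indicator S x \<partial>M) = complex_of_real (measure M S)"
proof -
  have "(\<integral>x. indicator S x \<partial>M) = (\<integral>x. complex_of_real (indicator S x) \<partial>M)"
    by (rule Bochner_Integration.integral_cong) (auto simp: indicator_def)
  then show ?thesis using assms by (simp add: sets.Int_space_eq2)
qed

context orthonormality_measure
begin

text \<open>With \<open>g = (x - z) f\<close> this is \<open>H f(H) = g(H) + z f(H)\<close>: the difference operator acts on the row index of the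
  matrix.\<close>

lemma schrodinger_formula_funcalc:
  assumes f: "f \<in> bounded_borel" and g: "g \<in> bounded_borel" and eq: "\<And>x. g x = (of_real x - z) * f x"
    and \<phi>: "\<phi> \<in> ell2"
  shows "schrodinger_formula V (funcalc f \<phi>) = (\<lambda>n. funcalc g \<phi> n + z * funcalc f \<phi> n)"
proof
  fix m
  show "schrodinger_formula V (funcalc f \<phi>) m = funcalc g \<phi> m + z * funcalc f \<phi> m"
  proof (cases "m = 0")
    case True
    then show ?thesis by (simp add: schrodinger_formula_def funcalc_def)
  next
    case False
    note s = funcalc_summable[OF f \<phi>]
    have "schrodinger_formula V (funcalc f \<phi>) m = (\<Sum>n. fmat f (m-1) n * \<phi> n) + (\<Sum>n. fmat f (m+1) n * \<phi> n)
        + of_real (V m) * (\<Sum>n. fmat f m n * \<phi> n)"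
      using False by (subst schrodinger_formula_eq) (auto simp: funcalc_def)
    also have "\<dots> = (\<Sum>n. fmat f (m-1) n * \<phi> n + fmat f (m+1) n * \<phi> n + of_real (V m) * (fmat f m n * \<phi> n))"
      using s by (simp add: suminf_add[symmetric] suminf_mult summable_add summable_mult)
    also have "\<dots> = (\<Sum>n. (fmat f (m-1) n + fmat f (m+1) n + of_real (V m) * fmat f m n) * \<phi> n)"
      by (simp add: algebra_simps)
    also have "\<dots> = (\<Sum>n. fmat g m n * \<phi> n + z * (fmat f m n * \<phi> n))"
      using False by (subst fmat_recurrence[OF f g eq]) (auto simp: algebra_simps)
    also have "\<dots> = funcalc g \<phi> m + z * funcalc f \<phi> m"
      unfolding funcalc_def using s funcalc_summable[OF g \<phi>]
      by (simp add: suminf_add[symmetric] suminf_mult summable_mult)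
    finally show ?thesis .
  qed
qed

lemma funcalc_in_domain:
  assumes f: "f \<in> bounded_borel" and g: "g \<in> bounded_borel" and eq: "\<And>x. g x = (of_real x - z) * f x"
    and \<phi>: "\<phi> \<in> ell2"
  shows "funcalc f \<phi> \<in> op_dom (schrodinger V)"
  unfolding op_dom_schrodinger using schrodinger_formula_funcalc[OF assms] f g \<phi> by (auto intro!: funcalc_ell2)

text \<open>The same product in the other order, \<open>f(H) (H - z) = g(H)\<close> on the domain. Here the difference operator is to be moved from \<open>\<psi>\<close> to the
  column index of the matrix, which is the Green identity.\<close>

lemma funcalc_schrodinger_formula:
  assumes f: "f \<in> bounded_borel" and g: "g \<in> bounded_borel" and eq: "\<And>x. g x = (of_real x - z) * f x"
    and \<psi>: "\<psi> \<in> op_dom (schrodinger V)"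
  shows "funcalc f (\<lambda>n. schrodinger_formula V \<psi> n - z * \<psi> n) = funcalc g \<psi>"
proof
  fix m
  let ?\<beta> = "\<lambda>n. schrodinger_formula V \<psi> n - z * \<psi> n"
  have \<psi>': "\<psi> \<in> ell2" "schrodinger_formula V \<psi> \<in> ell2" using \<psi> by (auto simp: op_dom_schrodinger)
  have "(\<Sum>n. fmat g m n * \<psi> n) = (\<Sum>n. fmat f m n * ?\<beta> n)"
  proof (rule green_identity[where V = V and z = z])
    show "?\<beta> \<in> ell2" using \<psi>' by (intro ell2_diff ell2_cmult)
    show "fmat f m (n - 1) + fmat f m (n + 1) + of_real (V n) * fmat f m n = fmat g m n + z * fmat f m n" if "n \<ge> 1" for n
      using fmat_recurrence[OF f g eq that, of m] by (simp add: fmat_commute[of _ m])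
    show "\<psi> (n - 1) + \<psi> (n + 1) + of_real (V n) * \<psi> n = ?\<beta> n + z * \<psi> n" if "n \<ge> 1" for n
      using that \<psi>' by (simp add: schrodinger_formula_eq ell2_zero_at_0)
  qed (intro fmat_row_ell2 f g \<psi>')+
  then show "funcalc f ?\<beta> m = funcalc g \<psi> m" by (simp add: funcalc_def)
qed

lemma funcalc_cauchy_kernel:
  assumes z: "Im z \<noteq> 0" and \<phi>: "\<phi> \<in> ell2"
  shows "funcalc (cauchy_kernel z) \<phi> \<in> op_dom (schrodinger V)"
    and "(\<lambda>n. schrodinger_formula V (funcalc (cauchy_kernel z) \<phi>) n - z * funcalc (cauchy_kernel z) \<phi> n) = \<phi>"
proof -
  have eq: "1 = (of_real x - z) * cauchy_kernel z x" for x
    using of_real_neq_nonreal[OF z] by (simp add: cauchy_kernel_def)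
  show "funcalc (cauchy_kernel z) \<phi> \<in> op_dom (schrodinger V)"
    by (rule funcalc_in_domain[OF bounded_borel_cauchy_kernel[OF z] bounded_borel_const eq \<phi>])
  show "(\<lambda>n. schrodinger_formula V (funcalc (cauchy_kernel z) \<phi>) n - z * funcalc (cauchy_kernel z) \<phi> n) = \<phi>"
    using schrodinger_formula_funcalc[OF bounded_borel_cauchy_kernel[OF z] bounded_borel_const eq \<phi>]
    by (simp add: funcalc_one[OF \<phi>])
qed

lemma funcalc_cauchy_kernel_left:
  assumes z: "Im z \<noteq> 0" and \<psi>: "\<psi> \<in> op_dom (schrodinger V)"
  shows "funcalc (cauchy_kernel z) (\<lambda>n. schrodinger_formula V \<psi> n - z * \<psi> n) = \<psi>"
proof -
  have eq: "1 = (of_real x - z) * cauchy_kernel z x" for x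
    using of_real_neq_nonreal[OF z] by (simp add: cauchy_kernel_def)
  show ?thesis
    using funcalc_schrodinger_formula[OF bounded_borel_cauchy_kernel[OF z] bounded_borel_const eq \<psi>] \<psi>
    by (simp add: funcalc_one op_dom_schrodinger)
qed

text \<open>The symbols \<open>g\<close> for which the rule holds against every \<open>f\<close> form a class as in the monotone class theorem. It contains the kernels: apply
  \<open>(f r)(H) (H - z) = f(H)\<close>, where \<open>r\<close> is the kernel at \<open>z\<close>, to the vector \<open>r(H) \<psi>\<close>.\<close>

lemma funcalc_mult:
  assumes "f \<in> bounded_borel" "g \<in> bounded_borel" "\<psi> \<in> ell2"
  shows "funcalc (\<lambda>x. f x * g x) \<psi> = funcalc f (funcalc g \<psi>)"
proof -
  define G where "G = {g \<in> bounded_borel. \<forall>f\<in>bounded_borel. \<forall>\<psi>\<in>ell2.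
     funcalc (\<lambda>x. f x * g x) \<psi> = funcalc f (funcalc g \<psi>)}"
  have "bounded_borel \<subseteq> G"
  proof (rule bounded_borel_monotone_class)
    fix g h a b assume gh: "g \<in> G" "h \<in> G"
    show "(\<lambda>x. a * g x + b * h x) \<in> G"
      unfolding G_def
    proof (intro CollectI conjI ballI)
      show "(\<lambda>x. a * g x + b * h x) \<in> bounded_borel" using gh by (auto simp: G_def)
      fix f \<psi> assume f: "f \<in> bounded_borel" and \<psi>: "\<psi> \<in> ell2"
      have gh': "g \<in> bounded_borel" "h \<in> bounded_borel"
        "funcalc (\<lambda>x. f x * g x) \<psi> = funcalc f (funcalc g \<psi>)" "funcalc (\<lambda>x. f x * h x) \<psi> = funcalc f (funcalc h \<psi>)"
        using gh f \<psi> by (auto simp: G_def)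
      have "funcalc (\<lambda>x. f x * (a * g x + b * h x)) \<psi> = funcalc (\<lambda>x. a * (f x * g x) + b * (f x * h x)) \<psi>"
        by (simp add: algebra_simps)
      also have "\<dots> = funcalc f (funcalc (\<lambda>x. a * g x + b * h x) \<psi>)"
        using gh' f \<psi> by (simp add: funcalc_lincomb_left funcalc_lincomb_right funcalc_ell2 bounded_borel_mult)
      finally show "funcalc (\<lambda>x. f x * (a * g x + b * h x)) \<psi> = funcalc f (funcalc (\<lambda>x. a * g x + b * h x) \<psi>)" .
    qed
  next
    fix g h assume gh: "g \<in> G" "h \<in> G"
    show "(\<lambda>x. g x * h x) \<in> G"
      unfolding G_def
    proof (intro CollectI conjI ballI)
      show "(\<lambda>x. g x * h x) \<in> bounded_borel" using gh by (auto simp: G_def)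
      fix f \<psi> assume f: "f \<in> bounded_borel" and \<psi>: "\<psi> \<in> ell2"
      have gb: "g \<in> bounded_borel" "h \<in> bounded_borel" using gh by (auto simp: G_def)
      have g: "funcalc (\<lambda>x. f x * g x) \<phi> = funcalc f (funcalc g \<phi>)" if "f \<in> bounded_borel" "\<phi> \<in> ell2" for f \<phi>
        using gh that by (auto simp: G_def)
      have h: "funcalc (\<lambda>x. f x * h x) \<phi> = funcalc f (funcalc h \<phi>)" if "f \<in> bounded_borel" "\<phi> \<in> ell2" for f \<phi>
        using gh that by (auto simp: G_def)
      have "funcalc (\<lambda>x. f x * (g x * h x)) \<psi> = funcalc (\<lambda>x. (f x * g x) * h x) \<psi>" by (simp add: mult.assoc)
      also have "\<dots> = funcalc f (funcalc g (funcalc h \<psi>))"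
        using gb f \<psi> by (subst h) (auto simp: g funcalc_ell2)
      also have "\<dots> = funcalc f (funcalc (\<lambda>x. g x * h x) \<psi>)"
        using gb f \<psi> by (simp add: h)
      finally show "funcalc (\<lambda>x. f x * (g x * h x)) \<psi> = funcalc f (funcalc (\<lambda>x. g x * h x) \<psi>)" .
    qed
  next
    show "(\<lambda>_. 1) \<in> G" by (auto simp: G_def funcalc_one)
  next
    fix h :: "nat \<Rightarrow> real \<Rightarrow> complex" and g C
    assume h: "\<And>k. h k \<in> G" and g: "g \<in> bounded_borel" and lim: "\<And>x. (\<lambda>k. h k x) \<longlonglongrightarrow> g x"
      and C: "\<And>k x. cmod (h k x) \<le> C"
    have hb: "h k \<in> bounded_borel" for k using h[of k] by (simp add: G_def)
    show "g \<in> G"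
      unfolding G_def
    proof (intro CollectI conjI ballI g)
      fix f \<psi> assume f: "f \<in> bounded_borel" and \<psi>: "\<psi> \<in> ell2"
      obtain D where D: "D \<ge> 0" "\<And>x. cmod (f x) \<le> D" using f by (metis bounded_borelE)
      have hm: "funcalc (\<lambda>x. f x * h k x) \<psi> = funcalc f (funcalc (h k) \<psi>)" for k
        using h[of k] f \<psi> by (simp add: G_def)
      have t1: "l2_tendsto (\<lambda>k. funcalc (\<lambda>x. f x * h k x) \<psi>) (funcalc (\<lambda>x. f x * g x) \<psi>)"
      proof (rule funcalc_dominated_convergence)
        show "(\<lambda>k. f x * h k x) \<longlonglongrightarrow> f x * g x" for x by (intro tendsto_intros lim)
        show "cmod (f x * h k x) \<le> D * C" for k x unfolding norm_mult using D C by (intro mult_mono) auto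
      qed (use f g hb \<psi> in auto)
      have t2: "l2_tendsto (\<lambda>k. funcalc f (funcalc (h k) \<psi>)) (funcalc f (funcalc g \<psi>))"
        by (rule l2_tendsto_bounded_operator[OF funcalc_dominated_convergence[OF hb g lim C \<psi>], where C = D])
          (use f D \<psi> g hb in \<open>auto intro: funcalc_bounded funcalc_ell2 funcalc_diff_right\<close>)
      show "funcalc (\<lambda>x. f x * g x) \<psi> = funcalc f (funcalc g \<psi>)"
        by (rule l2_tendsto_unique[OF t1[unfolded hm] t2]) (intro funcalc_ell2 bounded_borel_mult f g hb \<psi>)+
    qed
  next
    fix z :: complex assume z: "Im z \<noteq> 0"
    show "cauchy_kernel z \<in> G"
      unfolding G_def
    proof (intro CollectI conjI ballI)
      show "cauchy_kernel z \<in> bounded_borel" using z by auto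
      fix f \<psi> assume f: "f \<in> bounded_borel" and \<psi>: "\<psi> \<in> ell2"
      note R = funcalc_cauchy_kernel[OF z \<psi>]
      have eq: "f x = (of_real x - z) * (f x * cauchy_kernel z x)" for x
        using of_real_neq_nonreal[OF z] by (simp add: cauchy_kernel_def)
      show "funcalc (\<lambda>x. f x * cauchy_kernel z x) \<psi> = funcalc f (funcalc (cauchy_kernel z) \<psi>)"
        using funcalc_schrodinger_formula[OF _ f eq R(1)] f z unfolding R(2) by auto
    qed
  qed
  then show ?thesis using assms by (auto simp: G_def)
qed

lemma ident_cauchy_kernel: "Im z \<noteq> 0 \<Longrightarrow> of_real x * cauchy_kernel z x = 1 + z * cauchy_kernel z x"
  using of_real_neq_nonreal[of z x] by (simp add: cauchy_kernel_def field_simps)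

lemma ident_cauchy_kernel_bounded:
  assumes "Im z \<noteq> 0"
  shows "(\<lambda>x. of_real x * cauchy_kernel z x) \<in> bounded_borel"
  unfolding ident_cauchy_kernel[OF assms]
  by (intro bounded_borel_add bounded_borel_const bounded_borel_mult bounded_borel_cauchy_kernel assms)

text \<open>Recovering \<open>H\<close> from functions \<open>h\<^sub>k\<close> that tend to the identity needs the full domain: write \<open>\<psi> = r(H) \<eta>\<close> with the kernel \<open>r\<close> at
  \<open>\<i>\<close>; then \<open>h\<^sub>k r\<close> converges boundedly to \<open>x r = 1 + \<i> r\<close>.\<close>

theorem borel_functional_calculus_funcalc: "borel_functional_calculus (schrodinger V) funcalc"
  unfolding borel_functional_calculus_def
proof (intro conjI ballI allI impI)
  fix h \<psi> assume h: "(\<forall>k. h k \<in> bounded_borel) \<and> (\<forall>x. (\<lambda>k. h k x) \<longlonglongrightarrow> complex_of_real x) \<and> (\<forall>k x. cmod (h k x) \<le> \<bar>x\<bar>)"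
    and \<psi>: "\<psi> \<in> op_dom (schrodinger V)"
  let ?r = "cauchy_kernel \<i>"
  define \<eta> where "\<eta> n = schrodinger_formula V \<psi> n - \<i> * \<psi> n" for n
  have \<psi>': "\<psi> \<in> ell2" "schrodinger_formula V \<psi> \<in> ell2" using \<psi> by (auto simp: op_dom_schrodinger)
  have \<eta>: "\<eta> \<in> ell2" unfolding \<eta>_def[abs_def] using \<psi>' by (intro ell2_diff ell2_cmult)
  have r: "?r \<in> bounded_borel" by auto
  have \<psi>_eq: "funcalc ?r \<eta> = \<psi>" unfolding \<eta>_def[abs_def] by (rule funcalc_cauchy_kernel_left[OF _ \<psi>]) simp
  have xr: "(\<lambda>x. of_real x * ?r x) \<in> bounded_borel" by (rule ident_cauchy_kernel_bounded) simp
  then obtain C where C: "\<And>x. cmod (of_real x * ?r x) \<le> C" by (metis bounded_borelE)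
  have "l2_tendsto (\<lambda>k. funcalc (\<lambda>x. h k x * ?r x) \<eta>) (funcalc (\<lambda>x. of_real x * ?r x) \<eta>)"
  proof (rule funcalc_dominated_convergence)
    show "(\<lambda>k. h k x * ?r x) \<longlonglongrightarrow> of_real x * ?r x" for x using h by (intro tendsto_intros) auto
    show "cmod (h k x * ?r x) \<le> C" for k x
    proof -
      have "cmod (h k x * ?r x) \<le> cmod (of_real x * ?r x)"
        unfolding norm_mult using h by (intro mult_right_mono) auto
      then show ?thesis using C order_trans by blast
    qed
  qed (use h r \<eta> xr in auto)
  moreover have "funcalc (\<lambda>x. h k x * ?r x) \<eta> = funcalc (h k) \<psi>" for k
    using h r \<eta> by (simp add: funcalc_mult \<psi>_eq)
  moreover have "funcalc (\<lambda>x. of_real x * ?r x) \<eta> = schrodinger_formula V \<psi>"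
  proof -
    have "funcalc (\<lambda>x. of_real x * ?r x) \<eta> = funcalc (\<lambda>x. 1 * 1 + \<i> * ?r x) \<eta>"
      by (simp add: ident_cauchy_kernel)
    also have "\<dots> = (\<lambda>n. \<eta> n + \<i> * \<psi> n)"
      using funcalc_lincomb_left[OF bounded_borel_const[of 1] r \<eta>, of 1 \<i>] by (simp add: funcalc_one[OF \<eta>] \<psi>_eq)
    finally show ?thesis by (simp add: \<eta>_def)
  qed
  ultimately show "l2_tendsto (\<lambda>k. funcalc (h k) \<psi>) (op_app (schrodinger V) \<psi>)"
    by (simp add: op_app_schrodinger)
next
  fix h f C \<psi> assume h: "(\<forall>k. h k \<in> bounded_borel) \<and> f \<in> bounded_borel \<and> (\<forall>x. (\<lambda>k. h k x) \<longlonglongrightarrow> f x) \<and> (\<forall>k x. cmod (h k x) \<le> C)"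
    and \<psi>: "\<psi> \<in> ell2"
  then show "l2_tendsto (\<lambda>k. funcalc (h k) \<psi>) (funcalc f \<psi>)"
    by (intro funcalc_dominated_convergence[where C = C]) auto
qed (auto intro: funcalc_ell2 funcalc_lincomb_right funcalc_lincomb_left funcalc_mult funcalc_one funcalc_adjoint funcalc_bounded)

lemma funcalc_delta1: "funcalc f delta1 m = fmat f m 1"
  unfolding funcalc_def by (subst suminf_finite[of "{1}"]) (auto simp: delta1_def)

lemma l2_inner_funcalc_delta1: "l2_inner delta1 (funcalc f delta1) = (\<integral>x. f x \<partial>\<mu>)"
  by (simp add: l2_inner_delta1 funcalc_delta1 fmat_def)

lemma is_spectral_measure: "is_spectral_measure (schrodinger V) delta1 \<mu>"
  unfolding is_spectral_measure_def using borel_functional_calculus_funcalc l2_inner_funcalc_delta1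
  by (auto intro!: finite_measure_axioms)

text \<open>Any calculus \<open>\<Psi>\<close> sends the kernel at \<open>z\<close> to a left inverse of \<open>H - z\<close>: truncate the identity to \<open>h\<^sub>k\<close>
  and pass to the limit in \<open>\<Psi>(r) \<Psi>(h\<^sub>k) = \<Psi>(r h\<^sub>k)\<close>. As \<open>H - z\<close> is onto, this determines \<open>\<Psi>(r)\<close>, and the kernels determine the rest.\<close>

lemma borel_functional_calculus_unique:
  assumes "borel_functional_calculus (schrodinger V) \<Psi>" "f \<in> bounded_borel" "\<psi> \<in> ell2"
  shows "\<Psi> f \<psi> = funcalc f \<psi>"
proof -
  note c = assms(1)[unfolded borel_functional_calculus_def]
  have maps: "\<Psi> f \<psi> \<in> ell2" if "f \<in> bounded_borel" "\<psi> \<in> ell2" for f \<psi>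
    using conjunct1[OF c] that by blast
  have lin: "\<Psi> f (\<lambda>n. a * \<phi> n + b * \<psi> n) = (\<lambda>n. a * \<Psi> f \<phi> n + b * \<Psi> f \<psi> n)"
    if "f \<in> bounded_borel" "\<phi> \<in> ell2" "\<psi> \<in> ell2" for f \<phi> \<psi> a b
    using conjunct1[OF conjunct2[OF c]] that by blast
  have lin': "\<Psi> (\<lambda>x. a * f x + b * g x) \<psi> = (\<lambda>n. a * \<Psi> f \<psi> n + b * \<Psi> g \<psi> n)"
    if "f \<in> bounded_borel" "g \<in> bounded_borel" "\<psi> \<in> ell2" for f g \<psi> a b
    using conjunct1[OF conjunct2[OF conjunct2[OF c]]] that by blast
  have mult: "\<Psi> (\<lambda>x. f x * g x) \<psi> = \<Psi> f (\<Psi> g \<psi>)"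
    if "f \<in> bounded_borel" "g \<in> bounded_borel" "\<psi> \<in> ell2" for f g \<psi>
    using conjunct1[OF conjunct2[OF conjunct2[OF conjunct2[OF c]]]] that by blast
  note c5 = conjunct2[OF conjunct2[OF conjunct2[OF conjunct2[OF c]]]]
  have one: "\<Psi> (\<lambda>x. 1) \<psi> = \<psi>" if "\<psi> \<in> ell2" for \<psi>
    using conjunct1[OF c5] that by blast
  note c7 = conjunct2[OF conjunct2[OF c5]]
  have bound: "l2_norm (\<Psi> f \<psi>) \<le> C * l2_norm \<psi>" if "f \<in> bounded_borel" "\<And>x. cmod (f x) \<le> C" "\<psi> \<in> ell2" for f \<psi> C
    using conjunct1[OF c7] that by blast
  note c8 = conjunct2[OF c7]
  have ident: "l2_tendsto (\<lambda>k. \<Psi> (h k) \<psi>) (schrodinger_formula V \<psi>)"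
    if "\<And>k. h k \<in> bounded_borel" "\<And>x. (\<lambda>k. h k x) \<longlonglongrightarrow> of_real x" "\<And>k x. cmod (h k x) \<le> \<bar>x\<bar>"
      "\<psi> \<in> op_dom (schrodinger V)" for h :: "nat \<Rightarrow> real \<Rightarrow> complex" and \<psi>
    using conjunct1[OF c8] that unfolding op_app_schrodinger by blast
  have dom: "l2_tendsto (\<lambda>k. \<Psi> (h k) \<psi>) (\<Psi> f \<psi>)"
    if "\<And>k. h k \<in> bounded_borel" "f \<in> bounded_borel" "\<And>x. (\<lambda>k. h k x) \<longlonglongrightarrow> f x" "\<And>k x. cmod (h k x) \<le> C"
      "\<psi> \<in> ell2" for h :: "nat \<Rightarrow> real \<Rightarrow> complex" and f C \<psi>
    using conjunct2[OF c8] that by blast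
  have diff: "\<Psi> f (\<lambda>n. \<phi> n - \<psi> n) = (\<lambda>n. \<Psi> f \<phi> n - \<Psi> f \<psi> n)"
    if "f \<in> bounded_borel" "\<phi> \<in> ell2" "\<psi> \<in> ell2" for f \<phi> \<psi>
    using lin[OF that, of 1 "-1"] by simp
  define G where "G = {f \<in> bounded_borel. \<forall>\<psi>\<in>ell2. \<Psi> f \<psi> = funcalc f \<psi>}"
  have "bounded_borel \<subseteq> G"
  proof (rule bounded_borel_monotone_class)
    fix g h a b assume "g \<in> G" "h \<in> G"
    then show "(\<lambda>x. a * g x + b * h x) \<in> G"
      by (auto simp: G_def lin' funcalc_lincomb_left)
  next
    fix g h assume "g \<in> G" "h \<in> G"
    then show "(\<lambda>x. g x * h x) \<in> G"
      by (auto simp: G_def mult funcalc_mult funcalc_ell2)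
  next
    show "(\<lambda>_. 1) \<in> G" by (auto simp: G_def one funcalc_one)
  next
    fix h :: "nat \<Rightarrow> real \<Rightarrow> complex" and g C
    assume h: "\<And>k. h k \<in> G" and g: "g \<in> bounded_borel" and lim: "\<And>x. (\<lambda>k. h k x) \<longlonglongrightarrow> g x"
      and C: "\<And>k x. cmod (h k x) \<le> C"
    have hb: "h k \<in> bounded_borel" and he: "\<psi> \<in> ell2 \<Longrightarrow> \<Psi> (h k) \<psi> = funcalc (h k) \<psi>" for k \<psi>
      using h[of k] by (auto simp: G_def)
    have "\<Psi> g \<psi> = funcalc g \<psi>" if \<psi>: "\<psi> \<in> ell2" for \<psi>
    proof (rule l2_tendsto_unique)
      show "l2_tendsto (\<lambda>k. \<Psi> (h k) \<psi>) (\<Psi> g \<psi>)" by (rule dom[OF hb g lim C \<psi>])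
      show "l2_tendsto (\<lambda>k. \<Psi> (h k) \<psi>) (funcalc g \<psi>)"
        unfolding he[OF \<psi>] by (rule funcalc_dominated_convergence[OF hb g lim C \<psi>])
    qed (intro maps funcalc_ell2 hb g \<psi>)+
    then show "g \<in> G" using g by (simp add: G_def)
  next
    fix z :: complex assume z: "Im z \<noteq> 0"
    let ?r = "cauchy_kernel z"
    have r: "?r \<in> bounded_borel" using z by auto
    obtain D where D: "\<And>x. cmod (?r x) \<le> D" using r by (metis bounded_borelE)
    have xr: "(\<lambda>x. of_real x * ?r x) \<in> bounded_borel" by (rule ident_cauchy_kernel_bounded[OF z])
    then obtain C where C: "\<And>x. cmod (of_real x * ?r x) \<le> C" by (metis bounded_borelE)
    have "\<Psi> ?r \<eta> = funcalc ?r \<eta>" if \<eta>: "\<eta> \<in> ell2" for \<eta>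
    proof -
      define \<psi> where "\<psi> = funcalc ?r \<eta>"
      have \<psi>: "\<psi> \<in> op_dom (schrodinger V)" "(\<lambda>n. schrodinger_formula V \<psi> n - z * \<psi> n) = \<eta>"
        unfolding \<psi>_def using funcalc_cauchy_kernel[OF z \<eta>] by auto
      then have \<psi>': "\<psi> \<in> ell2" "schrodinger_formula V \<psi> \<in> ell2" by (auto simp: op_dom_schrodinger)
      define h where "h k x = complex_of_real (max (- real k) (min (real k) x))" for k :: nat and x
      have h: "h k \<in> bounded_borel" for k
        unfolding h_def[abs_def] by (rule bounded_borelI[of _ "real k"]) auto
      have h_le: "cmod (h k x) \<le> \<bar>x\<bar>" for k x by (auto simp: h_def)
      have h_lim: "(\<lambda>k. h k x) \<longlonglongrightarrow> of_real x" for x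
      proof (rule tendsto_eventually)
        obtain K where K: "\<bar>x\<bar> \<le> real K" using real_arch_simple by blast
        show "\<forall>\<^sub>F k in sequentially. h k x = of_real x"
          using eventually_ge_at_top[of K] by eventually_elim (use K in \<open>auto simp: h_def\<close>)
      qed
      have t1: "l2_tendsto (\<lambda>k. \<Psi> ?r (\<Psi> (h k) \<psi>)) (\<Psi> ?r (schrodinger_formula V \<psi>))"
        by (rule l2_tendsto_bounded_operator[OF ident[OF h h_lim h_le \<psi>(1)], where C = D])
          (use \<psi>' r h D in \<open>auto intro: maps bound diff\<close>)
      have t2: "l2_tendsto (\<lambda>k. \<Psi> (\<lambda>x. ?r x * h k x) \<psi>) (\<Psi> (\<lambda>x. of_real x * ?r x) \<psi>)"
      proof (rule dom)
        show "(\<lambda>k. ?r x * h k x) \<longlonglongrightarrow> of_real x * ?r x" for x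
          unfolding mult.commute[of "of_real x"] by (intro tendsto_intros h_lim)
        show "cmod (?r x * h k x) \<le> C" for k x
        proof -
          have "cmod (?r x * h k x) \<le> cmod (of_real x * ?r x)"
            unfolding norm_mult mult.commute[of "cmod (?r x)"] using h_le by (intro mult_right_mono) auto
          then show ?thesis using C order_trans by blast
        qed
      qed (use r h xr \<psi>' in auto)
      have "\<Psi> ?r (schrodinger_formula V \<psi>) = \<Psi> (\<lambda>x. of_real x * ?r x) \<psi>"
        by (rule l2_tendsto_unique[OF t1 t2[unfolded mult[OF r h \<psi>'(1)]]]) (intro maps r h xr \<psi>')+
      also have "\<dots> = \<Psi> (\<lambda>x. 1 * 1 + z * ?r x) \<psi>" by (simp add: ident_cauchy_kernel[OF z])
      also have "\<dots> = (\<lambda>n. \<psi> n + z * \<Psi> ?r \<psi> n)"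
        using lin'[OF bounded_borel_const[of 1] r \<psi>'(1), of 1 z] by (simp add: one[OF \<psi>'(1)])
      finally have "\<Psi> ?r (\<lambda>n. 1 * schrodinger_formula V \<psi> n + (- z) * \<psi> n) = \<psi>"
        by (subst lin[OF r \<psi>'(2,1)]) simp
      then show ?thesis using \<psi>(2) by (simp add: \<psi>_def)
    qed
    then show "?r \<in> G" using r by (simp add: G_def)
  qed
  then show ?thesis using assms by (auto simp: G_def)
qed

theorem spectral_measure_eq: "spectral_measure (schrodinger V) delta1 = \<mu>"
  unfolding spectral_measure_def
proof (rule the_equality)
  show "is_spectral_measure (schrodinger V) delta1 \<mu>" by (rule is_spectral_measure)
  fix \<nu> assume "is_spectral_measure (schrodinger V) delta1 \<nu>"
  then obtain \<Psi> where \<nu>: "sets \<nu> = sets borel" "finite_measure \<nu>" and \<Psi>: "borel_functional_calculus (schrodinger V) \<Psi>"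
    and int: "\<And>f. f \<in> bounded_borel \<Longrightarrow> l2_inner delta1 (\<Psi> f delta1) = (\<integral>x. f x \<partial>\<nu>)"
    by (auto simp: is_spectral_measure_def)
  interpret \<nu>: finite_measure \<nu> by fact
  show "\<nu> = \<mu>"
  proof (rule measure_eqI)
    show "sets \<nu> = sets \<mu>" using \<nu> by simp
    fix S assume S: "S \<in> sets \<nu>"
    then have S': "S \<in> sets borel" using \<nu> by simp
    have "(\<integral>x. indicator S x \<partial>\<nu>) = (\<integral>x. indicator S x \<partial>\<mu> :: complex)"
      using int[OF bounded_borel_indicator[OF S']] l2_inner_funcalc_delta1[of "indicator S"]
        borel_functional_calculus_unique[OF \<Psi> bounded_borel_indicator[OF S'] delta1_ell2]
      by metis
    then have "complex_of_real (measure \<nu> S) = of_real (measure \<mu> S)"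
      using S S' by (simp add: integral_indicator_complex)
    then show "emeasure \<nu> S = emeasure \<mu> S"
      by (simp add: \<nu>.emeasure_eq_measure emeasure_eq_measure)
  qed
qed

end

lemma exists_orthonormality_measure: obtains \<mu> where "orthonormality_measure \<mu> V"
proof -
  obtain \<mu> where "real_distribution \<mu>"
    "\<And>m n. m \<ge> 1 \<Longrightarrow> n \<ge> 1 \<Longrightarrow> integrable \<mu> (\<lambda>x. opoly V m x * opoly V n x)"
    "\<And>m n. m \<ge> 1 \<Longrightarrow> n \<ge> 1 \<Longrightarrow> (\<integral>x. opoly V m x * opoly V n x \<partial>\<mu>) = of_bool (m = n)"
    using exists_measure_orthonormalizing_opoly by metis
  then show ?thesis
    by (intro that[of \<mu>]) (simp add: orthonormality_measure_def orthonormality_measure_axioms_def)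
qed

text \<open>The coupling only shifts the potential at the first site, so the whole family is covered by working with an arbitrary potential.\<close>

lemma delta1_perturbation_schrodinger:
  "delta1_perturbation (schrodinger V) lam = schrodinger (V(1 := V 1 + lam))"
proof -
  define W where "W = V(1 := V 1 + lam)"
  have app: "schrodinger_formula W \<psi> n =
      schrodinger_formula V \<psi> n + of_real lam * l2_inner delta1 \<psi> * delta1 n" for \<psi> n
    by (auto simp: W_def schrodinger_formula_def l2_inner_delta1 delta1_def algebra_simps)
  have "(schrodinger_formula W \<psi> \<in> ell2) = (schrodinger_formula V \<psi> \<in> ell2)" for \<psi>
  proof -
    have d: "(\<lambda>n. of_real lam * l2_inner delta1 \<psi> * delta1 n) \<in> ell2" by (intro ell2_cmult delta1_ell2)
    have "schrodinger_formula W \<psi> =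
        (\<lambda>n. schrodinger_formula V \<psi> n + of_real lam * l2_inner delta1 \<psi> * delta1 n)"
      using app by auto
    moreover have "schrodinger_formula V \<psi> =
        (\<lambda>n. schrodinger_formula W \<psi> n - of_real lam * l2_inner delta1 \<psi> * delta1 n)"
      using app by auto
    ultimately show ?thesis using ell2_add[OF _ d] ell2_diff[OF _ d] by metis
  qed
  then show ?thesis
    unfolding delta1_perturbation_def W_def[symmetric] schrodinger_def by (auto simp: app fun_eq_iff)
qed

section \<open>The essential spectrum\<close>

lemma eigenspace_schrodinger:
  assumes "\<psi> \<in> eigenspace (schrodinger V) z"
  shows "\<psi> = (\<lambda>n. \<psi> 1 * opoly V n z)"
proof
  fix n
  have \<psi>: "\<psi> \<in> ell2" "schrodinger_formula V \<psi> = (\<lambda>n. z * \<psi> n)"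
    using assms by (auto simp: eigenspace_def op_dom_schrodinger op_app_schrodinger)
  show "\<psi> n = \<psi> 1 * opoly V n z"
  proof (induction n rule: less_induct)
    case (less n)
    show ?case
    proof (cases "n \<le> 1")
      case True
      then have "n = 0 \<or> n = Suc 0" by auto
      then show ?thesis using \<psi> by (auto simp: ell2_zero_at_0)
    next
      case False
      then obtain m where m: "n = Suc (Suc m)" by (metis less_imp_Suc_add not_le One_nat_def add_Suc)
      have "\<psi> n = (z - of_real (V (Suc m))) * \<psi> (Suc m) - \<psi> m"
        using fun_cong[OF \<psi>(2), of "Suc m"]
        unfolding schrodinger_formula_eq[where \<psi> = \<psi>, OF ell2_zero_at_0[OF \<psi>(1)]]
        by (simp add: m algebra_simps)
      then show ?thesis using less[of m] less[of "Suc m"] by (simp add: m algebra_simps)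
    qed
  qed
qed

lemma finitely_spanned_eigenspace: "finitely_spanned (eigenspace (schrodinger V) z)"
  unfolding finitely_spanned_def
proof (intro exI[of _ 1] exI[of _ "\<lambda>_ n. opoly V n z"] ballI)
  fix \<psi> assume "\<psi> \<in> eigenspace (schrodinger V) z"
  then show "\<exists>c :: nat \<Rightarrow> complex. \<psi> = (\<lambda>n. \<Sum>k<1. c k * opoly V n z)"
    using eigenspace_schrodinger by (intro exI[of _ "\<lambda>_. \<psi> 1"]) auto
qed

lemma shift_ell2:
  assumes "\<psi> \<in> ell2"
  shows "(\<lambda>n. if n = 0 then 0 else \<psi> (n - 1)) \<in> ell2" "l2_norm (\<lambda>n. if n = 0 then 0 else \<psi> (n - 1)) \<le> l2_norm \<psi>"
    and "(\<lambda>n. if n = 0 then 0 else \<psi> (n + 1)) \<in> ell2" "l2_norm (\<lambda>n. if n = 0 then 0 else \<psi> (n + 1)) \<le> l2_norm \<psi>"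
proof -
  have sum_le: "(\<Sum>n<N. (cmod (if n = 0 then 0 else \<psi> (s n)))\<^sup>2) \<le> (l2_norm \<psi>)\<^sup>2" if "inj_on s {1..}" for s and N :: nat
  proof -
    have sub: "{1..<N} \<subseteq> {1..}" by auto
    have "(\<Sum>n<N. (cmod (if n = 0 then 0 else \<psi> (s n)))\<^sup>2) = (\<Sum>n\<in>{1..<N}. (cmod (\<psi> (s n)))\<^sup>2)"
      by (rule sum.mono_neutral_cong_right) auto
    also have "\<dots> = (\<Sum>n\<in>s ` {1..<N}. (cmod (\<psi> n))\<^sup>2)"
      using inj_on_subset[OF that, of "{1..<N}", OF sub] by (subst sum.reindex) auto
    also have "\<dots> \<le> (l2_norm \<psi>)\<^sup>2" by (rule sum_le_l2_norm_sq[OF assms]) auto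
    finally show ?thesis .
  qed
  have 1: "inj_on (\<lambda>n::nat. n - 1) {1..}" and 2: "inj_on (\<lambda>n::nat. n + 1) {1..}" by (auto simp: inj_on_def)
  show "(\<lambda>n. if n = 0 then 0 else \<psi> (n - 1)) \<in> ell2" "l2_norm (\<lambda>n. if n = 0 then 0 else \<psi> (n - 1)) \<le> l2_norm \<psi>"
    by (rule ell2_l2_norm_leI[OF sum_le[OF 1]]; use assms in simp)+
  show "(\<lambda>n. if n = 0 then 0 else \<psi> (n + 1)) \<in> ell2" "l2_norm (\<lambda>n. if n = 0 then 0 else \<psi> (n + 1)) \<le> l2_norm \<psi>"
    by (rule ell2_l2_norm_leI[OF sum_le[OF 2]]; use assms in simp)+
qed

text \<open>Write \<open>(H - E) \<psi> = (V - E) \<psi> + L \<psi> + R \<psi>\<close> with two shifts of norm at most 1.\<close>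

lemma schrodinger_lower_bound_at_infinity:
  assumes far: "\<And>n. n > M \<Longrightarrow> \<bar>E\<bar> \<le> \<bar>V n - E\<bar>"
    and \<psi>: "\<psi> \<in> op_dom (schrodinger V)" and zero: "\<And>n. n \<le> M \<Longrightarrow> \<psi> n = 0"
  shows "(\<bar>E\<bar> - 2) * l2_norm \<psi> \<le> l2_norm (\<lambda>n. schrodinger_formula V \<psi> n - of_real E * \<psi> n)"
proof -
  have \<psi>': "\<psi> \<in> ell2" "schrodinger_formula V \<psi> \<in> ell2" using \<psi> by (auto simp: op_dom_schrodinger)
  define \<eta> where "\<eta> n = schrodinger_formula V \<psi> n - of_real E * \<psi> n" for n
  define L where "L n = (if n = 0 then 0 else \<psi> (n - 1))" for n
  define R where "R n = (if n = 0 then 0 else \<psi> (n + 1))" for n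
  have ell2: "\<eta> \<in> ell2" "L \<in> ell2" "R \<in> ell2"
    unfolding \<eta>_def[abs_def] L_def[abs_def] R_def[abs_def] using \<psi>' shift_ell2[OF \<psi>'(1)] by auto
  have norms: "l2_norm L \<le> l2_norm \<psi>" "l2_norm R \<le> l2_norm \<psi>"
    unfolding L_def[abs_def] R_def[abs_def] using shift_ell2[OF \<psi>'(1)] by auto
  have LR: "(\<lambda>n. L n + R n) \<in> ell2" using ell2 by auto
  have le: "cmod (of_real E * \<psi> n) \<le> cmod (\<eta> n - (L n + R n))" for n
  proof (cases "n \<le> M")
    case False
    then have "\<eta> n - (L n + R n) = of_real (V n - E) * \<psi> n"
      using ell2_zero_at_0[OF \<psi>'(1)] by (simp add: \<eta>_def L_def R_def schrodinger_formula_eq algebra_simps)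
    then show ?thesis using far[of n] False by (simp add: norm_mult mult_right_mono del: of_real_diff)
  qed (simp add: zero)
  have "\<bar>E\<bar> * l2_norm \<psi> = l2_norm (\<lambda>n. of_real E * \<psi> n)" using \<psi>' by (simp add: l2_norm_cmult)
  also have "\<dots> \<le> l2_norm (\<lambda>n. \<eta> n - (L n + R n))"
    by (rule ell2_l2_norm_mono(2)[OF ell2_diff[OF ell2(1) LR] le])
  also have "\<dots> \<le> l2_norm \<eta> + l2_norm (\<lambda>n. L n + R n)" by (rule l2_norm_triangle_diff[OF ell2(1) LR])
  also have "\<dots> \<le> l2_norm \<eta> + (l2_norm L + l2_norm R)" using l2_norm_triangle[OF ell2(2,3)] by simp
  also have "\<dots> \<le> l2_norm \<eta> + 2 * l2_norm \<psi>" using norms by simp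
  finally show ?thesis by (simp add: \<eta>_def[abs_def] algebra_simps)
qed

text \<open>Weyl's criterion: \<open>E = 2 cos \<theta>\<close>, and the plane wave \<open>exp(\<i> \<theta> n)\<close> cut off to a gap of length \<open>L\<close> has norm \<open>\<surd>L\<close>,
  whereas \<open>(H - E) \<psi>\<close> is supported at the four sites next to the two ends and is bounded independently of \<open>L\<close>.\<close>

lemma interval_subset_spectrum:
  assumes gaps: "\<And>L. \<exists>a. \<forall>n\<in>{a+1..a+L}. V n = 0" and E: "E \<in> {-2..2}"
  shows "complex_of_real E \<in> op_spectrum (schrodinger V)"
proof (rule ccontr)
  assume "complex_of_real E \<notin> op_spectrum (schrodinger V)"
  then have "of_real E \<in> resolvent_set (schrodinger V)" by (simp add: op_spectrum_def)
  then obtain C where C: "\<And>\<psi>. \<psi> \<in> op_dom (schrodinger V) \<Longrightarrow>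
      l2_norm \<psi> \<le> C * l2_norm (\<lambda>n. schrodinger_formula V \<psi> n - of_real E * \<psi> n)"
    by (auto simp: resolvent_set_def op_app_schrodinger)
  \<comment> \<open>Below, \<open>\<psi>\<close> has norm \<open>\<surd>L\<close> and \<open>(H - E) \<psi>\<close> has four entries of size at most 4, hence norm at most 8.\<close>
  obtain L where L: "(8 * C)\<^sup>2 < real L" using reals_Archimedean2 by blast
  obtain a where a: "\<And>n. n \<in> {a+1..a+L} \<Longrightarrow> V n = 0" using gaps by blast
  define \<theta> where "\<theta> = arccos (E / 2)"
  have \<theta>: "E = 2 * cos \<theta>" using E by (simp add: \<theta>_def cos_arccos)
  define \<psi> where "\<psi> n = (if n \<in> {a+1..a+L} then cis (\<theta> * real n) else 0)" for n
  define \<eta> where "\<eta> n = schrodinger_formula V \<psi> n - of_real E * \<psi> n" for n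
  have \<psi>0: "\<psi> 0 = 0" by (simp add: \<psi>_def)
  have \<psi>: "\<psi> \<in> ell2" by (rule ell2_finite[of "{a+1..a+L}"]) (auto simp: \<psi>_def)
  have \<psi>_norm: "l2_norm \<psi> = sqrt (real L)"
    by (subst l2_norm_finite[of "{a+1..a+L}"]) (auto simp: \<psi>_def)
  have cmod_\<psi>: "cmod (\<psi> n) \<le> 1" for n by (auto simp: \<psi>_def)
  have \<eta>_eq: "\<eta> n = \<psi> (n - 1) + \<psi> (n + 1) - of_real E * \<psi> n" if "n \<noteq> 0" for n
  proof -
    have "of_real (V n) * \<psi> n = 0" using a[of n] by (auto simp: \<psi>_def)
    then show ?thesis using that by (simp add: \<eta>_def schrodinger_formula_eq[where \<psi> = \<psi>, OF \<psi>0])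
  qed
  have \<eta>_le: "cmod (\<eta> n) \<le> 4" for n
  proof (cases "n = 0")
    case False
    have "cmod (of_real E * \<psi> n) \<le> 2 * 1" unfolding norm_mult using E cmod_\<psi> by (intro mult_mono) auto
    then show ?thesis unfolding \<eta>_eq[OF False]
      using norm_triangle_ineq4[of "\<psi> (n - 1) + \<psi> (n + 1)" "of_real E * \<psi> n"] norm_triangle_ineq[of "\<psi> (n - 1)" "\<psi> (n + 1)"]
        cmod_\<psi>[of "n - 1"] cmod_\<psi>[of "n + 1"] by linarith
  qed (simp add: \<eta>_def schrodinger_formula_def \<psi>0)
  let ?S = "{a, a + 1, a + L, a + L + 1}"
  have \<eta>_0: "\<eta> n = 0" if "n \<notin> ?S" for n
  proof (cases "n \<in> {a+2..<a+L}")
    case True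
    then obtain k where k: "n = Suc k" "k \<ge> a + 1" "k + 2 \<le> a + L" by (cases n) auto
    have rec: "cis (\<theta> * real k) + cis (\<theta> * real (k + 2)) = of_real E * cis (\<theta> * real (Suc k))"
    proof -
      have "cis (\<theta> * real k) = cis (\<theta> * real (Suc k)) * cis (- \<theta>)"
        "cis (\<theta> * real (k + 2)) = cis (\<theta> * real (Suc k)) * cis \<theta>"
        by (simp_all add: cis_mult algebra_simps)
      then have "cis (\<theta> * real k) + cis (\<theta> * real (k + 2)) = cis (\<theta> * real (Suc k)) * (cis (-\<theta>) + cis \<theta>)"
        by (simp add: algebra_simps)
      also have "cis (-\<theta>) + cis \<theta> = of_real E" by (simp add: complex_eq_iff \<theta>)
      finally show ?thesis by (simp add: mult.commute)
    qed
    have vals: "\<psi> (n - 1) = cis (\<theta> * real k)" "\<psi> (n + 1) = cis (\<theta> * real (k + 2))"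
        "\<psi> n = cis (\<theta> * real (Suc k))"
      using k by (auto simp: \<psi>_def)
    have "n \<noteq> 0" using k by simp
    show ?thesis unfolding \<eta>_eq[OF \<open>n \<noteq> 0\<close>] vals rec by (rule diff_self)
  next
    case False
    show ?thesis
    proof (cases "n = 0")
      case nz: False
      have "\<psi> (n - 1) = 0" "\<psi> (n + 1) = 0" "\<psi> n = 0" using False that nz by (auto simp: \<psi>_def)
      then show ?thesis by (simp add: \<eta>_eq[OF nz])
    qed (simp add: \<eta>_def schrodinger_formula_def \<psi>0)
  qed
  have \<eta>: "\<eta> \<in> ell2" by (rule ell2_finite[of ?S]) (use \<eta>_0 in \<open>auto simp: \<eta>_def schrodinger_formula_def \<psi>0\<close>)
  have "schrodinger_formula V \<psi> = (\<lambda>n. \<eta> n + of_real E * \<psi> n)" by (simp add: \<eta>_def)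
  then have "\<psi> \<in> op_dom (schrodinger V)" using \<psi> \<eta> by (auto simp: op_dom_schrodinger)
  from C[OF this] have "sqrt (real L) \<le> C * l2_norm \<eta>" by (simp add: \<eta>_def[abs_def] \<psi>_norm)
  also have "\<dots> \<le> \<bar>C\<bar> * 8"
  proof -
    have "(\<Sum>n\<in>?S. (cmod (\<eta> n))\<^sup>2) \<le> (\<Sum>n\<in>?S. 4\<^sup>2)" using \<eta>_le by (intro sum_mono power_mono) auto
    also have "\<dots> \<le> real 4 * 4\<^sup>2"
      unfolding sum_constant by (intro mult_right_mono of_nat_mono card_insert_le_m1) (auto intro!: card_insert_le_m1)
    finally have "l2_norm \<eta> \<le> 8"
      by (subst l2_norm_finite[of ?S]) (use \<eta>_0 in \<open>auto intro!: real_le_lsqrt\<close>)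
    then show ?thesis using \<eta> by (intro mult_mono) auto
  qed
  finally have "(sqrt (real L))\<^sup>2 \<le> (\<bar>C\<bar> * 8)\<^sup>2" by (intro power_mono) auto
  then show False using L by (simp add: power_mult_distrib)
qed

context orthonormality_measure
begin

lemma funcalc_cong_AE:
  assumes "f \<in> bounded_borel" "g \<in> bounded_borel" "AE x in \<mu>. f x = g x"
  shows "funcalc f = funcalc g"
proof -
  have [measurable]: "f \<in> borel_measurable borel" "g \<in> borel_measurable borel"
    using assms by (auto simp: bounded_borel_measurable)
  have "fmat f m n = fmat g m n" for m n
    unfolding fmat_def by (rule integral_cong_AE) (use assms(3) in \<open>auto elim: eventually_mono\<close>)
  then show ?thesis by (simp add: funcalc_def fun_eq_iff)
qed

text \<open>A function that is \<open>1/(x - z)\<close> almost everywhere and bounded represents the inverse of \<open>H - z\<close>.\<close>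

lemma resolvent_setI:
  assumes f: "f \<in> bounded_borel" and g: "g \<in> bounded_borel" and eq: "\<And>x. g x = (of_real x - z) * f x"
    and one: "AE x in \<mu>. g x = 1"
  shows "z \<in> resolvent_set (schrodinger V)"
proof -
  have g_id: "funcalc g \<psi> = \<psi>" if "\<psi> \<in> ell2" for \<psi>
    using funcalc_cong_AE[OF g bounded_borel_const one] funcalc_one[OF that] by simp
  obtain C where C: "\<And>x. cmod (f x) \<le> C" using f by (metis bounded_borelE)
  have left: "funcalc f (\<lambda>n. schrodinger_formula V \<psi> n - z * \<psi> n) = \<psi>" if "\<psi> \<in> op_dom (schrodinger V)" for \<psi>
    using funcalc_schrodinger_formula[OF f g eq that] that by (simp add: g_id op_dom_schrodinger)
  have maps: "(\<lambda>n. schrodinger_formula V \<psi> n - z * \<psi> n) \<in> ell2" if "\<psi> \<in> op_dom (schrodinger V)" for \<psi>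
    using that by (auto simp: op_dom_schrodinger)
  have "bij_betw (\<lambda>\<psi> n. schrodinger_formula V \<psi> n - z * \<psi> n) (op_dom (schrodinger V)) ell2"
    by (rule bij_betwI[where g = "funcalc f"])
      (use maps left funcalc_in_domain[OF f g eq] schrodinger_formula_funcalc[OF f g eq] g_id in auto)
  moreover have "l2_norm \<psi> \<le> C * l2_norm (\<lambda>n. schrodinger_formula V \<psi> n - z * \<psi> n)"
    if "\<psi> \<in> op_dom (schrodinger V)" for \<psi>
    using funcalc_bounded(2)[OF f C maps[OF that]] left[OF that] by simp
  ultimately show ?thesis by (auto simp: resolvent_set_def op_app_schrodinger)
qed

lemma nonreal_in_resolvent_set: "Im z \<noteq> 0 \<Longrightarrow> z \<in> resolvent_set (schrodinger V)"
  by (rule resolvent_setI[where f = "cauchy_kernel z" and g = "\<lambda>_. 1"])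
    (use of_real_neq_nonreal in \<open>auto simp: cauchy_kernel_def\<close>)

lemma null_interval_in_resolvent_set:
  assumes e: "e > 0" and null: "measure \<mu> {E - e<..<E + e} = 0"
  shows "of_real E \<in> resolvent_set (schrodinger V)"
proof (rule resolvent_setI)
  let ?f = "\<lambda>x. if x \<in> {E - e<..<E + e} then 0 else 1 / (complex_of_real x - of_real E)"
  let ?g = "\<lambda>x. if x \<in> {E - e<..<E + e} then 0 else 1 :: complex"
  show "?f \<in> bounded_borel"
  proof (rule bounded_borelI)
    show "cmod (?f x) \<le> 1 / e" for x
      using e by (auto simp: norm_divide of_real_diff[symmetric] simp del: of_real_diff intro!: divide_left_mono mult_pos_pos)
  qed measurable
  show "?g \<in> bounded_borel" by (rule bounded_borelI[of _ 1]) auto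
  show "?g x = (of_real x - of_real E) * ?f x" for x using e by auto
  have "{E - e<..<E + e} \<in> null_sets \<mu>" using null by (simp add: null_sets_def emeasure_eq_measure)
  then show "AE x in \<mu>. ?g x = 1" by (rule AE_I') auto
qed

lemma atom_eigenvector:
  assumes "measure \<mu> {E} \<noteq> 0"
  shows "eigenspace (schrodinger V) (of_real E) \<noteq> {\<lambda>n. 0}"
proof -
  let ?f = "indicator {E} :: real \<Rightarrow> complex"
  have f: "?f \<in> bounded_borel" by (rule bounded_borel_indicator) simp
  have eq: "0 = (complex_of_real x - of_real E) * ?f x" for x by (auto simp: indicator_def)
  have z: "funcalc (\<lambda>_. 0) delta1 = (\<lambda>_. 0)" by (simp add: funcalc_def fmat_def fun_eq_iff)
  have "funcalc ?f delta1 \<in> eigenspace (schrodinger V) (of_real E)"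
    using schrodinger_formula_funcalc[OF f bounded_borel_const eq delta1_ell2]
      funcalc_in_domain[OF f bounded_borel_const eq delta1_ell2] z
    by (simp add: eigenspace_def op_app_schrodinger)
  moreover have "funcalc ?f delta1 1 \<noteq> 0"
    using assms l2_inner_funcalc_delta1[of ?f] by (simp add: l2_inner_delta1 integral_indicator_complex)
  ultimately show ?thesis by force
qed

lemma fmat_sum:
  assumes "\<And>i. i \<in> I \<Longrightarrow> f i \<in> bounded_borel"
  shows "fmat (\<lambda>x. \<Sum>i\<in>I. a i * f i x) m n = (\<Sum>i\<in>I. a i * fmat (f i) m n)"
proof -
  have "fmat (\<lambda>x. \<Sum>i\<in>I. a i * f i x) m n =
      (\<integral>x. (\<Sum>i\<in>I. a i * (of_real (opoly V m x) * (f i x * of_real (opoly V n x)))) \<partial>\<mu>)"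
    unfolding fmat_def by (rule Bochner_Integration.integral_cong) (simp_all add: sum_distrib_left sum_distrib_right mult_ac)
  also have "\<dots> = (\<Sum>i\<in>I. a i * fmat (f i) m n)"
    unfolding fmat_def by (subst Bochner_Integration.integral_sum) (auto intro!: integrable_mult_right integrable_fmat assms)
  finally show ?thesis .
qed

text \<open>Suppose all the sets have positive measure. The vectors \<open>1\<^sub>S\<^sub>i(H) \<delta>\<^sub>1\<close> are then more than \<open>M\<close> in number, so
  a nontrivial combination \<open>\<psi>\<close> vanishes at the first \<open>M\<close> sites. It has energies within \<open>c\<close> of \<open>E\<close>, so \<open>H - E\<close> stretches it by at most \<open>c\<close>, but
  by at least \<open>\<bar>E\<bar> - 2\<close> by the lower bound. Hence it is 0, and since the sets are disjoint, each summand is 0.\<close>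

lemma few_charged_sets_outside_band:
  assumes far: "\<And>n. n > M \<Longrightarrow> \<bar>E\<bar> \<le> \<bar>V n - E\<bar>" and c: "0 < c" "c < \<bar>E\<bar> - 2"
    and S: "\<And>i. i \<in> I \<Longrightarrow> S i \<in> sets borel" "\<And>i. i \<in> I \<Longrightarrow> S i \<subseteq> {x. \<bar>x - E\<bar> < c}" "disjoint_family_on S I"
    and I: "finite I" "card I > M"
  shows "\<exists>i\<in>I. measure \<mu> (S i) = 0"
proof -
  let ?ind = "\<lambda>i. indicator (S i) :: real \<Rightarrow> complex"
  have ind: "?ind i \<in> bounded_borel" if "i \<in> I" for i using S that by auto
  have "\<exists>a. (\<exists>i\<in>I. a i \<noteq> 0) \<and> (\<forall>n\<in>{1..M}. (\<Sum>i\<in>I. a i * fmat (?ind i) n 1) = 0)"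
    by (rule exists_linear_dependency) (use I in auto)
  then obtain a i0 where i0: "i0 \<in> I" "a i0 \<noteq> 0" and a: "\<And>n. n \<in> {1..M} \<Longrightarrow> (\<Sum>i\<in>I. a i * fmat (?ind i) n 1) = 0"
    by blast
  define f where "f x = (\<Sum>i\<in>I. a i * ?ind i x)" for x
  \<comment> \<open>On the support of \<open>f\<close>, multiplication by \<open>x - E\<close> agrees with multiplication by \<open>k\<close>, which is bounded by \<open>c\<close>.\<close>
  define k where "k x = (if \<bar>x - E\<bar> < c then complex_of_real (x - E) else 0)" for x
  have f_bb: "f \<in> bounded_borel"
    unfolding f_def[abs_def] by (intro bounded_borel_sum bounded_borel_mult bounded_borel_const ind)
  have k_le: "cmod (k x) \<le> \<bar>c\<bar>" for x by (auto simp: k_def simp del: of_real_diff)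
  have k_bb: "k \<in> bounded_borel" unfolding k_def[abs_def]
    by (rule bounded_borelI[OF _ k_le[unfolded k_def]]) measurable
  have kf: "k x * f x = (of_real x - of_real E) * f x" for x
  proof (cases "\<bar>x - E\<bar> < c")
    case False
    then have "f x = 0" unfolding f_def using S(2) by (intro sum.neutral) (auto simp: indicator_def)
    then show ?thesis by simp
  qed (simp add: k_def)
  define \<psi> where "\<psi> = funcalc f delta1"
  have \<psi>_dom: "\<psi> \<in> op_dom (schrodinger V)"
    unfolding \<psi>_def by (rule funcalc_in_domain[OF f_bb _ kf delta1_ell2]) (use k_bb f_bb in auto)
  then have \<psi>: "\<psi> \<in> ell2" by (simp add: op_dom_schrodinger)
  have zero: "\<psi> n = 0" if "n \<le> M" for n
  proof (cases "n = 0")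
    case False
    have "\<psi> n = (\<Sum>i\<in>I. a i * fmat (?ind i) n 1)"
      unfolding \<psi>_def funcalc_delta1 f_def[abs_def] by (rule fmat_sum[OF ind])
    then show ?thesis using a[of n] False that by simp
  qed (simp add: \<psi>_def)
  have "(\<lambda>n. schrodinger_formula V \<psi> n - of_real E * \<psi> n) = funcalc k \<psi>"
    unfolding \<psi>_def funcalc_mult[OF k_bb f_bb delta1_ell2, symmetric]
    by (subst schrodinger_formula_funcalc[OF f_bb _ kf delta1_ell2]) (use k_bb f_bb in auto)
  then have "(\<bar>E\<bar> - 2) * l2_norm \<psi> \<le> l2_norm (funcalc k \<psi>)"
    using schrodinger_lower_bound_at_infinity[OF far \<psi>_dom zero] by simp
  also have "\<dots> \<le> \<bar>c\<bar> * l2_norm \<psi>" by (rule funcalc_bounded(2)[OF k_bb k_le \<psi>])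
  finally have le: "(\<bar>E\<bar> - 2 - \<bar>c\<bar>) * l2_norm \<psi> \<le> 0" by (simp add: algebra_simps)
  have pos: "\<bar>E\<bar> - 2 - \<bar>c\<bar> > 0" using c by simp
  have "\<not> l2_norm \<psi> > 0" using mult_pos_pos[OF pos, of "l2_norm \<psi>"] le by linarith
  then have "l2_norm \<psi> = 0" using l2_norm_nonneg[OF \<psi>] by linarith
  then have \<psi>_0: "\<psi> = (\<lambda>_. 0)" using l2_norm_eq_0[OF \<psi>] by auto
  have "a i0 * of_real (measure \<mu> (S i0)) = (\<integral>x. a i0 * ?ind i0 x \<partial>\<mu>)"
    using S i0 by (simp add: integral_indicator_complex)
  also have "\<dots> = (\<integral>x. ?ind i0 x * f x \<partial>\<mu>)"
  proof (rule Bochner_Integration.integral_cong[OF refl])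
    fix x
    show "a i0 * ?ind i0 x = ?ind i0 x * f x"
    proof (cases "x \<in> S i0")
      case True
      have "f x = (\<Sum>i\<in>I. if i = i0 then a i0 else 0)"
        unfolding f_def using S(3) True i0 by (intro sum.cong) (auto simp: disjoint_family_on_def indicator_def)
      then show ?thesis using I i0 True by simp
    qed simp
  qed
  also have "\<dots> = l2_inner delta1 (funcalc (?ind i0) \<psi>)"
    unfolding \<psi>_def funcalc_mult[OF ind[OF i0(1)] f_bb delta1_ell2, symmetric] l2_inner_funcalc_delta1 ..
  also have "\<dots> = 0" by (simp add: \<psi>_0 funcalc_def l2_inner_delta1)
  finally show ?thesis using i0 by auto
qed

text \<open>Cut the punctured neighbourhood into disjoint shells. At most \<open>M\<close> of them are charged, so the ones close to \<open>E\<close> are not.\<close>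

lemma punctured_neighbourhood_null:
  assumes far: "\<And>n. n > M \<Longrightarrow> \<bar>E\<bar> \<le> \<bar>V n - E\<bar>" and E: "\<bar>E\<bar> > 2"
  obtains e where "e > 0" "measure \<mu> {x. 0 < \<bar>x - E\<bar> \<and> \<bar>x - E\<bar> < e} = 0"
proof -
  define c where "c = (\<bar>E\<bar> - 2) / 2"
  have c: "c > 0" "c < \<bar>E\<bar> - 2" using E by (auto simp: c_def)
  define r where "r i = c / real (Suc i)" for i
  have r_mono: "r j \<le> r i" if "i \<le> j" for i j
    using that c by (auto simp: r_def intro!: divide_left_mono)
  have r_pos: "r i > 0" and r_le: "r i \<le> c" for i using c r_mono[of 0 i] by (auto simp: r_def)
  define S where "S i = {x. r (Suc i) \<le> \<bar>x - E\<bar> \<and> \<bar>x - E\<bar> < r i}" for i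
  have S_borel: "S i \<in> sets borel" for i unfolding S_def by measurable
  have disj: "disjoint_family_on S I" for I
    unfolding disjoint_family_on_def
  proof (intro ballI impI)
    fix i j :: nat assume "i \<noteq> j"
    then show "S i \<inter> S j = {}"
      using r_mono[of "Suc i" j] r_mono[of "Suc j" i] by (cases "i < j") (fastforce simp: S_def)+
  qed
  have "finite {i. measure \<mu> (S i) \<noteq> 0}"
  proof (rule ccontr)
    assume "infinite {i. measure \<mu> (S i) \<noteq> 0}"
    then obtain I where I: "I \<subseteq> {i. measure \<mu> (S i) \<noteq> 0}" "finite I" "card I = Suc M"
      using infinite_arbitrarily_large by blast
    have "\<exists>i\<in>I. measure \<mu> (S i) = 0"
    proof (rule few_charged_sets_outside_band[OF far c])
      show "S i \<subseteq> {x. \<bar>x - E\<bar> < c}" for i using r_le[of i] by (auto simp: S_def)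
    qed (use S_borel disj I in auto)
    then show False using I by auto
  qed
  then obtain K where K: "\<And>i. i \<ge> K \<Longrightarrow> measure \<mu> (S i) = 0"
    by (meson finite_nat_set_iff_bounded not_le mem_Collect_eq)
  let ?D = "{x. 0 < \<bar>x - E\<bar> \<and> \<bar>x - E\<bar> < r K}"
  have sub: "?D \<subseteq> (\<Union>i. S (K + i))"
  proof
    fix x assume x: "x \<in> ?D"
    obtain n where n: "c / \<bar>x - E\<bar> < real n" using reals_Archimedean2 by blast
    then have "c < real n * \<bar>x - E\<bar>" using x by (simp add: pos_divide_less_eq)
    moreover have "real n * \<bar>x - E\<bar> \<le> \<bar>x - E\<bar> * real (Suc n)" by (simp add: algebra_simps)
    ultimately have "c \<le> \<bar>x - E\<bar> * real (Suc n)" by linarith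
    then have "r n \<le> \<bar>x - E\<bar>" unfolding r_def by (subst pos_divide_le_eq) auto
    define j where "j = (LEAST j. r j \<le> \<bar>x - E\<bar>)"
    have j: "r j \<le> \<bar>x - E\<bar>" unfolding j_def by (rule LeastI) fact
    have jK: "j > K"
    proof (rule ccontr)
      assume "\<not> j > K"
      then have "r K \<le> r j" by (intro r_mono) simp
      then show False using j x by simp
    qed
    then obtain i where i: "j = Suc i" "i \<ge> K" by (cases j) auto
    have "\<not> r i \<le> \<bar>x - E\<bar>" unfolding j_def by (rule not_less_Least) (use i j_def in simp)
    then have "x \<in> S (K + (i - K))" using i j by (simp add: S_def)
    then show "x \<in> (\<Union>i. S (K + i))" by blast
  qed
  have "(\<Union>i. S (K + i)) \<in> null_sets \<mu>"
    by (rule null_sets_UN) (use K S_borel in \<open>simp add: null_sets_def emeasure_eq_measure\<close>)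
  moreover have "?D \<in> sets \<mu>" unfolding events_eq_borel by measurable
  ultimately have "?D \<in> null_sets \<mu>" using null_sets_subset sub by blast
  then have "measure \<mu> ?D = 0" by (simp add: null_sets_def emeasure_eq_measure)
  then show ?thesis using r_pos[of K] that by blast
qed

end

text \<open>Outside \<open>[-2, 2]\<close> the measure has no mass in a punctured neighbourhood. Either the centre carries no mass and is in the resolvent set,
  or it is an isolated point of the spectrum and an eigenvalue; the eigenspaces are one-dimensional as \<open>\<psi> 1\<close> determines an eigenvector.\<close>

theorem essential_spectrum_sparse_barriers:
  assumes gaps: "\<And>L. \<exists>a. \<forall>n\<in>{a+1..a+L}. V n = 0"
    and barriers: "\<And>E. \<exists>M. \<forall>n>M. V n = 0 \<or> V n \<ge> E"
  shows "essential_spectrum (schrodinger V) = complex_of_real ` {-2..2}"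
proof -
  obtain \<mu> where "orthonormality_measure \<mu> V" by (rule exists_orthonormality_measure)
  then interpret orthonormality_measure \<mu> V .
  let ?A = "schrodinger V"
  have inside: "complex_of_real E \<in> op_spectrum ?A" if "E \<in> {-2..2}" for E
    by (rule interval_subset_spectrum[OF gaps that])
  have nonreal: "Im z = 0" if "z \<in> op_spectrum ?A" for z
    using nonreal_in_resolvent_set[of z] that by (auto simp: op_spectrum_def)
  show ?thesis
  proof (intro equalityI subsetI)
    fix z assume "z \<in> complex_of_real ` {-2..2}"
    then obtain E where E: "z = of_real E" "E \<in> {-2..2}" by auto
    have "\<not> z isolated_in op_spectrum ?A"
    proof
      assume "z isolated_in op_spectrum ?A"
      then obtain e where e: "e > 0" "\<And>y. y \<in> op_spectrum ?A \<Longrightarrow> dist z y < e \<Longrightarrow> y = z"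
        by (auto simp: isolated_in_dist_Ex_iff)
      \<comment> \<open>A second point of \<open>[-2, 2]\<close> close to \<open>E\<close>, on the side of \<open>E\<close> facing 0 so that it stays in the interval.\<close>
      define d where "d = min (e / 2) 1"
      define E' where "E' = (if E > 0 then E - d else E + d)"
      have d: "d > 0" "d \<le> 1" "d < e" using e by (auto simp: d_def)
      have "E' \<in> {-2..2}" using E d by (auto simp: E'_def)
      moreover have "dist z (of_real E') < e" using d
        unfolding E(1) dist_of_real dist_real_def by (auto simp: E'_def)
      ultimately have "complex_of_real E' = z" using e inside by blast
      then show False using d by (auto simp: E E'_def split: if_splits)
    qed
    then show "z \<in> essential_spectrum ?A"
      using inside E by (auto simp: essential_spectrum_def discrete_spectrum_def)
  next
    fix z assume z: "z \<in> essential_spectrum ?A"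
    then have zs: "z \<in> op_spectrum ?A" by (simp add: essential_spectrum_def)
    define E where "E = Re z"
    have zE: "z = of_real E" using nonreal[OF zs] by (simp add: E_def complex_eq_iff)
    have "\<bar>E\<bar> \<le> 2"
    proof (rule ccontr)
      assume "\<not> \<bar>E\<bar> \<le> 2"
      then have E2: "\<bar>E\<bar> > 2" by simp
      obtain M where "\<forall>n>M. V n = 0 \<or> V n \<ge> 2 * \<bar>E\<bar>" using barriers by blast
      then have far: "\<bar>E\<bar> \<le> \<bar>V n - E\<bar>" if "n > M" for n using that by fastforce
      obtain e where e: "e > 0" and null: "measure \<mu> {x. 0 < \<bar>x - E\<bar> \<and> \<bar>x - E\<bar> < e} = 0"
        using punctured_neighbourhood_null[OF far E2] by blast
      have D: "{x. 0 < \<bar>x - E\<bar> \<and> \<bar>x - E\<bar> < e} \<in> sets borel" by measurable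
      have atom: "measure \<mu> {E} \<noteq> 0"
      proof
        assume "measure \<mu> {E} = 0"
        then have "measure \<mu> ({E} \<union> {x. 0 < \<bar>x - E\<bar> \<and> \<bar>x - E\<bar> < e}) = 0"
          using null D measure_Un_le[of "{E}" \<mu> "{x. 0 < \<bar>x - E\<bar> \<and> \<bar>x - E\<bar> < e}"] measure_nonneg
          by (simp add: antisym)
        also have "{E} \<union> {x. 0 < \<bar>x - E\<bar> \<and> \<bar>x - E\<bar> < e} = {E - e<..<E + e}" using e by auto
        finally show False using null_interval_in_resolvent_set[OF e] zs zE by (simp add: op_spectrum_def)
      qed
      have "z isolated_in op_spectrum ?A"
        unfolding isolated_in_dist_Ex_iff
      proof (intro conjI zs exI[of _ e] e ballI impI)
        fix y assume y: "y \<in> op_spectrum ?A" "dist z y < e"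
        define E' where "E' = Re y"
        have yE: "y = of_real E'" using nonreal[OF y(1)] by (simp add: E'_def complex_eq_iff)
        have le: "\<bar>E' - E\<bar> < e" using y(2)
          unfolding zE yE dist_of_real dist_real_def by linarith
        show "y = z"
        proof (rule ccontr)
          assume "y \<noteq> z"
          then have ne: "E' \<noteq> E" by (auto simp: yE zE)
          define d where "d = min \<bar>E' - E\<bar> (e - \<bar>E' - E\<bar>)"
          have d: "d > 0" using le ne by (simp add: d_def)
          have sub: "{E' - d<..<E' + d} \<subseteq> {x. 0 < \<bar>x - E\<bar> \<and> \<bar>x - E\<bar> < e}" by (auto simp: d_def)
          have "measure \<mu> {E' - d<..<E' + d} \<le> 0"
            using finite_measure_mono[OF sub] D null by simp
          then have "measure \<mu> {E' - d<..<E' + d} = 0" by (simp add: antisym)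
          from null_interval_in_resolvent_set[OF d this] show False using y yE by (simp add: op_spectrum_def)
        qed
      qed
      then have "z \<in> discrete_spectrum ?A"
        unfolding discrete_spectrum_def using atom_eigenvector[OF atom] finitely_spanned_eigenspace zE by simp
      then show False using z by (simp add: essential_spectrum_def)
    qed
    then have "E \<in> {-2..2}" by auto
    then show "z \<in> complex_of_real ` {-2..2}" unfolding zE by (rule imageI)
  qed
qed

section \<open>Recurrence of the Fourier transform\<close>

lemma cmod_exp_diff_le:
  "cmod (exp (- \<i> * of_real t * of_real y) - exp (- \<i> * of_real t * of_real x)) \<le> \<bar>t\<bar> * \<bar>y - x\<bar>"
proof -
  have "exp (- \<i> * of_real t * of_real y) - exp (- \<i> * of_real t * of_real x) =
      exp (- \<i> * of_real t * of_real x) * (iexp (t * (x - y)) - 1)"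
    by (simp add: exp_add[symmetric] algebra_simps)
  moreover have "cmod (exp (- \<i> * of_real t * of_real x)) = 1" by (simp add: norm_exp_eq_Re)
  moreover have "cmod (iexp (t * (x - y)) - 1) \<le> \<bar>t * (x - y)\<bar>"
    using iexp_approx1[of "t * (x - y)" 0] by simp
  ultimately show ?thesis by (simp only: norm_mult abs_mult abs_minus_commute[of y x])
qed

context orthonormality_measure
begin

lemma integrable_opoly: "integrable \<mu> (\<lambda>x. opoly V n x)"
  using integrable_opoly_opoly[of n 1] by simp

lemma integral_abs_opoly_le: "(\<integral>x. \<bar>opoly V n x\<bar> \<partial>\<mu>) \<le> 1"
proof -
  have "(\<integral>x. \<bar>opoly V n x\<bar> \<partial>\<mu>) \<le> (\<integral>x. 1 / 2 + (opoly V n x * opoly V n x) / 2 \<partial>\<mu>)"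
  proof (rule integral_mono)
    show "integrable \<mu> (\<lambda>x. 1 / 2 + (opoly V n x * opoly V n x) / 2)"
      by (intro Bochner_Integration.integrable_add integrable_divide integrable_opoly_opoly) auto
    show "\<bar>opoly V n x\<bar> \<le> 1 / 2 + (opoly V n x * opoly V n x) / 2" for x :: real
      using sum_squares_bound[of 1 "\<bar>opoly V n x\<bar>"] unfolding power2_abs by (simp add: power2_eq_square)
  qed (intro integrable_abs integrable_opoly)
  also have "\<dots> = 1 / 2 + of_bool (n \<noteq> 0) / 2"
    using integrable_opoly_opoly[of n n] integral_opoly_opoly[of n n] prob_space by simp
  also have "\<dots> \<le> 1" by simp
  finally show ?thesis .
qed

text \<open>For a node \<open>x\<close> the function \<open>f\<^sub>x\<close> below represents the truncated eigenvector \<open>(p\<^sub>1(x), \<dots>, p\<^sub>N(x))\<close>, extended by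
  the entry \<open>c = - p\<^sub>N(x)/h\<close> at the barrier. The entry is chosen so that in \<open>(y - x) f\<^sub>x(y)\<close> the two terms with \<open>p\<^sub>N\<^sub>+\<^sub>1\<close> that are not small cancel: the jump
  \<open>p\<^sub>N(x)\<close> at the end of the truncation, and \<open>c h\<close>. What is left is \<open>c (p\<^sub>N + p\<^sub>N\<^sub>+\<^sub>2 - x p\<^sub>N\<^sub>+\<^sub>1)\<close>, of size \<open>1/h\<close>. The
  weighted sum of the \<open>f\<^sub>x\<close> is 1, which represents \<open>\<delta>\<^sub>1\<close>. In the bound, replacing \<open>exp(- \<i> t y)\<close> by \<open>exp(- \<i> t x)\<close> in front of \<open>f\<^sub>x\<close>
  costs the term with \<open>t\<close>, and replacing \<open>exp(- \<i> t x)\<close> by 1 costs the term with \<open>1/M\<close>.\<close>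

lemma fourier_recurrence:
  assumes N: "N \<ge> 2" and h: "V (N + 1) = h" "h \<ge> 1" and M: "M > 0" and k: "k > 0"
  obtains t where "real k \<le> t" "t \<le> real k * real M ^ N"
    "cmod (measure_fourier \<mu> t - 1) \<le> t * (6 + (V 1)\<^sup>2) / h + 8 * real N * real (N + 1) / real M"
proof -
  let ?X = "gauss_nodes V N" and ?w = "gauss_weight V N"
  have N1: "N \<ge> 1" using N by simp
  note X = gauss_nodes[OF N1, of V]
  note w_pos = gauss_weight_pos[OF N1, of V]
  obtain \<xi> where \<xi>: "bij_betw \<xi> {..<N} ?X"
    using ex_bij_betw_nat_finite[OF X(1)] X(2) by (auto simp: atLeast0LessThan)
  \<comment> \<open>Approximating \<open>k x/(2\<pi>)\<close> in place of \<open>x/(2\<pi>)\<close> makes the recurrence time \<open>t = k q\<close> at least \<open>k\<close>.\<close>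
  obtain q p where q: "0 < q" "q \<le> int (M ^ N)"
    and p: "\<And>i. i < N \<Longrightarrow> \<bar>of_int q * (real k * \<xi> i / (2 * pi)) - of_int (p i)\<bar> < 1 / M"
    using Dirichlet_approx_simult[OF M, of N "\<lambda>i. real k * \<xi> i / (2 * pi)"] by metis
  define t where "t = real k * of_int q"
  have t: "real k \<le> t" "t \<le> real k * real M ^ N"
  proof -
    have "1 \<le> real_of_int q" using q(1) by linarith
    then show "real k \<le> t" using mult_left_mono[of 1 "real_of_int q" "real k"] by (simp add: t_def)
    have "real_of_int q \<le> real M ^ N" using q(2) by (metis of_int_le_iff of_int_of_nat_eq of_nat_power)
    then show "t \<le> real k * real M ^ N" by (simp add: t_def mult_left_mono)
  qed
  have t0: "t \<ge> 0" using t(1) by simp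
  define e where "e y = exp (- \<i> * of_real t * of_real y)" for y :: real
  have e_norm: "cmod (e y) = 1" for y by (simp add: e_def norm_exp_eq_Re)
  have e_near: "cmod (e x - 1) \<le> 8 / M" if x: "x \<in> ?X" for x
  proof -
    obtain i where i: "i < N" "x = \<xi> i" using x \<xi> by (auto simp: bij_betw_def)
    define d where "d = of_int q * (real k * \<xi> i / (2 * pi)) - of_int (p i)"
    have tx: "t * x = 2 * pi * d + 2 * pi * of_int (p i)" by (simp add: t_def d_def i field_simps)
    have "e x = iexp (- (t * x))" by (simp add: e_def mult.assoc)
    also have "\<dots> = iexp (- (2 * pi * d)) * iexp (2 * pi * of_int (- p i))"
      unfolding tx by (simp add: exp_add[symmetric] algebra_simps)
    also have "iexp (2 * pi * of_int (- p i)) = 1"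
      using cis_multiple_2pi[of "of_int (- p i)"] by (simp add: cis_conv_exp)
    finally have "cmod (e x - 1) = cmod (iexp (- (2 * pi * d)) - 1)" by simp
    also have "\<dots> \<le> \<bar>2 * pi * d\<bar>" using iexp_approx1[of "- (2 * pi * d)" 0] by simp
    also have "\<dots> \<le> 8 * (1 / M)"
      unfolding abs_mult using p[OF i(1)] pi_less_4 by (intro mult_mono) (auto simp: d_def)
    finally show ?thesis by simp
  qed
  define c where "c x = - opoly V N x / h" for x
  define f where "f x y = (\<Sum>n=1..N. opoly V n x * opoly V n y) + c x * opoly V (N + 1) y" for x y
  have f_int: "integrable \<mu> (f x)" for x
    unfolding f_def[abs_def]
    by (intro Bochner_Integration.integrable_add Bochner_Integration.integrable_sum integrable_mult_right integrable_opoly)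
  have f_sum: "(\<Sum>x\<in>?X. ?w x * f x y) = 1" for y
  proof -
    have "(\<Sum>x\<in>?X. ?w x * f x y) = (\<Sum>x\<in>?X. \<Sum>n=1..N. opoly V n y * (?w x * (opoly V n x * opoly V 1 x)))
       - opoly V (N + 1) y / h * (\<Sum>x\<in>?X. ?w x * (opoly V N x * opoly V 1 x))"
      by (simp add: f_def c_def distrib_left right_diff_distrib sum.distrib sum_distrib_left sum_subtractf sum_negf mult_ac)
    also have "(\<Sum>x\<in>?X. ?w x * (opoly V N x * opoly V 1 x)) = 0"
      using N gauss_quadrature[of N N 1 V] by simp
    also have "(\<Sum>x\<in>?X. \<Sum>n=1..N. opoly V n y * (?w x * (opoly V n x * opoly V 1 x)))
       = (\<Sum>n=1..N. opoly V n y * (\<Sum>x\<in>?X. ?w x * (opoly V n x * opoly V 1 x)))"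
      by (subst sum.swap) (simp add: sum_distrib_left)
    also have "\<dots> = (\<Sum>n=1..N. if n = 1 then opoly V n y else 0)"
    proof (rule sum.cong[OF refl])
      fix n assume "n \<in> {1..N}"
      then show "opoly V n y * (\<Sum>x\<in>?X. ?w x * (opoly V n x * opoly V 1 x)) = (if n = 1 then opoly V n y else 0)"
        using N1 gauss_quadrature[of n N 1 V] by simp
    qed
    also have "\<dots> = 1" using N1 by (subst sum.delta) auto
    finally show ?thesis by simp
  qed
  have resid: "(y - x) * f x y = c x * (opoly V N y + opoly V (N + 2) y - x * opoly V (N + 1) y)"
    if "x \<in> ?X" for x y
  proof -
    have root: "opoly V (N + 1) x = 0" using that by (simp add: gauss_nodes_def)
    have "(y - x) * (\<Sum>n=1..N. opoly V n x * opoly V n y) = opoly V (N + 1) y * opoly V N x"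
      using christoffel_darboux[of y x V N] root by (simp add: mult.commute)
    moreover have "y * opoly V (N + 1) y = opoly V N y + opoly V (N + 2) y + h * opoly V (N + 1) y"
      using opoly_recurrence[of "N + 1" y V] h by simp
    moreover have "c x * h = - opoly V N x" using h by (simp add: c_def)
    ultimately show ?thesis unfolding f_def by algebra
  qed
  have int_resid: "(\<integral>y. \<bar>y - x\<bar> * \<bar>f x y\<bar> \<partial>\<mu>) \<le> \<bar>c x\<bar> * (2 + \<bar>x\<bar>)"
    "integrable \<mu> (\<lambda>y. \<bar>y - x\<bar> * \<bar>f x y\<bar>)" if x: "x \<in> ?X" for x
  proof -
    have eq: "\<bar>y - x\<bar> * \<bar>f x y\<bar> = \<bar>c x * (opoly V N y + opoly V (N + 2) y - x * opoly V (N + 1) y)\<bar>" for y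
      unfolding abs_mult[symmetric] resid[OF x] ..
    show "integrable \<mu> (\<lambda>y. \<bar>y - x\<bar> * \<bar>f x y\<bar>)"
      unfolding eq by (intro integrable_abs integrable_mult_right Bochner_Integration.integrable_diff
          Bochner_Integration.integrable_add integrable_opoly)
    have "(\<integral>y. \<bar>y - x\<bar> * \<bar>f x y\<bar> \<partial>\<mu>) \<le>
        (\<integral>y. \<bar>c x\<bar> * (\<bar>opoly V N y\<bar> + \<bar>opoly V (N + 2) y\<bar> + \<bar>x\<bar> * \<bar>opoly V (N + 1) y\<bar>) \<partial>\<mu>)"
      unfolding eq
    proof (rule integral_mono)
      fix y
      have "\<bar>opoly V N y + opoly V (N + 2) y - x * opoly V (N + 1) y\<bar> \<le>
          \<bar>opoly V N y\<bar> + \<bar>opoly V (N + 2) y\<bar> + \<bar>x\<bar> * \<bar>opoly V (N + 1) y\<bar>"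
        using abs_mult[of x "opoly V (N + 1) y"] by linarith
      then show "\<bar>c x * (opoly V N y + opoly V (N + 2) y - x * opoly V (N + 1) y)\<bar> \<le>
         \<bar>c x\<bar> * (\<bar>opoly V N y\<bar> + \<bar>opoly V (N + 2) y\<bar> + \<bar>x\<bar> * \<bar>opoly V (N + 1) y\<bar>)"
        unfolding abs_mult[of "c x"] by (intro mult_left_mono) auto
    qed (intro integrable_abs integrable_mult_right Bochner_Integration.integrable_diff
          Bochner_Integration.integrable_add integrable_opoly)+
    also have "\<dots> = \<bar>c x\<bar> * ((\<integral>y. \<bar>opoly V N y\<bar> \<partial>\<mu>) + (\<integral>y. \<bar>opoly V (N + 2) y\<bar> \<partial>\<mu>) + \<bar>x\<bar> * (\<integral>y. \<bar>opoly V (N + 1) y\<bar> \<partial>\<mu>))"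
      by (simp only: integral_mult_right_zero Bochner_Integration.integral_add Bochner_Integration.integrable_add
          integrable_mult_right integrable_abs[OF integrable_opoly])
    also have "\<dots> \<le> \<bar>c x\<bar> * (1 + 1 + \<bar>x\<bar> * 1)"
      by (intro mult_left_mono add_mono integral_abs_opoly_le) auto
    finally show "(\<integral>y. \<bar>y - x\<bar> * \<bar>f x y\<bar> \<partial>\<mu>) \<le> \<bar>c x\<bar> * (2 + \<bar>x\<bar>)" by simp
  qed
  have int_f: "(\<integral>y. \<bar>f x y\<bar> \<partial>\<mu>) \<le> (\<Sum>n=1..N. \<bar>opoly V n x\<bar>) + \<bar>c x\<bar>" for x
  proof -
    have "(\<integral>y. \<bar>f x y\<bar> \<partial>\<mu>) \<le> (\<integral>y. (\<Sum>n=1..N. \<bar>opoly V n x\<bar> * \<bar>opoly V n y\<bar>) + \<bar>c x\<bar> * \<bar>opoly V (N + 1) y\<bar> \<partial>\<mu>)"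
    proof (rule integral_mono)
      fix y
      show "\<bar>f x y\<bar> \<le> (\<Sum>n=1..N. \<bar>opoly V n x\<bar> * \<bar>opoly V n y\<bar>) + \<bar>c x\<bar> * \<bar>opoly V (N + 1) y\<bar>"
        unfolding f_def abs_mult[symmetric] by (intro order_trans[OF abs_triangle_ineq] add_mono sum_abs order_refl)
    qed (intro integrable_abs f_int Bochner_Integration.integrable_add Bochner_Integration.integrable_sum integrable_mult_right integrable_opoly)+
    also have "\<dots> = (\<Sum>n=1..N. \<bar>opoly V n x\<bar> * (\<integral>y. \<bar>opoly V n y\<bar> \<partial>\<mu>)) + \<bar>c x\<bar> * (\<integral>y. \<bar>opoly V (N + 1) y\<bar> \<partial>\<mu>)"
      using integrable_abs[OF integrable_opoly]
      by (subst Bochner_Integration.integral_add) (auto simp: Bochner_Integration.integral_sum)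
    also have "\<dots> \<le> (\<Sum>n=1..N. \<bar>opoly V n x\<bar> * 1) + \<bar>c x\<bar> * 1"
      by (intro add_mono sum_mono mult_left_mono integral_abs_opoly_le) auto
    finally show ?thesis by simp
  qed
  have e_meas [measurable]: "e \<in> borel_measurable borel" unfolding e_def[abs_def] by measurable
  have f_meas [measurable]: "f x \<in> borel_measurable borel" for x unfolding f_def[abs_def] by measurable
  have int_ef: "integrable \<mu> (\<lambda>y. (e y - 1) * of_real (f x y))" for x
  proof (rule Bochner_Integration.integrable_bound)
    show "integrable \<mu> (\<lambda>y. 2 * \<bar>f x y\<bar>)" by (intro integrable_mult_right integrable_abs f_int)
    have "cmod (e y - 1) \<le> 2" for y using norm_triangle_ineq4[of "e y" 1] e_norm[of y] by simp
    then show "AE y in \<mu>. norm ((e y - 1) * of_real (f x y)) \<le> norm (2 * \<bar>f x y\<bar>)"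
      by (intro AE_I2) (auto simp: norm_mult intro!: mult_right_mono)
  qed measurable
  have piece: "cmod (\<integral>y. (e y - 1) * of_real (f x y) \<partial>\<mu>) \<le>
      t * (\<bar>c x\<bar> * (2 + \<bar>x\<bar>)) + 8 / M * ((\<Sum>n=1..N. \<bar>opoly V n x\<bar>) + \<bar>c x\<bar>)" if x: "x \<in> ?X" for x
  proof -
    have "cmod (\<integral>y. (e y - 1) * of_real (f x y) \<partial>\<mu>) \<le> (\<integral>y. cmod ((e y - 1) * of_real (f x y)) \<partial>\<mu>)"
      by (rule integral_norm_bound)
    also have "\<dots> \<le> (\<integral>y. t * (\<bar>y - x\<bar> * \<bar>f x y\<bar>) + 8 / M * \<bar>f x y\<bar> \<partial>\<mu>)"
    proof (rule integral_mono)
      show "integrable \<mu> (\<lambda>y. t * (\<bar>y - x\<bar> * \<bar>f x y\<bar>) + 8 / M * \<bar>f x y\<bar>)"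
        by (intro Bochner_Integration.integrable_add integrable_mult_right int_resid(2)[OF x] integrable_abs f_int)
      fix y
      have "cmod (e y - 1) \<le> cmod (e y - e x) + cmod (e x - 1)" using norm_triangle_ineq[of "e y - e x" "e x - 1"] by simp
      also have "\<dots> \<le> t * \<bar>y - x\<bar> + 8 / M"
        using cmod_exp_diff_le[of t y x] t0 e_near[OF x] by (intro add_mono) (auto simp: e_def)
      finally have "cmod (e y - 1) * \<bar>f x y\<bar> \<le> (t * \<bar>y - x\<bar> + 8 / M) * \<bar>f x y\<bar>" by (intro mult_right_mono) auto
      then show "cmod ((e y - 1) * of_real (f x y)) \<le> t * (\<bar>y - x\<bar> * \<bar>f x y\<bar>) + 8 / M * \<bar>f x y\<bar>"
        unfolding norm_mult norm_of_real by (simp add: algebra_simps)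
    qed (intro integrable_norm int_ef)
    also have "\<dots> = t * (\<integral>y. \<bar>y - x\<bar> * \<bar>f x y\<bar> \<partial>\<mu>) + 8 / M * (\<integral>y. \<bar>f x y\<bar> \<partial>\<mu>)"
      using int_resid(2)[OF x] integrable_abs[OF f_int] by simp
    also have "\<dots> \<le> t * (\<bar>c x\<bar> * (2 + \<bar>x\<bar>)) + 8 / M * ((\<Sum>n=1..N. \<bar>opoly V n x\<bar>) + \<bar>c x\<bar>)"
      by (intro add_mono mult_left_mono int_resid(1)[OF x] int_f) (use t0 in auto)
    finally show ?thesis .
  qed
  have "measure_fourier \<mu> t - 1 = (\<integral>y. e y - 1 \<partial>\<mu>)"
  proof -
    have "integrable \<mu> e" by (rule integrable_const_bound[of _ 1]) (auto simp: e_norm)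
    then show ?thesis by (simp add: measure_fourier_def e_def[abs_def] prob_space[simplified])
  qed
  also have "\<dots> = (\<integral>y. (\<Sum>x\<in>?X. of_real (?w x) * ((e y - 1) * of_real (f x y))) \<partial>\<mu>)"
  proof (rule Bochner_Integration.integral_cong[OF refl])
    fix y
    have "(\<Sum>x\<in>?X. of_real (?w x) * ((e y - 1) * of_real (f x y))) = (e y - 1) * of_real (\<Sum>x\<in>?X. ?w x * f x y)"
      by (simp add: sum_distrib_left mult_ac)
    then show "e y - 1 = (\<Sum>x\<in>?X. of_real (?w x) * ((e y - 1) * of_real (f x y)))" by (simp only: f_sum) simp
  qed
  also have "\<dots> = (\<Sum>x\<in>?X. of_real (?w x) * (\<integral>y. (e y - 1) * of_real (f x y) \<partial>\<mu>))"
    using int_ef by (subst Bochner_Integration.integral_sum) auto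
  finally have "cmod (measure_fourier \<mu> t - 1) \<le> (\<Sum>x\<in>?X. cmod (of_real (?w x) * (\<integral>y. (e y - 1) * of_real (f x y) \<partial>\<mu>)))"
    by (simp only: norm_sum)
  also have "\<dots> \<le> (\<Sum>x\<in>?X. ?w x * (t * (\<bar>c x\<bar> * (2 + \<bar>x\<bar>)) + 8 / M * ((\<Sum>n=1..N. \<bar>opoly V n x\<bar>) + \<bar>c x\<bar>)))"
  proof (rule sum_mono)
    fix x assume x: "x \<in> ?X"
    show "cmod (of_real (?w x) * (\<integral>y. (e y - 1) * of_real (f x y) \<partial>\<mu>)) \<le>
      ?w x * (t * (\<bar>c x\<bar> * (2 + \<bar>x\<bar>)) + 8 / M * ((\<Sum>n=1..N. \<bar>opoly V n x\<bar>) + \<bar>c x\<bar>))"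
      unfolding norm_mult using w_pos[of x] piece[OF x] by (simp add: mult_left_mono)
  qed
  also have "\<dots> \<le> (\<Sum>x\<in>?X. t / h * (?w x * ((opoly V N x)\<^sup>2 / 2 + 4 + x\<^sup>2)) + 8 / M * real (N + 1))"
  proof (rule sum_mono)
    fix x assume x: "x \<in> ?X"
    have w1: "?w x \<le> 1" by (rule gauss_weight_le_1[OF N1])
    \<comment> \<open>From \<open>w \<le> 1\<close> and \<open>w p\<^sub>n(x)\<^sup>2 \<le> 1\<close>; both hold because \<open>1/w\<close> is the sum of all \<open>p\<^sub>n(x)\<^sup>2\<close>, of which the first is 1.\<close>
    have wp: "?w x * \<bar>opoly V n x\<bar> \<le> 1" if "n \<in> {1..N}" for n
    proof -
      have "(opoly V n x)\<^sup>2 \<le> (\<Sum>n=1..N. (opoly V n x)\<^sup>2)"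
        by (rule member_le_sum[OF that]) auto
      moreover have "?w x * (\<Sum>n=1..N. (opoly V n x)\<^sup>2) = 1"
        using sum_opoly_sq_ge_1[OF N1, of V x] by (simp add: gauss_weight_def)
      ultimately have "?w x * (opoly V n x)\<^sup>2 \<le> 1" using w_pos[of x] by (metis mult_left_mono less_imp_le)
      then have "?w x * (?w x * (opoly V n x)\<^sup>2) \<le> 1 * 1" using w1 w_pos[of x] by (intro mult_mono) auto
      then have "(?w x * \<bar>opoly V n x\<bar>)\<^sup>2 \<le> 1\<^sup>2" by (simp add: power_mult_distrib power2_eq_square mult_ac)
      then show ?thesis by (rule power2_le_imp_le) simp
    qed
    have cx: "\<bar>c x\<bar> = \<bar>opoly V N x\<bar> / h" using h by (simp add: c_def abs_divide)
    have "?w x * \<bar>c x\<bar> \<le> 1 / h" using wp[of N] N1 h unfolding cx by (simp add: divide_right_mono)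
    also have "\<dots> \<le> 1" using h by simp
    finally have wc: "?w x * \<bar>c x\<bar> \<le> 1" .
    have "?w x * ((\<Sum>n=1..N. \<bar>opoly V n x\<bar>) + \<bar>c x\<bar>) = (\<Sum>n=1..N. ?w x * \<bar>opoly V n x\<bar>) + ?w x * \<bar>c x\<bar>"
      by (simp add: distrib_left sum_distrib_left)
    also have "\<dots> \<le> (\<Sum>n=1..N. 1) + 1" by (intro add_mono sum_mono wp wc)
    finally have 1: "?w x * ((\<Sum>n=1..N. \<bar>opoly V n x\<bar>) + \<bar>c x\<bar>) \<le> real (N + 1)" by simp
    have "\<bar>opoly V N x\<bar> * (2 + \<bar>x\<bar>) \<le> (opoly V N x)\<^sup>2 / 2 + 4 + x\<^sup>2"
    proof -
      have "2 * \<bar>opoly V N x\<bar> * (2 + \<bar>x\<bar>) \<le> (opoly V N x)\<^sup>2 + (2 + \<bar>x\<bar>)\<^sup>2"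
        using sum_squares_bound[of "\<bar>opoly V N x\<bar>" "2 + \<bar>x\<bar>"] by simp
      moreover have "(2 + \<bar>x\<bar>)\<^sup>2 \<le> 8 + 2 * x\<^sup>2"
        using sum_squares_bound[of 2 "\<bar>x\<bar>"] by (simp add: power2_sum)
      ultimately show ?thesis by linarith
    qed
    then have "\<bar>c x\<bar> * (2 + \<bar>x\<bar>) \<le> ((opoly V N x)\<^sup>2 / 2 + 4 + x\<^sup>2) / h"
      using h unfolding cx by (simp add: divide_right_mono)
    then have 2: "?w x * (t * (\<bar>c x\<bar> * (2 + \<bar>x\<bar>))) \<le> ?w x * (t * (((opoly V N x)\<^sup>2 / 2 + 4 + x\<^sup>2) / h))"
      using t0 w_pos[of x] by (intro mult_left_mono) auto
    have 3: "8 / M * (?w x * ((\<Sum>n=1..N. \<bar>opoly V n x\<bar>) + \<bar>c x\<bar>)) \<le> 8 / M * real (N + 1)"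
      by (rule mult_left_mono[OF 1]) simp
    have "?w x * (t * (\<bar>c x\<bar> * (2 + \<bar>x\<bar>)) + 8 / M * ((\<Sum>n=1..N. \<bar>opoly V n x\<bar>) + \<bar>c x\<bar>)) =
        ?w x * (t * (\<bar>c x\<bar> * (2 + \<bar>x\<bar>))) + 8 / M * (?w x * ((\<Sum>n=1..N. \<bar>opoly V n x\<bar>) + \<bar>c x\<bar>))"
      by (subst distrib_left) (simp only: mult.left_commute)
    also have "\<dots> \<le> ?w x * (t * (((opoly V N x)\<^sup>2 / 2 + 4 + x\<^sup>2) / h)) + 8 / M * real (N + 1)"
      by (rule add_mono[OF 2 3])
    also have "?w x * (t * (((opoly V N x)\<^sup>2 / 2 + 4 + x\<^sup>2) / h)) = t / h * (?w x * ((opoly V N x)\<^sup>2 / 2 + 4 + x\<^sup>2))"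
      by (simp only: divide_inverse mult_ac)
    finally show "?w x * (t * (\<bar>c x\<bar> * (2 + \<bar>x\<bar>)) + 8 / M * ((\<Sum>n=1..N. \<bar>opoly V n x\<bar>) + \<bar>c x\<bar>)) \<le>
        t / h * (?w x * ((opoly V N x)\<^sup>2 / 2 + 4 + x\<^sup>2)) + 8 / M * real (N + 1)" .
  qed
  also have "\<dots> = t / h * (\<Sum>x\<in>?X. ?w x * ((opoly V N x)\<^sup>2 / 2 + 4 + x\<^sup>2)) + 8 / M * real (N + 1) * real N"
    by (simp add: sum.distrib sum_distrib_left X)
  also have "\<dots> \<le> t / h * (6 + (V 1)\<^sup>2) + 8 / M * real (N + 1) * real N"
  proof (intro add_right_mono mult_left_mono)
    show "(\<Sum>x\<in>?X. ?w x * ((opoly V N x)\<^sup>2 / 2 + 4 + x\<^sup>2)) \<le> 6 + (V 1)\<^sup>2"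
    proof -
      let ?E = "\<lambda>m n. \<Sum>x\<in>?X. ?w x * (opoly V m x * opoly V n x)"
      have "(\<Sum>x\<in>?X. ?w x * ((opoly V N x)\<^sup>2 / 2 + 4 + x\<^sup>2)) =
          ?E N N / 2 + 4 * ?E 1 1 + (?E 2 2 + 2 * V 1 * ?E 2 1 + (V 1)\<^sup>2 * ?E 1 1)"
        unfolding sum_distrib_left sum_divide_distrib sum.distrib[symmetric]
        by (rule sum.cong[OF refl]) (simp add: numeral_2_eq_2 power2_eq_square algebra_simps)
      also have "\<dots> = 1 / 2 + 4 + (1 + (V 1)\<^sup>2)"
        using gauss_quadrature[of 2 N 2 V] gauss_quadrature[of 2 N 1 V] gauss_quadrature[of 1 N 1 V] gauss_quadrature[of N N N V] N
        by simp
      finally show ?thesis by simp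
    qed
  qed (use t0 h in auto)
  finally have "cmod (measure_fourier \<mu> t - 1) \<le> t * (6 + (V 1)\<^sup>2) / h + 8 * real N * real (N + 1) / real M"
    by (simp add: mult_ac)
  then show ?thesis using that t by blast
qed

end

section \<open>The barrier potential\<close>

text \<open>For a barrier at \<open>n\<close>, the recurrence with \<open>N = n - 1\<close>, \<open>k = n\<close> and \<open>M = 32 n\<^sup>2\<close> happens before time \<open>n M\<^sup>n\<close>. The height is four times
  this time, multiplied by \<open>6 + n\<^sup>2\<close>, an upper bound for the factor \<open>6 + \<lambda>\<^sup>2\<close> in the error; then both error terms are at most
  1/4.\<close>

definition barrier_height :: "nat \<Rightarrow> real" where
  "barrier_height n = 4 * (real n * (32 * real n ^ 2) ^ n) * (6 + real n ^ 2)"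

definition barrier_potential :: "nat \<Rightarrow> real" where
  "barrier_potential n = (if \<exists>m\<ge>2. n = m\<^sup>2 then barrier_height n else 0)"

lemma barrier_height_ge: "n \<ge> 1 \<Longrightarrow> barrier_height n \<ge> real n"
proof -
  assume n: "n \<ge> 1"
  have "1 \<le> 32 * real n ^ 2" using n by (simp add: one_le_power order_trans[of 1 "real n ^ 2"])
  then have p: "1 \<le> (32 * real n ^ 2) ^ n" by (rule one_le_power)
  have "real n * 1 * 1 \<le> (real n * (32 * real n ^ 2) ^ n) * (4 * (6 + real n ^ 2))"
    using p by (intro mult_mono) auto
  also have "\<dots> = barrier_height n" by (simp only: barrier_height_def mult_ac)
  finally show ?thesis by simp
qed

lemma essential_spectrum_barrier_potential:
  "essential_spectrum (schrodinger barrier_potential) = complex_of_real ` {-2..2}"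
proof (rule essential_spectrum_sparse_barriers)
  fix L :: nat
  have "barrier_potential n = 0" if n: "n \<in> {L\<^sup>2+1..L\<^sup>2+L}" for n
  proof (rule ccontr)
    assume "barrier_potential n \<noteq> 0"
    then obtain m where m: "n = m\<^sup>2" by (auto simp: barrier_potential_def split: if_splits)
    have "m\<^sup>2 < (L + 1)\<^sup>2" "L\<^sup>2 < m\<^sup>2" using n unfolding m by (auto simp: power2_eq_square)
    then show False by (simp add: power_less_imp_less_base not_less_eq) (metis Suc_eq_plus1 less_antisym not_less_iff_gr_or_eq power_less_imp_less_base zero_le)
  qed
  then show "\<exists>a. \<forall>n\<in>{a+1..a+L}. barrier_potential n = 0" by blast
next
  fix E :: real
  obtain M :: nat where M: "E \<le> real M" using real_arch_simple by blast
  have "barrier_potential n = 0 \<or> E \<le> barrier_potential n" if "n > M" for n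
  proof (cases "barrier_potential n = 0")
    case False
    then have "barrier_potential n = barrier_height n" by (auto simp: barrier_potential_def split: if_splits)
    then show ?thesis using barrier_height_ge[of n] that M by auto
  qed simp
  then show "\<exists>M. \<forall>n>M. barrier_potential n = 0 \<or> E \<le> barrier_potential n" by blast
qed

text \<open>Beyond any time there is a barrier at \<open>n \<ge> \<bar>\<lambda>\<bar>\<close> whose recurrence brings the Fourier transform within 1/2 of 1.\<close>

lemma not_rajchman_barrier_potential:
  "\<not> rajchman (spectral_measure (delta1_perturbation (schrodinger barrier_potential) lam) delta1)"
proof
  define V where "V = barrier_potential(1 := barrier_potential 1 + lam)"
  assume "rajchman (spectral_measure (delta1_perturbation (schrodinger barrier_potential) lam) delta1)"
  then have raj: "rajchman (spectral_measure (schrodinger V) delta1)"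
    by (simp only: delta1_perturbation_schrodinger V_def)
  obtain \<mu> where "orthonormality_measure \<mu> V" by (rule exists_orthonormality_measure)
  then interpret orthonormality_measure \<mu> V .
  have "(measure_fourier \<mu> \<longlongrightarrow> 0) at_infinity" using raj by (simp add: rajchman_def spectral_measure_eq)
  then obtain b where b: "\<And>t. norm t \<ge> b \<Longrightarrow> dist (measure_fourier \<mu> t) 0 < 1 / 2"
    unfolding Lim_at_infinity by (meson half_gt_zero zero_less_one)
  obtain m :: nat where m: "max (max b \<bar>lam\<bar>) 2 \<le> real m" using real_arch_simple by blast
  define n where "n = m\<^sup>2"
  have m2: "m \<ge> 2" using m by simp
  have mn: "m \<le> n" "n \<ge> 4"
    using m2 power_mono[of 2 m 2] by (auto simp: n_def power2_eq_square)
  define N where "N = n - 1"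
  have N: "N + 1 = n" "N \<ge> 2" using mn by (auto simp: N_def)
  let ?M = "32 * n\<^sup>2"
  have VN: "V (N + 1) = barrier_height n"
  proof -
    have "\<exists>m\<ge>2. n = m\<^sup>2" using m2 n_def by blast
    moreover have "n \<noteq> 1" using mn by simp
    ultimately show ?thesis unfolding V_def N(1) by (simp add: barrier_potential_def)
  qed
  have not1: "\<not> (\<exists>m\<ge>2. 1 = (m::nat)\<^sup>2)"
    using power_mono[of 2 _ 2] by (metis one_less_numeral_iff one_less_power not_less pos2 semiring_norm(76) less_le_trans nat_neq_iff)
  have V1: "V 1 = lam" using not1 unfolding V_def barrier_potential_def by auto
  have h1: "barrier_height n \<ge> 1" using barrier_height_ge[of n] mn by simp
  obtain t where t: "real n \<le> t" "t \<le> real n * real ?M ^ N"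
    "cmod (measure_fourier \<mu> t - 1) \<le> t * (6 + (V 1)\<^sup>2) / barrier_height n + 8 * real N * real (N + 1) / real ?M"
    by (rule fourier_recurrence[OF N(2) VN h1, of ?M n]) (use mn in auto)
  have "t * (6 + (V 1)\<^sup>2) / barrier_height n \<le> 1 / 4"
  proof -
    have "\<bar>lam\<bar> \<le> real n" using m mn by simp
    then have lam: "6 + (V 1)\<^sup>2 \<le> 6 + real n ^ 2" unfolding V1 by (simp add: abs_le_square_iff[symmetric])
    have "1 \<le> ?M" using mn by (simp add: Suc_le_eq)
    then have "real 1 \<le> real ?M" by (rule of_nat_mono)
    then have "real ?M ^ N \<le> real ?M ^ n" using N by (intro power_increasing) auto
    then have "t \<le> real n * (32 * real n ^ 2) ^ n" using t(2) by (simp add: order_trans mult_left_mono)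
    then have "t * (6 + (V 1)\<^sup>2) \<le> (real n * (32 * real n ^ 2) ^ n) * (6 + real n ^ 2)"
      using lam by (intro mult_mono) auto
    then show ?thesis using h1 by (simp add: divide_le_eq) (simp add: barrier_height_def)
  qed
  moreover have "8 * real N * real (N + 1) / real ?M \<le> 1 / 4"
  proof -
    have "real N * real (N + 1) \<le> real n * real n" using N by (intro mult_mono) auto
    then show ?thesis using mn by (simp add: divide_le_eq power2_eq_square)
  qed
  ultimately have "cmod (measure_fourier \<mu> t - 1) \<le> 1 / 2" using t(3) by linarith
  moreover have "cmod (measure_fourier \<mu> t) < 1 / 2"
    using b[of t] t(1) m mn by simp
  ultimately show False
    using norm_triangle_ineq4[of "measure_fourier \<mu> t" "measure_fourier \<mu> t - 1"] by simp
qed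

theorem theorem1p2:
  shows "\<exists>V :: nat \<Rightarrow> real.
    essential_spectrum (schrodinger V) = complex_of_real ` {-2..2} \<and>
    (\<forall>lam :: real. \<not> rajchman (spectral_measure (delta1_perturbation (schrodinger V) lam) delta1))"
  using essential_spectrum_barrier_potential not_rajchman_barrier_potential by blast

end
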